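(* Let $M$ be a smooth manifold of dimension $2n$ and let $\Gamma$ be a pseudogroup of local diffeomorphisms of $M$. Let $\omega$ be a $\Gamma$-invariant symplectic form on $M$. Then the following conditions are equivalent: (1) every $\Gamma$-invariant cohomology class (that is, every class in $H^*_\Gamma(M)$) has a harmonic representative; (2) for each $k\in\{0,1,\ldots,n\}$ the mapping $L^k:H^{n-k}_\Gamma(M)\to H^{n+k}_\Gamma(M)$ is surjective, where $L[\xi]=[\omega\wedge\xi]$.
   Context: A form $\xi\in\Omega^*(M)$ is $\Gamma$-invariant if $\xi|_U=\gamma^*(\xi|_{\gamma(U)})$ for every $\gamma\in\Gamma$ with domain $U$. The $\Gamma$-invariant forms form a subcomplex $\Omega^*_\Gamma(M)$ of the de Rham complex; its cohomology is $H^*_\Gamma(M)$. A multivector field $X$ is $\Gamma$-invariant if $X|_{\gamma(U)}=\gamma_*(X|_U)$ for every $\gamma\in\Gamma$ with domain $U$; the space of these is $\mathfrak{X}^*_\Gamma(M)$. A $\Gamma$-invariant symplectic form is a closed nondegenerate $\omega\in\Omega^2_\Gamma(M)$. The map $X\mapsto\iota_X\omega$ from vector fields to $1$-forms extends multiplicatively to an algebra isomorphism from multivector fields to forms, which restricts to an isomorphism $\flat:\mathfrak{X}^*_\Gamma(M)\cong\Omega^*_\Gamma(M)$. The star operator is $$\star:\Omega^k_\Gamma(M)\to\Omega^{2n-k}_\Gamma(M),\qquad \star\xi=\iota_{\flat^{-1}(\xi)}\omega^n,$$ where $\iota_{X_1\wedge\dots\wedge X_k}\eta=\eta(X_1,\dots,X_k,\cdot)$.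 For $\xi\in\Omega^k_\Gamma(M)$ put $\delta\xi=(-1)^k\star d\star\xi$. A form $\xi\in\Omega^*_\Gamma(M)$ is harmonic if $d\xi=0$ and $\delta\xi=0$. *)

theory Defs
  imports "HOL-Analysis.Analysis" "HOL-Library.FuncSet"
begin

section \<open>Smooth maps and smooth manifolds\<close>

fun Ck_on :: "nat \<Rightarrow> 'e::real_normed_vector set \<Rightarrow> ('e \<Rightarrow> 'f::real_normed_vector) \<Rightarrow> bool" where
  "Ck_on 0 S f \<longleftrightarrow> continuous_on S f"
| "Ck_on (Suc k) S f \<longleftrightarrow>
     f differentiable_on S \<and> (\<forall>v. Ck_on k S (\<lambda>x. frechet_derivative f (at x) v))"

text \<open>Used only for open \<open>S\<close> in a finite-dimensional space, where continuity of all directional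
  derivatives of a differentiable map is continuity of its derivative.\<close>

definition smooth_on :: "'e::real_normed_vector set \<Rightarrow> ('e \<Rightarrow> 'f::real_normed_vector) \<Rightarrow> bool" where
  "smooth_on S f \<longleftrightarrow> (\<forall>k. Ck_on k S f)"

text \<open>The model space is a finite-dimensional real inner product space. The class
  \<open>euclidean_space\<close> is not used, because it excludes dimension 0.\<close>

definition has_dimension :: "'e::real_vector itself \<Rightarrow> nat \<Rightarrow> bool" where
  "has_dimension _ m \<longleftrightarrow>
     (\<exists>B :: 'e set. finite B \<and> independent B \<and> span B = UNIV \<and> card B = m)"

text \<open>A chart is a pair of its domain and its coordinate map; the values of the coordinate map
  outside the domain are irrelevant.\<close>

type_synonym ('a, 'e) chart = "'a set \<times> ('a \<Rightarrow> 'e)"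

definition chart_inv :: "('a, 'e) chart \<Rightarrow> 'e \<Rightarrow> 'a" where
  "chart_inv c = inv_into (fst c) (snd c)"

definition smooth_manifold ::
  "nat \<Rightarrow> 'a topology \<Rightarrow> ('a, 'e::real_inner) chart set \<Rightarrow> bool" where
  "smooth_manifold m X A \<longleftrightarrow>
     has_dimension TYPE('e) m \<and>
     Hausdorff_space X \<and> second_countable X \<and>
     (\<Union>c\<in>A. fst c) = topspace X \<and>
     (\<forall>(U, \<phi>)\<in>A. openin X U \<and> open (\<phi> ` U) \<and>
        homeomorphic_map (subtopology X U) (top_of_set (\<phi> ` U)) \<phi>) \<and>
     (\<forall>(U, \<phi>)\<in>A. \<forall>(V, \<psi>)\<in>A. smooth_on (\<phi> ` (U \<inter> V)) (\<psi> \<circ> chart_inv (U, \<phi>)))"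


section \<open>Pseudogroups of local diffeomorphisms\<close>

text \<open>A local map is a pair \<open>(U, f)\<close> with \<open>f\<close> extensional on \<open>U\<close>, so that equality of pairs is
  equality of maps with the same domain.\<close>

type_synonym 'a local_map = "'a set \<times> ('a \<Rightarrow> 'a)"

definition smooth_map :: "('a, 'e::real_normed_vector) chart set \<Rightarrow> 'a local_map \<Rightarrow> bool" where
  "smooth_map A = (\<lambda>(U, f). \<forall>(V, \<phi>)\<in>A. \<forall>(W, \<psi>)\<in>A.
     smooth_on (\<phi> ` (U \<inter> V \<inter> f -` W)) (\<psi> \<circ> f \<circ> chart_inv (V, \<phi>)))"

definition local_inv :: "'a local_map \<Rightarrow> 'a local_map" where
  "local_inv = (\<lambda>(U, f). (f ` U, restrict (inv_into U f) (f ` U)))"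

definition local_comp :: "'a local_map \<Rightarrow> 'a local_map \<Rightarrow> 'a local_map" where
  "local_comp = (\<lambda>(V, g) (U, f). (U \<inter> f -` V, restrict (g \<circ> f) (U \<inter> f -` V)))"

definition local_diffeo ::
  "'a topology \<Rightarrow> ('a, 'e::real_normed_vector) chart set \<Rightarrow> 'a local_map \<Rightarrow> bool" where
  "local_diffeo X A = (\<lambda>(U, f). openin X U \<and> openin X (f ` U) \<and> f \<in> extensional U \<and>
     homeomorphic_map (subtopology X U) (subtopology X (f ` U)) f \<and>
     smooth_map A (U, f) \<and> smooth_map A (local_inv (U, f)))"

definition pseudogroup ::
  "'a topology \<Rightarrow> ('a, 'e::real_normed_vector) chart set \<Rightarrow> 'a local_map set \<Rightarrow> bool" where
  "pseudogroup X A \<Gamma> \<longleftrightarrow>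
     (\<forall>g\<in>\<Gamma>. local_diffeo X A g) \<and>
     (\<forall>U. openin X U \<longrightarrow> (U, restrict id U) \<in> \<Gamma>) \<and>
     (\<forall>g\<in>\<Gamma>. local_inv g \<in> \<Gamma>) \<and>
     (\<forall>g\<in>\<Gamma>. \<forall>h\<in>\<Gamma>. local_comp g h \<in> \<Gamma>) \<and>
     (\<forall>(U, f)\<in>\<Gamma>. \<forall>V. openin X V \<and> V \<subseteq> U \<longrightarrow> (V, restrict f V) \<in> \<Gamma>) \<and>
     (\<forall>\<U> f. (\<forall>U\<in>\<U>. openin X U \<and> (U, restrict f U) \<in> \<Gamma>) \<and> local_diffeo X A (\<Union>\<U>, f)
        \<longrightarrow> (\<Union>\<U>, f) \<in> \<Gamma>)"


section \<open>Exterior algebra of a vector space\<close>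

text \<open>A possibly inhomogeneous alternating form on \<open>'e\<close> is a function on lists of vectors; its
  degree-\<open>k\<close> component is its restriction to lists of length \<open>k\<close>. Components of degree larger
  than the dimension vanish automatically.\<close>

type_synonym 'e alt = "'e list \<Rightarrow> real"

definition alternating :: "'e::real_vector alt \<Rightarrow> bool" where
  "alternating \<alpha> \<longleftrightarrow>
     (\<forall>us ws. linear (\<lambda>v. \<alpha> (us @ v # ws))) \<and> (\<forall>vs. \<not> distinct vs \<longrightarrow> \<alpha> vs = 0)"

definition alt_unit :: "'e alt" where
  "alt_unit vs = (if vs = [] then 1 else 0)"

text \<open>Sum over shuffles: \<open>I\<close> is the set of positions of the arguments passed to \<open>\<alpha>\<close>.\<close>

definition shuffle_sign :: "nat \<Rightarrow> nat set \<Rightarrow> real" where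
  "shuffle_sign m I = (-1) ^ card {(i, j). i \<in> I \<and> j \<in> {..<m} - I \<and> j < i}"

definition wedge :: "'e alt \<Rightarrow> 'e alt \<Rightarrow> 'e alt" (infixr "\<and>\<^sub>a" 70) where
  "(\<alpha> \<and>\<^sub>a \<beta>) vs = (\<Sum>I\<in>Pow {..<length vs}.
     shuffle_sign (length vs) I * \<alpha> (nths vs I) * \<beta> (nths vs ({..<length vs} - I)))"

text \<open>The exterior algebra \<open>\<Lambda>V\<close> of a finite-dimensional space \<open>V\<close> is identified with the dual of
  the space of alternating forms on \<open>V\<close>: the decomposable multivector
  \<open>v\<^sub>1 \<and> \<dots> \<and> v\<^sub>k\<close> is the functional \<open>\<alpha> \<mapsto> \<alpha> [v\<^sub>1, \<dots>, v\<^sub>k]\<close>, and these span the dual.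
  A functional is extended by 0 to functions that are not alternating.\<close>

type_synonym 'e multivec = "'e alt \<Rightarrow> real"

definition multivector :: "'e::real_vector multivec \<Rightarrow> bool" where
  "multivector P \<longleftrightarrow>
     (\<forall>\<alpha> \<beta>. alternating \<alpha> \<and> alternating \<beta> \<longrightarrow> P (\<lambda>vs. \<alpha> vs + \<beta> vs) = P \<alpha> + P \<beta>) \<and>
     (\<forall>r \<alpha>. alternating \<alpha> \<longrightarrow> P (\<lambda>vs. r * \<alpha> vs) = r * P \<alpha>) \<and>
     (\<forall>\<alpha>. \<not> alternating \<alpha> \<longrightarrow> P \<alpha> = 0)"

text \<open>Linear extension of \<open>v\<^sub>1 \<and> \<dots> \<and> v\<^sub>k \<mapsto> \<eta>(v\<^sub>1, \<dots>, v\<^sub>k, \<cdot>)\<close>.\<close>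

definition contract :: "'e multivec \<Rightarrow> 'e alt \<Rightarrow> 'e alt" where
  "contract P \<eta> ys = P (\<lambda>xs. \<eta> (xs @ ys))"

text \<open>Linear extension of \<open>v\<^sub>1 \<and> \<dots> \<and> v\<^sub>k \<mapsto> \<iota>\<^bsub>v\<^sub>1\<^esub>\<omega> \<and> \<dots> \<and> \<iota>\<^bsub>v\<^sub>k\<^esub>\<omega>\<close>, that is, the multiplicative
  extension of \<open>v \<mapsto> \<iota>\<^bsub>v\<^esub>\<omega>\<close>.\<close>

definition flat_alt :: "'e alt \<Rightarrow> 'e multivec \<Rightarrow> 'e alt" where
  "flat_alt \<omega> P ys = P (\<lambda>xs. foldr (\<and>\<^sub>a) (map (\<lambda>x zs. \<omega> (x # zs)) xs) alt_unit ys)"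


section \<open>Invariant forms and multivector fields\<close>

text \<open>Sections of tensor bundles are given by their local representatives: \<open>\<xi> c x\<close> is the value
  of \<open>\<xi>\<close>, written in the chart \<open>c\<close>, at the point with coordinates \<open>x\<close>. Representatives in
  different charts are related by the transition maps. Representatives are 0 where the chart is
  not defined, so that equality of sections is equality of functions.\<close>

type_synonym ('a, 'e) form = "('a, 'e) chart \<Rightarrow> 'e \<Rightarrow> 'e alt"
type_synonym ('a, 'e) multivec_field = "('a, 'e) chart \<Rightarrow> 'e \<Rightarrow> 'e multivec"

definition in_chart :: "('a, 'e) chart set \<Rightarrow> ('a, 'e) chart \<Rightarrow> 'e \<Rightarrow> bool" where
  "in_chart A c x \<longleftrightarrow> c \<in> A \<and> x \<in> snd c ` fst c"

definition coord_deriv ::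
  "('a, 'e::real_normed_vector) chart \<Rightarrow> ('a, 'e) chart \<Rightarrow> ('a \<Rightarrow> 'a) \<Rightarrow> 'a \<Rightarrow> 'e \<Rightarrow> 'e" where
  "coord_deriv c c' f p = frechet_derivative (snd c' \<circ> f \<circ> chart_inv c) (at (snd c p))"

text \<open>\<open>\<xi>|\<^sub>U = f\<^sup>*(\<xi>|\<^bsub>f(U)\<^esub>)\<close>, expressed in charts around \<open>p\<close> and \<open>f p\<close> for each \<open>p\<close> in \<open>U\<close>.\<close>

definition form_preserved ::
  "('a, 'e::real_normed_vector) chart set \<Rightarrow> 'a local_map \<Rightarrow> ('a, 'e) form \<Rightarrow> bool" where
  "form_preserved A = (\<lambda>(U, f) \<xi>. \<forall>c\<in>A. \<forall>c'\<in>A. \<forall>p\<in>U. p \<in> fst c \<and> f p \<in> fst c' \<longrightarrow>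
     (\<forall>vs. \<xi> c (snd c p) vs = \<xi> c' (snd c' (f p)) (map (coord_deriv c c' f p) vs)))"

text \<open>\<open>P|\<^bsub>f(U)\<^esub> = f\<^sub>*(P|\<^sub>U)\<close>, where \<open>(D\<^sub>*P)(\<alpha>) = P(D\<^sup>*\<alpha>)\<close> for a linear map \<open>D\<close>.\<close>

definition multivec_preserved ::
  "('a, 'e::real_normed_vector) chart set \<Rightarrow> 'a local_map \<Rightarrow> ('a, 'e) multivec_field \<Rightarrow> bool" where
  "multivec_preserved A = (\<lambda>(U, f) P. \<forall>c\<in>A. \<forall>c'\<in>A. \<forall>p\<in>U. p \<in> fst c \<and> f p \<in> fst c' \<longrightarrow>
     (\<forall>\<alpha>. alternating \<alpha> \<longrightarrow>
        P c' (snd c' (f p)) \<alpha> = P c (snd c p) (\<lambda>vs. \<alpha> (map (coord_deriv c c' f p) vs))))"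

definition forms :: "('a, 'e::real_normed_vector) chart set \<Rightarrow> ('a, 'e) form set" where
  "forms A = {\<xi>.
     (\<forall>c x. if in_chart A c x then alternating (\<xi> c x) else \<xi> c x = (\<lambda>vs. 0)) \<and>
     (\<forall>c\<in>A. \<forall>vs. smooth_on (snd c ` fst c) (\<lambda>x. \<xi> c x vs)) \<and>
     form_preserved A (UNIV, id) \<xi>}"

definition multivec_fields ::
  "('a, 'e::real_normed_vector) chart set \<Rightarrow> ('a, 'e) multivec_field set" where
  "multivec_fields A = {P.
     (\<forall>c x. if in_chart A c x then multivector (P c x) else P c x = (\<lambda>\<alpha>. 0)) \<and>
     (\<forall>c\<in>A. \<forall>\<alpha>. alternating \<alpha> \<longrightarrow> smooth_on (snd c ` fst c) (\<lambda>x. P c x \<alpha>)) \<and>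
     multivec_preserved A (UNIV, id) P}"

definition inv_forms ::
  "('a, 'e::real_normed_vector) chart set \<Rightarrow> 'a local_map set \<Rightarrow> ('a, 'e) form set" where
  "inv_forms A \<Gamma> = {\<xi> \<in> forms A. \<forall>g\<in>\<Gamma>. form_preserved A g \<xi>}"

definition inv_multivec_fields ::
  "('a, 'e::real_normed_vector) chart set \<Rightarrow> 'a local_map set \<Rightarrow> ('a, 'e) multivec_field set" where
  "inv_multivec_fields A \<Gamma> = {P \<in> multivec_fields A. \<forall>g\<in>\<Gamma>. multivec_preserved A g P}"

definition inv_forms_deg ::
  "('a, 'e::real_normed_vector) chart set \<Rightarrow> 'a local_map set \<Rightarrow> nat \<Rightarrow> ('a, 'e) form set" where
  "inv_forms_deg A \<Gamma> k = {\<xi> \<in> inv_forms A \<Gamma>. \<forall>c x vs. length vs \<noteq> k \<longrightarrow> \<xi> c x vs = 0}"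

definition form_component :: "nat \<Rightarrow> ('a, 'e) form \<Rightarrow> ('a, 'e) form" where
  "form_component k \<xi> c x vs = (if length vs = k then \<xi> c x vs else 0)"

definition form_wedge :: "('a, 'e) form \<Rightarrow> ('a, 'e) form \<Rightarrow> ('a, 'e) form" where
  "form_wedge \<xi> \<eta> c x = \<xi> c x \<and>\<^sub>a \<eta> c x"

definition form_one :: "('a, 'e) chart set \<Rightarrow> ('a, 'e) form" where
  "form_one A c x = (if in_chart A c x then alt_unit else (\<lambda>vs. 0))"

definition form_power :: "('a, 'e) chart set \<Rightarrow> ('a, 'e) form \<Rightarrow> nat \<Rightarrow> ('a, 'e) form" where
  "form_power A \<omega> m = (form_wedge \<omega> ^^ m) (form_one A)"

text \<open>\<open>d\<xi>(v\<^sub>0, \<dots>, v\<^sub>k) = \<Sum>\<^sub>i (-1)\<^sup>i v\<^sub>i(\<xi>(v\<^sub>0, \<dots>, v\<^sub>i omitted, \<dots>, v\<^sub>k))\<close> for vector fields that are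
  constant in the chart.\<close>

definition ext_d :: "('a, 'e::real_normed_vector) chart set \<Rightarrow> ('a, 'e) form \<Rightarrow> ('a, 'e) form" where
  "ext_d A \<xi> c x vs = (if in_chart A c x
     then \<Sum>i<length vs. (-1) ^ i *
       frechet_derivative (\<lambda>y. \<xi> c y (take i vs @ drop (Suc i) vs)) (at x) (vs ! i)
     else 0)"


section \<open>Invariant cohomology\<close>

definition inv_closed ::
  "('a, 'e::real_normed_vector) chart set \<Rightarrow> 'a local_map set \<Rightarrow> ('a, 'e) form set" where
  "inv_closed A \<Gamma> = {\<xi> \<in> inv_forms A \<Gamma>. ext_d A \<xi> = (\<lambda>c x vs. 0)}"

definition cohomologous ::
  "('a, 'e::real_normed_vector) chart set \<Rightarrow> 'a local_map set \<Rightarrow> ('a, 'e) form rel" where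
  "cohomologous A \<Gamma> = {(\<xi>, \<zeta>). \<xi> \<in> inv_closed A \<Gamma> \<and> \<zeta> \<in> inv_closed A \<Gamma> \<and>
     (\<exists>\<eta>\<in>inv_forms A \<Gamma>. \<zeta> = (\<lambda>c x vs. \<xi> c x vs + ext_d A \<eta> c x vs))}"

definition inv_cohomology ::
  "('a, 'e::real_normed_vector) chart set \<Rightarrow> 'a local_map set \<Rightarrow> ('a, 'e) form set set" where
  "inv_cohomology A \<Gamma> = inv_closed A \<Gamma> // cohomologous A \<Gamma>"

text \<open>The degree-\<open>k\<close> summand of the cohomology of the total complex.\<close>

definition inv_cohomology_deg ::
  "('a, 'e::real_normed_vector) chart set \<Rightarrow> 'a local_map set \<Rightarrow> nat \<Rightarrow> ('a, 'e) form set set" where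
  "inv_cohomology_deg A \<Gamma> k =
     {cohomologous A \<Gamma> `` {\<xi>} |\<xi>. \<xi> \<in> inv_closed A \<Gamma> \<inter> inv_forms_deg A \<Gamma> k}"

text \<open>\<open>L[\<xi>] = [\<omega> \<and> \<xi>]\<close>; all members of the union are equal.\<close>

definition lefschetz ::
  "('a, 'e::real_normed_vector) chart set \<Rightarrow> 'a local_map set \<Rightarrow> ('a, 'e) form \<Rightarrow>
   ('a, 'e) form set \<Rightarrow> ('a, 'e) form set" where
  "lefschetz A \<Gamma> \<omega> C = (\<Union>\<xi>\<in>C. cohomologous A \<Gamma> `` {form_wedge \<omega> \<xi>})"


section \<open>Symplectic star operator and harmonic forms\<close>

definition nondegenerate :: "('a, 'e::real_vector) chart set \<Rightarrow> ('a, 'e) form \<Rightarrow> bool" where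
  "nondegenerate A \<omega> \<longleftrightarrow>
     (\<forall>c x v. in_chart A c x \<and> (\<forall>w. \<omega> c x [v, w] = 0) \<longrightarrow> v = 0)"

definition inv_symplectic ::
  "('a, 'e::real_normed_vector) chart set \<Rightarrow> 'a local_map set \<Rightarrow> ('a, 'e) form \<Rightarrow> bool" where
  "inv_symplectic A \<Gamma> \<omega> \<longleftrightarrow>
     \<omega> \<in> inv_forms_deg A \<Gamma> 2 \<and> \<omega> \<in> inv_closed A \<Gamma> \<and> nondegenerate A \<omega>"

definition flat :: "('a, 'e) form \<Rightarrow> ('a, 'e) multivec_field \<Rightarrow> ('a, 'e) form" where
  "flat \<omega> P c x = flat_alt (\<omega> c x) (P c x)"

text \<open>\<open>n\<close> is half the dimension.\<close>

definition star ::
  "('a, 'e::real_normed_vector) chart set \<Rightarrow> 'a local_map set \<Rightarrow> ('a, 'e) form \<Rightarrow> nat \<Rightarrow>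
   ('a, 'e) form \<Rightarrow> ('a, 'e) form" where
  "star A \<Gamma> \<omega> n \<xi> c x =
     contract (inv_into (inv_multivec_fields A \<Gamma>) (flat \<omega>) \<xi> c x) (form_power A \<omega> n c x)"

text \<open>\<open>\<delta> = (-1)\<^sup>k \<star> d \<star>\<close> in degree \<open>k\<close>, extended linearly to inhomogeneous forms.\<close>

definition codiff ::
  "('a, 'e::real_normed_vector) chart set \<Rightarrow> 'a local_map set \<Rightarrow> ('a, 'e) form \<Rightarrow> nat \<Rightarrow>
   ('a, 'e) form \<Rightarrow> ('a, 'e) form" where
  "codiff A \<Gamma> \<omega> n \<xi> c x vs = (\<Sum>k\<le>2*n.
     (-1) ^ k * star A \<Gamma> \<omega> n (ext_d A (star A \<Gamma> \<omega> n (form_component k \<xi>))) c x vs)"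

definition harmonic ::
  "('a, 'e::real_normed_vector) chart set \<Rightarrow> 'a local_map set \<Rightarrow> ('a, 'e) form \<Rightarrow> nat \<Rightarrow>
   ('a, 'e) form \<Rightarrow> bool" where
  "harmonic A \<Gamma> \<omega> n \<xi> \<longleftrightarrow> \<xi> \<in> inv_forms A \<Gamma> \<and>
     ext_d A \<xi> = (\<lambda>c x vs. 0) \<and> codiff A \<Gamma> \<omega> n \<xi> = (\<lambda>c x vs. 0)"

end

theory Submission
  imports Defs "HOL-Library.Function_Algebras"
begin

text \<open>
  The product \<open>L\<close> with the symplectic form commutes with \<open>d\<close>, because
  the symplectic form is closed. Call a form \<open>x\<close> of degree \<open>n - k\<close>
  primitive if \<open>L\<^bsup>k+1\<^esup>x = 0\<close>. On forms, before passing to cohomology,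
  \<open>L\<^sup>k\<close> is always a bijection from degree \<open>n - k\<close> to degree
  \<open>n + k\<close>; hence every form is in a unique way a sum of terms \<open>L\<^sup>i
  x\<^sub>i\<^sub>j\<close> with \<open>x\<^sub>i\<^sub>j\<close> primitive of degree \<open>n -
  (i + j)\<close>. The star operator respects this decomposition: \<open>\<star>L\<^sup>i x =
  c\<^sub>i\<^sub>j L\<^sup>j x\<close> with constants \<open>c\<^sub>i\<^sub>j \<noteq> 0\<close>
  (\<open>star_pt_primitive\<close>).

  The heart of the matter is that a form is harmonic if and only if all its primitive components
  are closed. For a primitive \<open>x\<close> the bijectivity of \<open>L\<^sup>k\<close> gives
  \<open>dx = a + Lb\<close> with \<open>a\<close> and \<open>b\<close> primitive
  (\<open>d_Prim\<close>). With \<open>dx\<^sub>i\<^sub>j = a\<^sub>i\<^sub>j + L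
  b\<^sub>i\<^sub>j\<close>, the component equations of \<open>d\<xi> = 0\<close> pair each
  \<open>b\<^sub>i\<^sub>j\<close> with the neighbour \<open>a' = a\<^bsub>i+1,j+1\<^esub>\<close>
  in \<open>a' + b\<^sub>i\<^sub>j = 0\<close>, and those of \<open>\<delta>\<xi> = 0\<close> pair
  them in \<open>c' a' + c\<^sub>i\<^sub>j b\<^sub>i\<^sub>j = 0\<close> with \<open>c' =
  c\<^bsub>i+1,j+1\<^esub>\<close>. The two constants have opposite signs, so \<open>a'\<close>
  and \<open>b\<^sub>i\<^sub>j\<close> both vanish (\<open>harmonic_imp_closed_primitive\<close>).

  If every class has a harmonic representative, a class of degree \<open>n + k\<close> is
  represented by a sum of terms \<open>L\<^sup>i x\<^sub>i\<^sub>j\<close> with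
  \<open>x\<^sub>i\<^sub>j\<close> closed and \<open>i = k + j\<close>, from which
  \<open>L\<^sup>k\<close> can be divided out. Conversely, let all maps \<open>L\<^sup>k\<close>
  be surjective in cohomology and let \<open>z\<close> be closed of degree \<open>n - k\<close>.
  Then \<open>L\<^bsup>k+1\<^esup>z = L\<^bsup>k+2\<^esup>w + d\<beta>\<close> for a closed form
  \<open>w\<close> of smaller degree, and with \<open>\<beta> =
  L\<^bsup>k+1\<^esup>\<alpha>\<close> the form \<open>z - Lw - d\<alpha>\<close> is closed and
  primitive; induction on the degree treats \<open>w\<close>
  (\<open>harmonic_iff_lefschetz\<close>).

  The rest makes this available for invariant forms. At a point, everything is derived from
  contraction with vectors, which is a derivation of the wedge product. The inverse of
  \<open>L\<^sup>k\<close> and the inverse of \<open>\<flat>\<close> are given by formulas that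
  show smoothness in the point (\<open>Lk_surj_family\<close>, \<open>smooth_sharp\<close>), and
  both are invariant because they are unique. Finally \<open>d\<close> preserves invariance
  because it commutes with pullbacks, by the symmetry of second derivatives
  (\<open>dd_pull\<close>).
\<close>

section \<open>Pointwise vector space structure on functions\<close>

text \<open>Alternating forms, multivectors and forms on a manifold are all functions into the
  reals. With the pointwise structure they form real vector spaces, so that subspaces, linear maps
  and finite sums are available for them.\<close>

instantiation "fun" :: (type, scaleR) scaleR
begin
definition "r *\<^sub>R f = (\<lambda>x. r *\<^sub>R f x)"
instance ..
end

lemma scaleR_fun_apply [simp]: "(r *\<^sub>R f) x = r *\<^sub>R f x"
  by (simp add: scaleR_fun_def)

instance "fun" :: (type, real_vector) real_vector
  by standard (simp_all add: fun_eq_iff algebra_simps)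

lemma sum_fun_apply: "(\<Sum>i\<in>I. f i) x = (\<Sum>i\<in>I. f i x)"
  by (induction I rule: infinite_finite_induct) auto

section \<open>The wedge product of functions on lists\<close>

text \<open>Contraction with a vector. Since it removes the first entry of the argument list,
  identities between forms are proved by induction on that list, one contraction for each
  entry.\<close>

definition \<iota> :: "'e \<Rightarrow> 'e alt \<Rightarrow> 'e alt" where
  "\<iota> v \<alpha> = (\<lambda>vs. \<alpha> (v # vs))"

definition grade_inv :: "'e alt \<Rightarrow> 'e alt" where
  "grade_inv \<alpha> = (\<lambda>vs. (-1) ^ length vs * \<alpha> vs)"

definition homog :: "nat \<Rightarrow> 'e alt \<Rightarrow> bool" where
  "homog k \<alpha> \<longleftrightarrow> (\<forall>vs. length vs \<noteq> k \<longrightarrow> \<alpha> vs = 0)"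

lemma \<iota>_apply [simp]: "\<iota> v \<alpha> vs = \<alpha> (v # vs)"
  by (simp add: \<iota>_def)

lemma \<iota>_add [simp]: "\<iota> v (\<alpha> + \<beta>) = \<iota> v \<alpha> + \<iota> v \<beta>"
  by (auto simp: fun_eq_iff)

lemma \<iota>_scale [simp]: "\<iota> v (r *\<^sub>R \<alpha>) = r *\<^sub>R \<iota> v \<alpha>"
  by (auto simp: fun_eq_iff)

lemma \<iota>_minus [simp]: "\<iota> v (- \<alpha>) = - \<iota> v \<alpha>"
  by (auto simp: fun_eq_iff)

lemma \<iota>_zero [simp]: "\<iota> v 0 = 0"
  by (auto simp: fun_eq_iff)

lemma \<iota>_grade_inv: "\<iota> v (grade_inv \<alpha>) = - grade_inv (\<iota> v \<alpha>)"
  by (auto simp: fun_eq_iff grade_inv_def)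

lemma grade_inv_grade_inv [simp]: "grade_inv (grade_inv \<alpha>) = \<alpha>"
  by (auto simp: fun_eq_iff grade_inv_def power_mult_distrib[symmetric] mult.assoc[symmetric])

lemma grade_inv_homog: "homog k \<alpha> \<Longrightarrow> grade_inv \<alpha> = (-1) ^ k *\<^sub>R \<alpha>"
  by (auto simp: fun_eq_iff grade_inv_def homog_def)

lemma homog_\<iota>: "homog (Suc k) \<alpha> \<Longrightarrow> homog k (\<iota> v \<alpha>)"
  by (auto simp: homog_def)

lemma homog_\<iota>_0: "homog 0 \<alpha> \<Longrightarrow> \<iota> v \<alpha> = 0"
  by (auto simp: homog_def fun_eq_iff)

lemma homog_0_unit: "homog 0 \<alpha> \<Longrightarrow> \<alpha> = \<alpha> [] *\<^sub>R alt_unit"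
  by (auto simp: fun_eq_iff homog_def alt_unit_def)

lemma homog_eqI:
  assumes "homog k \<alpha>" "homog k \<beta>" "k > 0" "\<And>v. \<iota> v \<alpha> = \<iota> v \<beta>"
  shows "\<alpha> = \<beta>"
proof
  fix vs show "\<alpha> vs = \<beta> vs"
  proof (cases vs)
    case Nil then show ?thesis using assms by (auto simp: homog_def)
  next
    case (Cons v ws) then show ?thesis using fun_cong[OF assms(4)[of v], of ws] by simp
  qed
qed

lemma homog_add: "homog k \<alpha> \<Longrightarrow> homog k \<beta> \<Longrightarrow> homog k (\<alpha> + \<beta>)"
  and homog_diff: "homog k \<alpha> \<Longrightarrow> homog k \<beta> \<Longrightarrow> homog k (\<alpha> - \<beta>)"
  and homog_scale: "homog k \<alpha> \<Longrightarrow> homog k (r *\<^sub>R \<alpha>)"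
  and homog_zero: "homog k 0"
  and homog_unit: "homog 0 alt_unit"
  by (auto simp: homog_def alt_unit_def)

lemma homog_sum: "(\<And>i. i \<in> I \<Longrightarrow> homog k (f i)) \<Longrightarrow> homog k (\<Sum>i\<in>I. f i)"
  by (auto simp: homog_def sum_fun_apply)

lemma wedge_Nil: "(\<alpha> \<and>\<^sub>a \<beta>) [] = \<alpha> [] * \<beta> []"
  by (simp add: wedge_def shuffle_sign_def)

lemma sum_Pow_lessThan_Suc:
  "(\<Sum>I\<in>Pow {..<Suc n}. f I) =
   (\<Sum>J\<in>Pow {..<n}. f (insert 0 (Suc ` J))) + (\<Sum>J\<in>Pow {..<n}. (f (Suc ` J) :: real))"
proof -
  have "{..<Suc n} = insert 0 (Suc ` {..<n})"
    by (simp add: lessThan_Suc_eq_insert_0)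
  then have *: "Pow {..<Suc n} = Pow (Suc ` {..<n}) \<union> insert 0 ` Pow (Suc ` {..<n})"
    by (simp add: Pow_insert)
  have P: "Pow (Suc ` {..<n}) = (\<lambda>J. Suc ` J) ` Pow {..<n}"
    by (simp add: image_Pow_surj)
  have i1: "inj_on (\<lambda>J. Suc ` J) (Pow {..<n})"
    by (auto intro!: inj_onI simp: inj_image_eq_iff)
  have i2: "inj_on (\<lambda>J. insert 0 (Suc ` J)) (Pow {..<n})"
  proof (rule inj_onI)
    fix J K assume "insert 0 (Suc ` J) = insert 0 (Suc ` K)"
    then have "insert 0 (Suc ` J) - {0} = insert 0 (Suc ` K) - {0}" by simp
    moreover have "insert 0 (Suc ` J) - {0} = Suc ` J" for J by auto
    ultimately show "J = K" by (simp add: inj_image_eq_iff)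
  qed
  have "(\<Sum>I\<in>Pow {..<Suc n}. f I) = sum f (Pow (Suc ` {..<n})) + sum f (insert 0 ` Pow (Suc ` {..<n}))"
    unfolding * by (rule sum.union_disjoint) auto
  also have "sum f (Pow (Suc ` {..<n})) = (\<Sum>J\<in>Pow {..<n}. f (Suc ` J))"
    unfolding P using i1 by (simp add: sum.reindex)
  also have "sum f (insert 0 ` Pow (Suc ` {..<n})) = (\<Sum>J\<in>Pow {..<n}. f (insert 0 (Suc ` J)))"
    unfolding P image_image using i2 by (simp add: sum.reindex)
  finally show ?thesis by simp
qed

lemma shuffle_sign_insert_0: "shuffle_sign (Suc n) (insert 0 (Suc ` J)) = shuffle_sign n J"
proof -
  have "{(i, j). i \<in> insert 0 (Suc ` J) \<and> j \<in> {..<Suc n} - insert 0 (Suc ` J) \<and> j < i}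
      = map_prod Suc Suc ` {(i, j). i \<in> J \<and> j \<in> {..<n} - J \<and> j < i}" (is "?A = ?B")
  proof (rule set_eqI)
    fix p :: "nat \<times> nat"
    obtain i j where p: "p = (i, j)" by fastforce
    show "p \<in> ?A \<longleftrightarrow> p \<in> ?B"
      unfolding p by (cases i; cases j) (auto simp: image_iff)
  qed
  then show ?thesis
    unfolding shuffle_sign_def by (simp add: card_image inj_on_def)
qed

lemma shuffle_sign_Suc:
  assumes "J \<subseteq> {..<n}"
  shows "shuffle_sign (Suc n) (Suc ` J) = (-1) ^ card J * shuffle_sign n J"
proof -
  let ?C = "{(i, j). i \<in> J \<and> j \<in> {..<n} - J \<and> j < i}"
  have "{(i, j). i \<in> Suc ` J \<and> j \<in> {..<Suc n} - Suc ` J \<and> j < i}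
      = (\<lambda>i. (Suc i, 0)) ` J \<union> map_prod Suc Suc ` ?C" (is "?A = ?B")
  proof (rule set_eqI)
    fix p :: "nat \<times> nat"
    obtain i j where p: "p = (i, j)" by fastforce
    show "p \<in> ?A \<longleftrightarrow> p \<in> ?B"
      unfolding p by (cases i; cases j) (auto simp: image_iff)
  qed
  moreover have "card ((\<lambda>i. (Suc i, 0::nat)) ` J \<union> map_prod Suc Suc ` ?C) = card J + card ?C"
  proof -
    have fJ: "finite J" using assms finite_subset by blast
    have "?C \<subseteq> J \<times> {..<n}" by auto
    then have fC: "finite ?C" using fJ by (meson finite_SigmaI finite_lessThan finite_subset)
    have "card ((\<lambda>i. (Suc i, 0::nat)) ` J \<union> map_prod Suc Suc ` ?C)
      = card ((\<lambda>i. (Suc i, 0::nat)) ` J) + card (map_prod Suc Suc ` ?C)"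
      using fJ fC by (intro card_Un_disjoint) auto
    also have "\<dots> = card J + card ?C"
      by (simp add: card_image inj_on_def)
    finally show ?thesis .
  qed
  ultimately show ?thesis
    unfolding shuffle_sign_def by (simp add: power_add)
qed

text \<open>A shuffle either gives the first argument to \<open>\<alpha>\<close>, or gives it to
  \<open>\<beta>\<close>, in which case it passes all arguments of \<open>\<alpha>\<close> and
  contributes a sign. So contraction is a graded derivation of the wedge product. Associativity,
  graded commutativity and the alternating property follow from this recursion.\<close>

lemma wedge_Cons:
  "(\<alpha> \<and>\<^sub>a \<beta>) (v # vs) = (\<iota> v \<alpha> \<and>\<^sub>a \<beta>) vs + (grade_inv \<alpha> \<and>\<^sub>a \<iota> v \<beta>) vs"
proof -
  let ?n = "length vs"
  have c1: "{..<Suc ?n} - insert 0 (Suc ` J) = Suc ` ({..<?n} - J)" for J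
  proof (rule set_eqI)
    fix x show "x \<in> {..<Suc ?n} - insert 0 (Suc ` J) \<longleftrightarrow> x \<in> Suc ` ({..<?n} - J)"
      by (cases x) auto
  qed
  have c2: "{..<Suc ?n} - Suc ` J = insert 0 (Suc ` ({..<?n} - J))" for J
  proof (rule set_eqI)
    fix x show "x \<in> {..<Suc ?n} - Suc ` J \<longleftrightarrow> x \<in> insert 0 (Suc ` ({..<?n} - J))"
      by (cases x) auto
  qed
  have s1: "{j. Suc j \<in> insert 0 (Suc ` J)} = J" "{j. Suc j \<in> Suc ` J} = J" for J
    by auto
  have n1: "nths (v # vs) (insert 0 (Suc ` J)) = v # nths vs J" for J
    by (simp only: nths_Cons s1) simp
  have n2: "nths (v # vs) (Suc ` J) = nths vs J" for J
    by (simp only: nths_Cons s1) simp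
  have len: "length (nths vs J) = card J" if "J \<in> Pow {..<?n}" for J
  proof -
    have "{i. i < length vs \<and> i \<in> J} = J" using that by auto
    then show ?thesis by (simp add: length_nths)
  qed
  show ?thesis
    unfolding wedge_def list.size add_0_right add_Suc_right sum_Pow_lessThan_Suc c1 c2 n1 n2 \<iota>_apply
      shuffle_sign_insert_0 grade_inv_def
    by (intro arg_cong2[where f="(+)"] sum.cong refl) (auto simp: shuffle_sign_Suc len)
qed

lemma \<iota>_wedge: "\<iota> v (\<alpha> \<and>\<^sub>a \<beta>) = \<iota> v \<alpha> \<and>\<^sub>a \<beta> + grade_inv \<alpha> \<and>\<^sub>a \<iota> v \<beta>"
  by (auto simp: fun_eq_iff wedge_Cons)

lemma wedge_linear_left: "linear (\<lambda>\<alpha>. \<alpha> \<and>\<^sub>a \<beta>)"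
  by (rule linearI) (auto simp: fun_eq_iff wedge_def sum.distrib sum_distrib_left algebra_simps)

lemma wedge_linear_right: "linear (\<lambda>\<beta>. \<alpha> \<and>\<^sub>a \<beta>)"
  by (rule linearI) (auto simp: fun_eq_iff wedge_def sum.distrib sum_distrib_left algebra_simps)

lemmas wedge_simps [simp] =
  linear_add[OF wedge_linear_left] linear_add[OF wedge_linear_right]
  linear_diff[OF wedge_linear_left] linear_diff[OF wedge_linear_right]
  linear_scale[OF wedge_linear_left] linear_scale[OF wedge_linear_right]
  linear_neg[OF wedge_linear_left] linear_neg[OF wedge_linear_right]
  linear_0[OF wedge_linear_left] linear_0[OF wedge_linear_right]

lemma grade_inv_wedge: "grade_inv (\<alpha> \<and>\<^sub>a \<beta>) = grade_inv \<alpha> \<and>\<^sub>a grade_inv \<beta>"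
proof
  fix vs show "grade_inv (\<alpha> \<and>\<^sub>a \<beta>) vs = (grade_inv \<alpha> \<and>\<^sub>a grade_inv \<beta>) vs"
  proof (induction vs arbitrary: \<alpha> \<beta>)
    case Nil then show ?case by (simp add: grade_inv_def wedge_Nil)
  next
    case (Cons v vs)
    have "grade_inv (\<alpha> \<and>\<^sub>a \<beta>) (v # vs)
      = - (grade_inv (\<iota> v \<alpha> \<and>\<^sub>a \<beta>) vs + grade_inv (grade_inv \<alpha> \<and>\<^sub>a \<iota> v \<beta>) vs)"
      by (simp add: grade_inv_def wedge_Cons algebra_simps)
    then show ?case
      unfolding Cons.IH by (simp add: wedge_Cons \<iota>_grade_inv)
  qed
qed

lemma wedge_assoc: "(\<alpha> \<and>\<^sub>a \<beta>) \<and>\<^sub>a \<gamma> = \<alpha> \<and>\<^sub>a \<beta> \<and>\<^sub>a \<gamma>"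
proof
  fix vs show "((\<alpha> \<and>\<^sub>a \<beta>) \<and>\<^sub>a \<gamma>) vs = (\<alpha> \<and>\<^sub>a \<beta> \<and>\<^sub>a \<gamma>) vs"
    by (induction vs arbitrary: \<alpha> \<beta> \<gamma>)
      (simp_all add: wedge_Nil wedge_Cons \<iota>_wedge grade_inv_wedge)
qed

lemma alt_unit_wedge [simp]: "alt_unit \<and>\<^sub>a \<beta> = \<beta>"
proof
  have *: "\<iota> v alt_unit = 0" "grade_inv alt_unit = alt_unit" for v :: 'a
    by (auto simp: fun_eq_iff alt_unit_def grade_inv_def)
  fix vs show "(alt_unit \<and>\<^sub>a \<beta>) vs = \<beta> vs"
    by (induction vs arbitrary: \<beta>) (simp_all add: wedge_Nil wedge_Cons *, simp add: alt_unit_def)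
qed

lemma wedge_alt_unit [simp]: "\<beta> \<and>\<^sub>a alt_unit = \<beta>"
proof
  have *: "\<iota> v alt_unit = 0" for v :: 'a
    by (auto simp: fun_eq_iff alt_unit_def)
  fix vs show "(\<beta> \<and>\<^sub>a alt_unit) vs = \<beta> vs"
    by (induction vs arbitrary: \<beta>) (simp_all add: wedge_Nil wedge_Cons *, simp add: alt_unit_def)
qed

text \<open>Contraction turns even forms into odd ones and conversely, so the two cases of graded
  commutativity have to be proved together. The sign operator \<open>grade_inv\<close> expresses
  parity without a choice of degree.\<close>

lemma wedge_commute_apply:
  "(grade_inv \<alpha> = \<alpha> \<longrightarrow> (\<alpha> \<and>\<^sub>a \<beta>) vs = (\<beta> \<and>\<^sub>a \<alpha>) vs) \<and>
   (grade_inv \<alpha> = - \<alpha> \<longrightarrow> (\<alpha> \<and>\<^sub>a \<beta>) vs = (grade_inv \<beta> \<and>\<^sub>a \<alpha>) vs)"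
proof (induction vs arbitrary: \<alpha> \<beta>)
  case Nil then show ?case by (simp add: wedge_Nil grade_inv_def)
next
  case (Cons v vs)
  show ?case
  proof (intro conjI impI)
    assume a: "grade_inv \<alpha> = \<alpha>"
    then have "grade_inv (\<iota> v \<alpha>) = - \<iota> v \<alpha>"
      using \<iota>_grade_inv[of v \<alpha>] by (metis minus_minus)
    then have "(\<iota> v \<alpha> \<and>\<^sub>a \<beta>) vs = (grade_inv \<beta> \<and>\<^sub>a \<iota> v \<alpha>) vs" using Cons.IH by blast
    moreover have "(\<alpha> \<and>\<^sub>a \<iota> v \<beta>) vs = (\<iota> v \<beta> \<and>\<^sub>a \<alpha>) vs" using Cons.IH a by blast
    ultimately show "(\<alpha> \<and>\<^sub>a \<beta>) (v # vs) = (\<beta> \<and>\<^sub>a \<alpha>) (v # vs)"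
      unfolding wedge_Cons a by simp
  next
    assume a: "grade_inv \<alpha> = - \<alpha>"
    then have "grade_inv (\<iota> v \<alpha>) = \<iota> v \<alpha>"
      using \<iota>_grade_inv[of v \<alpha>] by (metis \<iota>_minus minus_minus)
    then have "(\<iota> v \<alpha> \<and>\<^sub>a \<beta>) vs = (\<beta> \<and>\<^sub>a \<iota> v \<alpha>) vs" using Cons.IH by blast
    moreover have "(\<alpha> \<and>\<^sub>a \<iota> v \<beta>) vs = (grade_inv (\<iota> v \<beta>) \<and>\<^sub>a \<alpha>) vs" using Cons.IH a by blast
    ultimately show "(\<alpha> \<and>\<^sub>a \<beta>) (v # vs) = (grade_inv \<beta> \<and>\<^sub>a \<alpha>) (v # vs)"
      unfolding wedge_Cons a \<iota>_grade_inv by simp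
  qed
qed

lemma wedge_commute_even: "grade_inv \<alpha> = \<alpha> \<Longrightarrow> \<alpha> \<and>\<^sub>a \<beta> = \<beta> \<and>\<^sub>a \<alpha>"
  and wedge_commute_odd: "grade_inv \<alpha> = - \<alpha> \<Longrightarrow> \<alpha> \<and>\<^sub>a \<beta> = grade_inv \<beta> \<and>\<^sub>a \<alpha>"
  using wedge_commute_apply[of \<alpha> \<beta>] by blast+

lemma homog_wedge:
  assumes "homog p \<alpha>" "homog q \<beta>"
  shows "homog (p + q) (\<alpha> \<and>\<^sub>a \<beta>)"
  unfolding homog_def
proof (intro allI impI)
  fix vs :: "'a list"
  assume n: "length vs \<noteq> p + q"
  show "(\<alpha> \<and>\<^sub>a \<beta>) vs = 0"
    unfolding wedge_def
  proof (rule sum.neutral, rule ballI)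
    fix I assume I: "I \<in> Pow {..<length vs}"
    have "{i. i < length vs \<and> i \<in> I} = I"
      "{i. i < length vs \<and> i \<in> {..<length vs} - I} = {..<length vs} - I" using I by auto
    then have "length (nths vs I) + length (nths vs ({..<length vs} - I)) = length vs"
      using I by (simp add: length_nths card_Diff_subset finite_subset card_mono subset_eq_atLeast0_lessThan_card)
        (metis card_lessThan card_mono finite_lessThan le_add_diff_inverse)
    then have "length (nths vs I) \<noteq> p \<or> length (nths vs ({..<length vs} - I)) \<noteq> q"
      using n by auto
    then show "shuffle_sign (length vs) I * \<alpha> (nths vs I) * \<beta> (nths vs ({..<length vs} - I)) = 0"
      using assms by (auto simp: homog_def)
  qed
qed

section \<open>Alternating forms\<close>

lemma alternating_linear: "alternating \<alpha> \<Longrightarrow> linear (\<lambda>v. \<alpha> (us @ v # ws))"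
  by (simp add: alternating_def)

lemma alternating_linear_Cons: "alternating \<alpha> \<Longrightarrow> linear (\<lambda>v. \<alpha> (v # ws))"
  using alternating_linear[of \<alpha> "[]"] by simp

lemma alternating_swap:
  assumes "\<And>us ws. linear (\<lambda>v. \<alpha> (us @ v # ws))" "\<And>us v ws. \<alpha> (us @ v # v # ws) = (0::real)"
  shows "\<alpha> (us @ a # b # ws) = - \<alpha> (us @ b # a # ws)"
proof -
  have l: "\<alpha> (us @ (a + b) # c # ws) = \<alpha> (us @ a # c # ws) + \<alpha> (us @ b # c # ws)" for c
    using linear_add[OF assms(1)[of us "c # ws"]] by simp
  have r: "\<alpha> (us @ c # (a + b) # ws) = \<alpha> (us @ c # a # ws) + \<alpha> (us @ c # b # ws)" for c
    using linear_add[OF assms(1)[of "us @ [c]" ws]] by simp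
  have "\<alpha> (us @ (a + b) # (a + b) # ws) = 0" by (rule assms)
  then show ?thesis unfolding l r by (simp add: assms(2))
qed

text \<open>Adjacent equal arguments suffice: multilinearity then gives a sign for each
  transposition of neighbours, and these move any two equal arguments together.\<close>

lemma alternatingI_adjacent:
  assumes "\<And>us ws. linear (\<lambda>v. \<alpha> (us @ v # ws))" "\<And>us v ws. \<alpha> (us @ v # v # ws) = 0"
  shows "alternating \<alpha>"
  unfolding alternating_def
proof (intro conjI allI impI)
  show "linear (\<lambda>v. \<alpha> (us @ v # ws))" for us ws by (rule assms)
next
  fix vs :: "'a list" assume "\<not> distinct vs"
  then obtain xs y ys zs where vs: "vs = xs @ y # ys @ y # zs"
    using not_distinct_decomp[of vs] by auto
  have "\<alpha> (xs @ y # ys @ y # zs) = 0"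
  proof (induction ys arbitrary: xs)
    case Nil then show ?case using assms(2) by simp
  next
    case (Cons z ys)
    have "\<alpha> (xs @ y # z # ys @ y # zs) = - \<alpha> (xs @ z # y # ys @ y # zs)"
      using assms by (rule alternating_swap)
    then show ?case using Cons.IH[of "xs @ [z]"] by simp
  qed
  then show "\<alpha> vs = 0" using vs by simp
qed

lemma alternating_swap':
  assumes "alternating \<alpha>"
  shows "\<alpha> (us @ a # b # ws) = - \<alpha> (us @ b # a # ws)"
  using assms by (intro alternating_swap) (auto simp: alternating_def)

lemma alternating_\<iota>: "alternating \<alpha> \<Longrightarrow> alternating (\<iota> v \<alpha>)"
  unfolding alternating_def by (auto simp flip: append_Cons)

lemma alternating_move:
  assumes "alternating \<alpha>"
  shows "\<alpha> (us @ v # ws) = (-1) ^ length us * \<alpha> (v # us @ ws)"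
  using assms
proof (induction us arbitrary: \<alpha>)
  case (Cons u us)
  have "\<alpha> (u # us @ v # ws) = (-1) ^ length us * \<alpha> (u # v # us @ ws)"
    by (rule Cons.IH[OF alternating_\<iota>[OF Cons.prems, of u], unfolded \<iota>_apply])
  also have "\<alpha> (u # v # us @ ws) = - \<alpha> (v # u # us @ ws)"
    by (rule alternating_swap'[OF Cons.prems, of "[]", unfolded append_Nil])
  finally show ?case by (simp only: append_Cons list.size power_Suc power_add) simp
qed simp

text \<open>Rearranging the arguments changes an alternating form only by a sign.\<close>

lemma alternating_zero_mset:
  assumes "alternating \<gamma>" "mset xs = mset ys" "\<gamma> xs = 0"
  shows "\<gamma> ys = 0"
  using assms
proof (induction xs arbitrary: ys \<gamma>)
  case Nil then show ?case by simp
next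
  case (Cons x xs)
  have "x \<in> set ys" using Cons.prems(2) by (metis list.set_intros(1) set_mset_mset)
  then obtain us ws where ys: "ys = us @ x # ws" by (meson split_list)
  have "mset xs = mset (us @ ws)" using Cons.prems(2) ys by simp
  moreover have "\<iota> x \<gamma> xs = 0" using Cons.prems(3) by (simp only: \<iota>_apply)
  ultimately have "\<iota> x \<gamma> (us @ ws) = 0"
    by (rule Cons.IH[OF alternating_\<iota>[OF Cons.prems(1)]])
  then show ?case unfolding ys alternating_move[OF Cons.prems(1), of us x ws] by (simp only: \<iota>_apply mult_zero_right)
qed

lemma alternating_zero [simp]: "alternating 0"
  by (auto simp: alternating_def zero_fun_def module_hom_zero)

lemma alternating_add: "alternating \<alpha> \<Longrightarrow> alternating \<beta> \<Longrightarrow> alternating (\<alpha> + \<beta>)"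
  by (auto simp: alternating_def intro: linear_compose_add)

lemma alternating_scale: "alternating \<alpha> \<Longrightarrow> alternating (r *\<^sub>R \<alpha>)"
  by (auto simp: alternating_def intro!: linear_compose_scale_right[where 'b=real, simplified])

lemma alternating_minus: "alternating \<alpha> \<Longrightarrow> alternating (- \<alpha>)"
  using alternating_scale[of \<alpha> "-1"] by simp

lemma alternating_diff: "alternating \<alpha> \<Longrightarrow> alternating \<beta> \<Longrightarrow> alternating (\<alpha> - \<beta>)"
  using alternating_add[of \<alpha> "- \<beta>"] alternating_minus[of \<beta>] by simp

lemma alternating_sum: "(\<And>i. i \<in> I \<Longrightarrow> alternating (f i)) \<Longrightarrow> alternating (\<Sum>i\<in>I. f i)"
  by (induction I rule: infinite_finite_induct) (auto intro: alternating_add)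

lemma alternating_unit: "alternating alt_unit"
  by (auto simp: alternating_def alt_unit_def module_hom_zero)

lemma alternating_scale_degrees:
  assumes "alternating \<alpha>" shows "alternating (\<lambda>vs. c (length vs) * \<alpha> vs)"
proof -
  have "linear (\<lambda>v. c (length (us @ v # ws)) *\<^sub>R \<alpha> (us @ v # ws))" for us ws
    using linear_compose_scale_right[OF alternating_linear[OF assms, of us ws],
        of "c (Suc (length us + length ws))"] by simp
  then show ?thesis using assms by (auto simp: alternating_def)
qed

lemma alternating_component:
  assumes "alternating \<alpha>" shows "alternating (\<lambda>vs. if length vs = k then \<alpha> vs else 0)"
proof -
  have "(\<lambda>vs. if length vs = k then \<alpha> vs else 0)
      = (\<lambda>vs. (if length vs = k then 1 else 0) * \<alpha> vs)" by (simp add: fun_eq_iff)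
  then show ?thesis
    using alternating_scale_degrees[OF assms, of "\<lambda>l. if l = k then 1 else 0"] by simp
qed

lemma alternating_grade_inv: "alternating \<alpha> \<Longrightarrow> alternating (grade_inv \<alpha>)"
  unfolding grade_inv_def by (rule alternating_scale_degrees)

text \<open>Contracting twice with the same vector gives 0 on each factor, and the two mixed terms
  cancel by the sign of \<open>grade_inv\<close>.\<close>

lemma alternating_wedge:
  assumes "alternating \<alpha>" "alternating \<beta>"
  shows "alternating (\<alpha> \<and>\<^sub>a \<beta>)"
proof (rule alternatingI_adjacent)
  have \<iota>l: "\<iota> (x + y) \<alpha> = \<iota> x \<alpha> + \<iota> y \<alpha>" "\<iota> (r *\<^sub>R x) \<alpha> = r *\<^sub>R \<iota> x \<alpha>"
    if "alternating \<alpha>" for x y r and \<alpha> :: "'a alt"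
    using linear_add[OF alternating_linear_Cons[OF that]]
      linear_scale[OF alternating_linear_Cons[OF that]] by (auto simp: fun_eq_iff)
  show "linear (\<lambda>v. (\<alpha> \<and>\<^sub>a \<beta>) (us @ v # ws))" for us ws
    using assms
  proof (induction us arbitrary: \<alpha> \<beta>)
    case Nil
    show ?case
      by (rule linearI) (simp_all add: wedge_Cons \<iota>l Nil algebra_simps)
  next
    case (Cons u us)
    then show ?case
      by (auto simp: wedge_Cons intro!: linear_compose_add alternating_\<iota> alternating_grade_inv)
  qed
  have \<iota>\<iota>: "\<iota> v (\<iota> v \<alpha>) = 0" if "alternating \<alpha>" for v and \<alpha> :: "'a alt"
    using that by (auto simp: fun_eq_iff alternating_def)
  show "(\<alpha> \<and>\<^sub>a \<beta>) (us @ v # v # ws) = 0" for us v ws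
    using assms
  proof (induction us arbitrary: \<alpha> \<beta>)
    case Nil
    then show ?case by (simp add: wedge_Cons \<iota>_wedge \<iota>\<iota> \<iota>_grade_inv)
  next
    case (Cons u us)
    have "(\<iota> u \<alpha> \<and>\<^sub>a \<beta>) (us @ v # v # ws) = 0"
      using Cons by (intro Cons.IH alternating_\<iota>) auto
    moreover have "(grade_inv \<alpha> \<and>\<^sub>a \<iota> u \<beta>) (us @ v # v # ws) = 0"
      using Cons by (intro Cons.IH alternating_\<iota> alternating_grade_inv) auto
    ultimately show ?case by (simp add: wedge_Cons)
  qed
qed

lemma pull_wedge:
  "(\<lambda>vs. (\<alpha> \<and>\<^sub>a \<beta>) (map D vs)) = (\<lambda>vs. \<alpha> (map D vs)) \<and>\<^sub>a (\<lambda>vs. \<beta> (map D vs))"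
  by (auto simp: fun_eq_iff wedge_def nths_map)

lemma alternating_pull:
  assumes "alternating \<alpha>" "linear D"
  shows "alternating (\<lambda>vs. \<alpha> (map D vs))"
  using assms linear_compose[OF assms(2) alternating_linear[OF assms(1)]]
  by (auto simp: alternating_def o_def distinct_map)

section \<open>Products of covectors\<close>

definition covector :: "('e \<Rightarrow> real) \<Rightarrow> 'e alt" where
  "covector f vs = (if length vs = 1 then f (hd vs) else 0)"

lemma homog_covector: "homog 1 (covector f)"
  by (simp add: homog_def covector_def)

lemma \<iota>_covector: "\<iota> v (covector f) = f v *\<^sub>R alt_unit"
  by (auto simp: fun_eq_iff covector_def alt_unit_def)

lemma grade_inv_covector: "grade_inv (covector f) = - covector f"
  using grade_inv_homog[OF homog_covector, of f] by simp

lemma homog_1_covector: "homog 1 \<alpha> \<Longrightarrow> \<alpha> = covector (\<lambda>v. \<alpha> [v])"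
proof
  fix vs assume "homog 1 \<alpha>"
  then show "\<alpha> vs = covector (\<lambda>v. \<alpha> [v]) vs"
    by (cases vs; cases "tl vs") (auto simp: homog_def covector_def)
qed

lemma \<iota>_covector_wedge: "\<iota> v (covector f \<and>\<^sub>a \<beta>) = f v *\<^sub>R \<beta> - covector f \<and>\<^sub>a \<iota> v \<beta>"
  by (simp add: \<iota>_wedge \<iota>_covector grade_inv_covector)

lemma alternating_covector:
  assumes "linear f" shows "alternating (covector f)"
proof (rule alternatingI_adjacent)
  show "linear (\<lambda>v. covector f (us @ v # ws))" for us ws
    using assms by (cases "us = [] \<and> ws = []") (auto simp: covector_def module_hom_zero)
  show "covector f (us @ v # v # ws) = 0" for us v ws by (simp add: covector_def)
qed

text \<open>Expansion along the first row.\<close>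

lemma covector_wedge_expand:
  "(covector f \<and>\<^sub>a \<beta>) vs =
     (\<Sum>i<length vs. (-1) ^ i * f (vs ! i) * \<beta> (take i vs @ drop (Suc i) vs))"
proof (induction vs arbitrary: \<beta>)
  case Nil then show ?case by (simp add: wedge_Nil covector_def)
next
  case (Cons v vs)
  have "(covector f \<and>\<^sub>a \<beta>) (v # vs) = f v * \<beta> vs - (covector f \<and>\<^sub>a \<iota> v \<beta>) vs"
    using fun_cong[OF \<iota>_covector_wedge[of v f \<beta>], of vs] by simp
  then show ?case
    unfolding Cons.IH list.size add_0_right add_Suc_right sum.lessThan_Suc_shift
    by (simp add: sum_negf)
qed

text \<open>The value of this form on a list of vectors is the determinant of the matrix of all
  values of the functionals at the vectors.\<close>

definition cprod :: "('e \<Rightarrow> real) list \<Rightarrow> 'e alt" where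
  "cprod fs = foldr (\<and>\<^sub>a) (map covector fs) alt_unit"

lemma cprod_simps [simp]: "cprod [] = alt_unit" "cprod (f # fs) = covector f \<and>\<^sub>a cprod fs"
  by (simp_all add: cprod_def)

lemma cprod_append: "cprod (fs @ gs) = cprod fs \<and>\<^sub>a cprod gs"
  by (induction fs) (simp_all add: wedge_assoc)

lemma homog_cprod: "homog (length fs) (cprod fs)"
proof (induction fs)
  case (Cons f fs) then show ?case using homog_wedge[OF homog_covector] by fastforce
qed (simp add: homog_unit)

lemma alternating_cprod: "(\<And>f. f \<in> set fs \<Longrightarrow> linear f) \<Longrightarrow> alternating (cprod fs)"
  by (induction fs) (auto intro: alternating_wedge alternating_covector alternating_unit)

text \<open>Expansion along the first column.\<close>

lemma \<iota>_cprod: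
  "\<iota> y (cprod fs) = (\<Sum>i<length fs. ((-1) ^ i * (fs ! i) y) *\<^sub>R cprod (take i fs @ drop (Suc i) fs))"
proof (induction fs)
  case Nil then show ?case by (auto simp: fun_eq_iff alt_unit_def)
next
  case (Cons f fs)
  show ?case
    unfolding cprod_simps \<iota>_covector_wedge Cons.IH list.size add_0_right add_Suc_right sum.lessThan_Suc_shift
    by (simp add: linear_sum[OF wedge_linear_right] sum_negf)
qed

text \<open>A matrix and its transpose have the same determinant: the expansion of one side along
  the first column is the expansion of the other side along the first row.\<close>

lemma cprod_transpose: "cprod (map B xs) ys = cprod (map (\<lambda>y x. B x y) ys) xs"
proof (induction ys arbitrary: xs)
  case Nil
  show ?case using homog_cprod[of "map B xs"] by (cases xs) (auto simp: homog_def alt_unit_def)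
next
  case (Cons y ys)
  have "cprod (map B xs) (y # ys) = (\<Sum>i<length xs. (-1) ^ i * B (xs ! i) y *
      cprod (map B (take i xs @ drop (Suc i) xs)) ys)"
    using fun_cong[OF \<iota>_cprod[of y "map B xs"], of ys]
    by (simp add: sum_fun_apply take_map drop_map)
  also have "\<dots> = (\<Sum>i<length xs. (-1) ^ i * B (xs ! i) y *
      cprod (map (\<lambda>y x. B x y) ys) (take i xs @ drop (Suc i) xs))"
    unfolding Cons.IH ..
  also have "\<dots> = cprod (map (\<lambda>y x. B x y) (y # ys)) xs"
    by (simp add: covector_wedge_expand)
  finally show ?case .
qed

section \<open>Expansion in an orthonormal basis\<close>

text \<open>The model space carries an inner product but no distinguished basis, and its dimension
  may be 0. All sums over coordinates use a chosen orthonormal basis.\<close>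

locale orthonormal_basis =
  fixes B :: "'e::real_inner set"
  assumes finite_basis: "finite B"
    and orthonormal: "\<And>e e'. e \<in> B \<Longrightarrow> e' \<in> B \<Longrightarrow> e \<bullet> e' = (if e = e' then 1 else 0)"
    and basis_expand: "\<And>x. x = (\<Sum>e\<in>B. (e \<bullet> x) *\<^sub>R e)"
begin

lemma linear_expand: "linear f \<Longrightarrow> f x = (\<Sum>e\<in>B. (e \<bullet> x) *\<^sub>R f e)"
  by (subst basis_expand[of x]) (simp add: linear_sum linear_scale)

lemma alternating_expand:
  assumes "alternating \<alpha>"
  shows "(\<Sum>e\<in>B. (e \<bullet> x) * \<alpha> (us @ e # ws)) = \<alpha> (us @ x # ws)"
  using linear_expand[OF alternating_linear[OF assms, of us ws], of x] by simp

abbreviation dual :: "'e \<Rightarrow> 'e alt" where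
  "dual e \<equiv> covector (\<lambda>v. e \<bullet> v)"

lemma alternating_dual: "alternating (dual e)"
  by (intro alternating_covector linearI) (auto simp: algebra_simps)

text \<open>Each argument contributes once the value of \<open>\<alpha>\<close>: the sum over the
  basis inserts the \<open>i\<close>-th argument in front, and the sign of the expansion moves it
  back to its place. So creating and annihilating in all directions counts the degree.\<close>

lemma euler_apply:
  assumes "alternating \<alpha>"
  shows "(\<Sum>e\<in>B. (dual e \<and>\<^sub>a \<iota> e \<alpha>) vs) = real (length vs) * \<alpha> vs"
proof -
  have "(\<Sum>e\<in>B. (dual e \<and>\<^sub>a \<iota> e \<alpha>) vs)
     = (\<Sum>e\<in>B. \<Sum>i<length vs. (-1) ^ i * (e \<bullet> vs ! i) * \<alpha> (e # take i vs @ drop (Suc i) vs))"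
    by (simp add: covector_wedge_expand)
  also have "\<dots> = (\<Sum>i<length vs. (-1) ^ i * (\<Sum>e\<in>B. (e \<bullet> vs ! i) * \<alpha> (e # take i vs @ drop (Suc i) vs)))"
    by (subst sum.swap) (simp add: sum_distrib_left mult.assoc)
  also have "\<dots> = (\<Sum>i<length vs. \<alpha> vs)"
  proof (rule sum.cong[OF refl])
    fix i assume i: "i \<in> {..<length vs}"
    then have vs: "vs = take i vs @ vs ! i # drop (Suc i) vs" by (simp add: id_take_nth_drop)
    have "(\<Sum>e\<in>B. (e \<bullet> vs ! i) * \<alpha> (e # take i vs @ drop (Suc i) vs))
        = \<alpha> (vs ! i # take i vs @ drop (Suc i) vs)"
      using alternating_expand[OF assms, where us="[]"] by simp
    also have "(-1) ^ i * \<dots> = \<alpha> (take i vs @ vs ! i # drop (Suc i) vs)"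
      using i by (subst alternating_move[OF assms]) simp
    finally show "(-1) ^ i * (\<Sum>e\<in>B. (e \<bullet> vs ! i) * \<alpha> (e # take i vs @ drop (Suc i) vs)) = \<alpha> vs"
      by (simp flip: vs)
  qed
  finally show ?thesis by simp
qed

lemma euler:
  assumes "alternating \<alpha>" "homog p \<alpha>"
  shows "(\<Sum>e\<in>B. dual e \<and>\<^sub>a \<iota> e \<alpha>) = real p *\<^sub>R \<alpha>"
proof
  fix vs show "(\<Sum>e\<in>B. dual e \<and>\<^sub>a \<iota> e \<alpha>) vs = (real p *\<^sub>R \<alpha>) vs"
    using euler_apply[OF assms(1), of vs] assms(2)
    by (cases "length vs = p") (simp_all add: sum_fun_apply homog_def)
qed

text \<open>The opposite order of the two operators counts the missing degree.\<close>

lemma euler':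
  assumes "alternating \<alpha>" "homog p \<alpha>"
  shows "(\<Sum>e\<in>B. \<iota> e (dual e \<and>\<^sub>a \<alpha>)) = (real (card B) - real p) *\<^sub>R \<alpha>"
proof -
  have "(\<Sum>e\<in>B. \<iota> e (dual e \<and>\<^sub>a \<alpha>)) = (\<Sum>e\<in>B. \<alpha> - dual e \<and>\<^sub>a \<iota> e \<alpha>)"
    by (rule sum.cong) (auto simp: \<iota>_covector_wedge orthonormal)
  also have "\<dots> = real (card B) *\<^sub>R \<alpha> - real p *\<^sub>R \<alpha>"
    unfolding sum_subtractf euler[OF assms] by (simp add: sum_constant_scaleR del: sum_constant)
  finally show ?thesis by (simp add: algebra_simps)
qed

text \<open>All lists over the basis, with repetitions; the factor \<open>1 / fact m\<close> in
  expansions accounts for this redundancy and avoids a choice of an order of the basis.\<close>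

definition tuples :: "nat \<Rightarrow> 'e list set" where
  "tuples m = {J. set J \<subseteq> B \<and> length J = m}"

lemma sum_tuples_Suc: "(\<Sum>J\<in>tuples (Suc m). f J) = (\<Sum>e\<in>B. \<Sum>J\<in>tuples m. f (e # J))"
proof -
  have "tuples (Suc m) = (\<lambda>(e, J). e # J) ` (B \<times> tuples m)"
    unfolding tuples_def by (auto simp: length_Suc_conv image_iff)
  then have "(\<Sum>J\<in>tuples (Suc m). f J) = (\<Sum>(e, J)\<in>B \<times> tuples m. f (e # J))"
    by (simp add: sum.reindex inj_on_def case_prod_beta)
  then show ?thesis by (simp add: sum.cartesian_product)
qed

text \<open>Iteration of Euler's identity.\<close>

lemma form_expansion:
  assumes "alternating \<alpha>" "homog m \<alpha>"
  shows "\<alpha> = (1 / fact m) *\<^sub>R (\<Sum>J\<in>tuples m. \<alpha> J *\<^sub>R cprod (map (\<bullet>) J))"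
  using assms
proof (induction m arbitrary: \<alpha>)
  case 0
  have "tuples 0 = {[]}" by (auto simp: tuples_def)
  then have "(1 / fact 0) *\<^sub>R (\<Sum>J\<in>tuples 0. \<alpha> J *\<^sub>R cprod (map (\<bullet>) J)) = \<alpha> [] *\<^sub>R alt_unit"
    by simp
  with homog_0_unit[OF 0(2)] show ?case by (rule trans[OF _ sym])
next
  case (Suc m)
  have "(real (Suc m)) *\<^sub>R \<alpha> = (\<Sum>e\<in>B. dual e \<and>\<^sub>a \<iota> e \<alpha>)"
    by (simp only: euler[OF Suc.prems])
  also have "\<dots> = (\<Sum>e\<in>B. dual e \<and>\<^sub>a (1 / fact m) *\<^sub>R (\<Sum>J\<in>tuples m. \<iota> e \<alpha> J *\<^sub>R cprod (map (\<bullet>) J)))"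
    by (rule sum.cong[OF refl], rule arg_cong[where f="\<lambda>\<beta>. covector _ \<and>\<^sub>a \<beta>"],
      rule Suc.IH[OF alternating_\<iota>[OF Suc.prems(1)] homog_\<iota>[OF Suc.prems(2)]])
  also have "\<dots> = (1 / fact m) *\<^sub>R (\<Sum>J\<in>tuples (Suc m). \<alpha> J *\<^sub>R cprod (map (\<bullet>) J))"
    by (simp add: sum_tuples_Suc scaleR_sum_right linear_sum[OF wedge_linear_right])
  finally have "(1 / real (Suc m)) *\<^sub>R (real (Suc m) *\<^sub>R \<alpha>) =
    (1 / real (Suc m)) *\<^sub>R (1 / fact m) *\<^sub>R (\<Sum>J\<in>tuples (Suc m). \<alpha> J *\<^sub>R cprod (map (\<bullet>) J))"
    by (simp only:)
  moreover have "(1 / real (Suc m)) *\<^sub>R (real (Suc m) *\<^sub>R \<alpha>) = \<alpha>"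
    by (simp only: scaleR_scaleR) (simp del: of_nat_Suc)
  moreover have "1 / real (Suc m) * (1 / fact m) = 1 / fact (Suc m)"
    by simp
  ultimately show ?case by (simp only: scaleR_scaleR)
qed

lemma alternating_eq_0I:
  assumes "alternating \<alpha>" "homog m \<alpha>" "\<And>J. J \<in> tuples m \<Longrightarrow> \<alpha> J = 0"
  shows "\<alpha> = 0"
  by (subst form_expansion[OF assms(1,2)]) (simp add: assms(3))

lemma alternating_gt_dim:
  fixes \<alpha> :: "'e alt"
  assumes "alternating \<alpha>" "homog m \<alpha>" "m > card B"
  shows "\<alpha> = 0"
proof (rule alternating_eq_0I[OF assms(1,2)])
  fix J assume "J \<in> tuples m"
  then have "\<not> distinct J"
    using assms(3) card_mono[OF finite_basis, of "set J"] distinct_card[of J]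
    by (auto simp: tuples_def)
  then show "\<alpha> J = 0" using assms(1) by (simp add: alternating_def)
qed

text \<open>On basis lists, a form of top degree takes up to sign only one value besides
  0.\<close>

lemma top_form_zero:
  assumes a: "alternating \<gamma>" "homog (card B) \<gamma>" and b: "distinct b" "set b = B" and 0: "\<gamma> b = 0"
  shows "\<gamma> = 0"
proof (rule alternating_eq_0I[OF a])
  fix J assume J: "J \<in> tuples (card B)"
  show "\<gamma> J = 0"
  proof (cases "distinct J")
    case False then show ?thesis using a unfolding alternating_def by blast
  next
    case True
    then have "set J = B"
      using J distinct_card[OF True] card_subset_eq[OF finite_basis, of "set J"]
      by (simp add: tuples_def)
    then have "mset J = mset b" using True b by (simp add: set_eq_iff_mset_eq_distinct[symmetric])
    then show ?thesis using alternating_zero_mset[OF a(1), of b J] 0 by simp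
  qed
qed

lemma top_form_eq:
  assumes "alternating \<alpha>" "homog (card B) \<alpha>" "alternating \<beta>" "homog (card B) \<beta>"
    and b: "distinct b" "set b = B"
  shows "\<alpha> b *\<^sub>R \<beta> = \<beta> b *\<^sub>R \<alpha>"
proof -
  have "\<alpha> b *\<^sub>R \<beta> - \<beta> b *\<^sub>R \<alpha> = 0"
    using assms
    by (intro top_form_zero[OF _ _ b] alternating_diff alternating_scale homog_diff homog_scale) auto
  then show ?thesis by simp
qed

text \<open>By \<open>euler'\<close>, the contractions of the products \<open>dual e
  \<and>\<^sub>a \<alpha>\<close> add up to a multiple of \<open>\<alpha>\<close>, with a factor
  that vanishes only in the top degree.\<close>

lemma annihilated_zero:
  assumes "alternating \<alpha>" "homog p \<alpha>" "p \<noteq> card B" "\<And>e. e \<in> B \<Longrightarrow> dual e \<and>\<^sub>a \<alpha> = 0"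
  shows "\<alpha> = 0"
  using euler'[OF assms(1,2)] assms(3,4) by simp

text \<open>By Euler's identity, products of covectors span all alternating forms.\<close>

lemma alternating_induct [consumes 2, case_names unit scale add wedge]:
  assumes "alternating \<alpha>" "homog p \<alpha>"
    and "Q 0 alt_unit"
    and "\<And>q r \<alpha>. alternating \<alpha> \<Longrightarrow> homog q \<alpha> \<Longrightarrow> Q q \<alpha> \<Longrightarrow> Q q (r *\<^sub>R \<alpha>)"
    and "\<And>q \<alpha> \<beta>. alternating \<alpha> \<Longrightarrow> homog q \<alpha> \<Longrightarrow> Q q \<alpha> \<Longrightarrow>
          alternating \<beta> \<Longrightarrow> homog q \<beta> \<Longrightarrow> Q q \<beta> \<Longrightarrow> Q q (\<alpha> + \<beta>)"
    and "\<And>q e \<alpha>. alternating \<alpha> \<Longrightarrow> homog q \<alpha> \<Longrightarrow> Q q \<alpha> \<Longrightarrow> Q (Suc q) (dual e \<and>\<^sub>a \<alpha>)"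
  shows "Q p \<alpha>"
  using assms(1,2)
proof (induction p arbitrary: \<alpha>)
  case 0
  show ?case
    by (subst homog_0_unit[OF 0(2)]) (intro assms(4) assms(3) alternating_unit homog_unit)
next
  case (Suc p)
  note a = Suc.prems(1)
  have aw: "alternating (dual e \<and>\<^sub>a \<iota> e \<alpha>)" and hw: "homog (Suc p) (dual e \<and>\<^sub>a \<iota> e \<alpha>)"
    and Qw: "Q (Suc p) (dual e \<and>\<^sub>a \<iota> e \<alpha>)" for e
    using Suc homog_wedge[OF homog_covector homog_\<iota>[OF Suc.prems(2)]]
    by (auto intro!: alternating_wedge alternating_dual alternating_\<iota> assms(6) homog_\<iota>)
  have "alternating (\<Sum>e\<in>C. dual e \<and>\<^sub>a \<iota> e \<alpha>) \<and> homog (Suc p) (\<Sum>e\<in>C. dual e \<and>\<^sub>a \<iota> e \<alpha>) \<and>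
     Q (Suc p) (\<Sum>e\<in>C. dual e \<and>\<^sub>a \<iota> e \<alpha>)" if "finite C" for C
    using that
  proof (induction C)
    case empty
    have "Q (Suc p) (0 *\<^sub>R (dual 0 \<and>\<^sub>a \<iota> 0 \<alpha>))" by (intro assms(4) aw hw Qw)
    then have "Q (Suc p) 0" by (simp only: scaleR_zero_left)
    then show ?case by (simp only: sum.empty alternating_zero homog_zero simp_thms)
  next
    case (insert e C)
    then show ?case
      unfolding sum.insert[OF insert.hyps]
      by (intro conjI alternating_add homog_add assms(5) aw hw Qw) blast+
  qed
  from this[OF finite_basis]
  have "Q (Suc p) ((1 / real (Suc p)) *\<^sub>R (\<Sum>e\<in>B. dual e \<and>\<^sub>a \<iota> e \<alpha>))"
    by (intro assms(4)) auto
  then show ?case unfolding euler[OF Suc.prems] by simp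
qed

end

lemmas fun_app = plus_fun_apply zero_fun_apply scaleR_fun_apply minus_apply uminus_apply \<iota>_apply

(* From here on, equations between forms are used without arguments; these rules would replace
  forms by their values. *)
declare fun_app [simp del]

section \<open>Symplectic vector spaces\<close>

definition component :: "nat \<Rightarrow> 'e alt \<Rightarrow> 'e alt" where
  "component k \<alpha> = (\<lambda>vs. if length vs = k then \<alpha> vs else 0)"

lemma homog_component: "homog k (component k \<alpha>)"
  by (simp add: homog_def component_def)

lemma alternating_component': "alternating \<alpha> \<Longrightarrow> alternating (component k \<alpha>)"
  unfolding component_def by (rule alternating_component)

lemma component_homog: "homog k \<alpha> \<Longrightarrow> component j \<alpha> = (if j = k then \<alpha> else 0)"
  by (auto simp: homog_def component_def fun_eq_iff fun_app)

context orthonormal_basis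
begin

lemma component_gt_dim:
  fixes \<alpha> :: "'e alt"
  assumes "alternating \<alpha>" "k > card B"
  shows "component k \<alpha> = 0"
  by (rule alternating_gt_dim[OF alternating_component'[OF assms(1)] homog_component assms(2)])

lemma sum_components:
  fixes \<alpha> :: "'e alt"
  assumes "alternating \<alpha>"
  shows "(\<Sum>k\<le>card B. component k \<alpha>) = \<alpha>"
proof
  fix vs
  have "(\<Sum>k\<le>card B. component k \<alpha>) vs = (\<Sum>k\<le>card B. if k = length vs then \<alpha> vs else 0)"
    unfolding sum_fun_apply component_def by (intro sum.cong) auto
  also have "\<dots> = \<alpha> vs"
    using fun_cong[OF component_gt_dim[OF assms, of "length vs"], of vs]
    by (auto simp: component_def fun_app)
  finally show "(\<Sum>k\<le>card B. component k \<alpha>) vs = \<alpha> vs" .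
qed

lemma span_basis: "span B = UNIV"
proof -
  have "x \<in> span B" for x
    by (subst basis_expand) (intro span_sum span_scale span_base)
  then show ?thesis by blast
qed

lemma independent_basis: "independent B"
proof (rule pairwise_orthogonal_independent)
  show "pairwise orthogonal B" using orthonormal by (auto simp: pairwise_def orthogonal_def)
  show "0 \<notin> B" using orthonormal by force
qed

lemma inj_imp_surj:
  fixes f :: "'e \<Rightarrow> 'e"
  assumes "linear f" "\<And>x. f x = 0 \<Longrightarrow> x = 0"
  shows "surj f"
proof -
  interpret fd: finite_dimensional_vector_space "(*\<^sub>R)" B
    by unfold_locales (use finite_basis independent_basis span_basis
      in \<open>simp_all add: dependent_raw_def span_raw_def\<close>)
  have "inj f" using assms linear_injective_0 by blast
  then show ?thesis by (rule fd.linear_inj_imp_surj[OF assms(1)[unfolded linear_def]])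
qed

end

locale symplectic_space = orthonormal_basis B for B :: "'e::real_inner set" +
  fixes \<omega> :: "'e alt" and n :: nat
  assumes card_basis: "card B = 2 * n"
    and alt_\<omega>: "alternating \<omega>"
    and homog_\<omega>: "homog 2 \<omega>"
    and nondeg: "\<And>v. (\<And>w. \<omega> [v, w] = 0) \<Longrightarrow> v = 0"
begin

abbreviation L :: "'e alt \<Rightarrow> 'e alt" where "L \<alpha> \<equiv> \<omega> \<and>\<^sub>a \<alpha>"

abbreviation Lk :: "nat \<Rightarrow> 'e alt \<Rightarrow> 'e alt" where "Lk k \<equiv> ((\<and>\<^sub>a) \<omega>) ^^ k"

text \<open>The 1-form \<open>\<flat>v = \<iota>\<^bsub>v\<^esub>\<omega>\<close>.\<close>

abbreviation musical :: "'e \<Rightarrow> 'e alt" where "musical v \<equiv> covector (\<lambda>w. \<omega> [v, w])"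

lemma \<iota>_\<omega>: "\<iota> v \<omega> = musical v"
proof -
  have "homog 1 (\<iota> v \<omega>)" using homog_\<iota>[of 1 \<omega> v] homog_\<omega> by (simp add: numeral_2_eq_2)
  moreover have "(\<lambda>w. \<iota> v \<omega> [w]) = (\<lambda>w. \<omega> [v, w])" by (simp add: \<iota>_def)
  ultimately show ?thesis using homog_1_covector[of "\<iota> v \<omega>"] by (simp only:)
qed

lemma grade_inv_\<omega>: "grade_inv \<omega> = \<omega>"
  using grade_inv_homog[OF homog_\<omega>] by simp

lemma linear_\<omega>: "linear (\<lambda>w. \<omega> [v, w])" "linear (\<lambda>w. \<omega> [w, v])"
  using alternating_linear[OF alt_\<omega>, of "[v]" "[]"] alternating_linear[OF alt_\<omega>, of "[]" "[v]"] by simp_all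

lemma \<omega>_antisym: "\<omega> [v, w] = - \<omega> [w, v]"
  using alternating_swap'[OF alt_\<omega>, of "[]" v w "[]"] by simp

lemma alternating_musical: "alternating (musical v)"
  by (rule alternating_covector[OF linear_\<omega>(1)])

lemma \<iota>_L: "\<iota> v (L \<alpha>) = musical v \<and>\<^sub>a \<alpha> + L (\<iota> v \<alpha>)"
  by (simp add: \<iota>_wedge \<iota>_\<omega> grade_inv_\<omega>)

lemma L_covector: "L (covector f \<and>\<^sub>a \<alpha>) = covector f \<and>\<^sub>a L \<alpha>"
  by (simp add: wedge_commute_even[OF grade_inv_\<omega>, of "covector f"] flip: wedge_assoc)

lemma Lk_covector: "Lk k (covector f \<and>\<^sub>a \<alpha>) = covector f \<and>\<^sub>a Lk k \<alpha>"
  by (induction k) (simp_all add: L_covector)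

lemma linear_Lk: "linear (Lk k)"
proof (induction k)
  case 0 show ?case by (rule linearI) simp_all
next
  case (Suc k) then show ?case using linear_compose[OF Suc wedge_linear_right[of \<omega>]] by (simp add: o_def)
qed

lemmas Lk_simps = linear_add[OF linear_Lk] linear_diff[OF linear_Lk] linear_scale[OF linear_Lk]
  linear_0[OF linear_Lk] linear_neg[OF linear_Lk]

text \<open>Since \<open>\<omega>\<close> has even degree, contraction is an ordinary derivation
  with respect to powers of \<open>L\<close>.\<close>

lemma \<iota>_Lk: "\<iota> v (Lk (Suc k) \<alpha>) = real (Suc k) *\<^sub>R (musical v \<and>\<^sub>a Lk k \<alpha>) + Lk (Suc k) (\<iota> v \<alpha>)"
proof (induction k)
  case 0 then show ?case by (simp add: \<iota>_L)
next
  case (Suc k)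
  have "\<iota> v (Lk (Suc (Suc k)) \<alpha>) = musical v \<and>\<^sub>a Lk (Suc k) \<alpha> + L (\<iota> v (Lk (Suc k) \<alpha>))"
    by (simp add: \<iota>_L)
  also have "\<dots> = musical v \<and>\<^sub>a Lk (Suc k) \<alpha> + real (Suc k) *\<^sub>R (musical v \<and>\<^sub>a Lk (Suc k) \<alpha>)
      + Lk (Suc (Suc k)) (\<iota> v \<alpha>)"
    unfolding Suc.IH wedge_simps L_covector by simp
  also have "\<dots> = real (Suc (Suc k)) *\<^sub>R (musical v \<and>\<^sub>a Lk (Suc k) \<alpha>) + Lk (Suc (Suc k)) (\<iota> v \<alpha>)"
    by (simp only: of_nat_Suc[of "Suc k"] scaleR_add_left scaleR_one add_ac)
  finally show ?case .
qed

lemma alternating_Lk: "alternating \<alpha> \<Longrightarrow> alternating (Lk k \<alpha>)"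
  by (induction k) (auto intro: alternating_wedge alt_\<omega>)

lemma homog_Lk: "homog p \<alpha> \<Longrightarrow> homog (p + 2 * k) (Lk k \<alpha>)"
proof (induction k)
  case (Suc k) then show ?case using homog_wedge[OF homog_\<omega>, of "p + 2 * k"] by (simp add: add_ac)
qed simp

lemma grade_inv_Lk: "homog p \<alpha> \<Longrightarrow> grade_inv (Lk k \<alpha>) = (-1) ^ p *\<^sub>R Lk k \<alpha>"
  by (simp add: grade_inv_homog[OF homog_Lk] power_add power_mult)

text \<open>Contraction maps primitive forms to primitive forms: it lowers the degree by one, and
  one more factor \<open>L\<close> kills the result, as the term with \<open>musical v\<close> in
  the product rule contains \<open>L\<^sup>k\<alpha> = 0\<close>. This makes inductions on the
  degree possible.\<close>

lemma Lk_\<iota>_eq_0: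
  assumes "Lk k \<alpha> = 0" shows "Lk (Suc k) (\<iota> v \<alpha>) = 0"
proof (cases k)
  case 0 then show ?thesis using assms by (simp add: Lk_simps)
next
  case (Suc l)
  have "Lk (Suc k) (\<iota> v \<alpha>) = L (\<iota> v (Lk k \<alpha>)) - real k *\<^sub>R L (musical v \<and>\<^sub>a Lk l \<alpha>)"
    unfolding Suc \<iota>_Lk by simp
  also have "L (musical v \<and>\<^sub>a Lk l \<alpha>) = musical v \<and>\<^sub>a Lk k \<alpha>"
    unfolding L_covector Suc by simp
  finally show ?thesis using assms by simp
qed

subsection \<open>Musical isomorphism on vectors\<close>

text \<open>The vector with \<open>\<flat>(T x) = x \<bullet> \<cdot>\<close>. It exists because
  \<open>\<flat>\<close> is injective and the dimension is finite.\<close>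

definition T :: "'e \<Rightarrow> 'e" where "T x = (SOME v. \<forall>w. \<omega> [v, w] = x \<bullet> w)"

lemma \<omega>_eqI: "(\<And>w. \<omega> [u, w] = \<omega> [v, w]) \<Longrightarrow> u = v"
  using nondeg[of "u - v"] linear_diff[OF linear_\<omega>(2)] by auto

lemma inner_\<omega>_expand: "(\<Sum>e\<in>B. \<omega> [v, e] *\<^sub>R e) \<bullet> w = \<omega> [v, w]"
proof -
  have "(\<Sum>e\<in>B. \<omega> [v, e] *\<^sub>R e) \<bullet> w = (\<Sum>e\<in>B. (e \<bullet> w) *\<^sub>R \<omega> [v, e])"
    by (simp add: inner_sum_left mult.commute)
  also have "\<dots> = \<omega> [v, w]"
    by (rule linear_expand[OF linear_\<omega>(1), symmetric])
  finally show ?thesis .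
qed

lemma T: "\<omega> [T x, w] = x \<bullet> w"
proof -
  define f where "f v = (\<Sum>e\<in>B. \<omega> [v, e] *\<^sub>R e)" for v
  have inner_f: "f v \<bullet> w = \<omega> [v, w]" for v w
    unfolding f_def by (rule inner_\<omega>_expand)
  have "linear f"
    unfolding f_def
    by (intro linear_compose_sum ballI linearI)
      (simp_all add: linear_add[OF linear_\<omega>(2)] linear_scale[OF linear_\<omega>(2)] algebra_simps)
  moreover have "v = 0" if "f v = 0" for v
    using nondeg[of v] inner_f[of v] that by auto
  ultimately have "surj f" by (rule inj_imp_surj)
  then obtain v where "x = f v" by (rule surjE)
  then have "\<forall>w. \<omega> [v, w] = x \<bullet> w" by (simp add: inner_f)
  then show ?thesis unfolding T_def by (rule someI2) blast
qed

lemma linear_T: "linear T"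
  by (rule linearI; rule \<omega>_eqI)
    (simp_all add: T linear_add[OF linear_\<omega>(2)] linear_scale[OF linear_\<omega>(2)] algebra_simps)

lemma musical_T: "musical (T x) = dual x"
  by (simp add: T)

lemma T_surj: "\<exists>x. T x = v"
  by (rule exI[of _ "\<Sum>e\<in>B. \<omega> [v, e] *\<^sub>R e"], rule \<omega>_eqI) (simp only: T inner_\<omega>_expand)

subsection \<open>Powers of the symplectic form\<close>

abbreviation \<omega>p :: "nat \<Rightarrow> 'e alt" where "\<omega>p k \<equiv> Lk k alt_unit"

lemma \<iota>_alt_unit: "\<iota> v alt_unit = 0"
  by (auto simp: fun_eq_iff alt_unit_def fun_app)

lemma alternating_\<omega>p: "alternating (\<omega>p k)" and homog_\<omega>p: "homog (2 * k) (\<omega>p k)"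
  using alternating_Lk[OF alternating_unit] homog_Lk[OF homog_unit, of k] by simp_all

lemma \<iota>_\<omega>p: "\<iota> v (\<omega>p (Suc k)) = real (Suc k) *\<^sub>R (musical v \<and>\<^sub>a \<omega>p k)"
  unfolding \<iota>_Lk \<iota>_alt_unit by (simp only: Lk_simps add_0_right)

text \<open>If \<open>\<omega>\<^bsup>k+1\<^esup> = 0\<close>, contraction shows that every 1-form
  annihilates \<open>\<omega>\<^sup>k\<close>, so \<open>\<omega>\<^sup>k\<close> vanishes or has
  top degree.\<close>

lemma \<omega>p_nonzero: "k \<le> n \<Longrightarrow> \<omega>p k \<noteq> 0"
proof (induction k)
  case 0
  have "alt_unit [] \<noteq> (0 :: 'e alt) []" by (simp add: alt_unit_def fun_app)
  then show ?case by (metis funpow_0)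
next
  case (Suc k)
  show ?case
  proof
    assume 0: "\<omega>p (Suc k) = 0"
    have "musical v \<and>\<^sub>a \<omega>p k = 0" for v
      using \<iota>_\<omega>p[of v k] unfolding 0 by simp
    then have "dual e \<and>\<^sub>a \<omega>p k = 0" for e
      using musical_T[of e] by metis
    then have "\<omega>p k = 0"
      using Suc.prems card_basis by (intro annihilated_zero[OF alternating_\<omega>p homog_\<omega>p]) auto
    then show False using Suc by simp
  qed
qed

text \<open>Induction on the degree by \<open>Lk_\<iota>_eq_0\<close>: all contractions of
  \<open>\<alpha>\<close> satisfy the same hypothesis with \<open>p - 1\<close> and \<open>k +
  1\<close>. For scalars it is the fact that \<open>\<omega>\<^sup>k \<noteq> 0\<close>.\<close>

lemma Lk_inj:
  assumes "alternating \<alpha>" "homog p \<alpha>" "p + k \<le> n" "Lk k \<alpha> = 0"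
  shows "\<alpha> = 0"
  using assms
proof (induction p arbitrary: k \<alpha>)
  case 0
  have "Lk k \<alpha> = \<alpha> [] *\<^sub>R \<omega>p k"
    by (subst homog_0_unit[OF 0(2)]) (simp only: Lk_simps)
  then have "\<alpha> [] = 0" using 0 \<omega>p_nonzero[of k] by simp
  with homog_0_unit[OF 0(2)] show ?case by (simp only: scaleR_zero_left)
next
  case (Suc p)
  have "\<iota> v \<alpha> = 0" for v
    using Suc.prems by (intro Suc.IH[OF alternating_\<iota> homog_\<iota> _ Lk_\<iota>_eq_0]) auto
  then show ?case
    by (intro homog_eqI[OF Suc.prems(2) homog_zero]) simp_all
qed

subsection \<open>Multivectors\<close>

text \<open>The form \<open>\<flat>x\<^sub>1 \<and> \<dots> \<and> \<flat>x\<^sub>k\<close>, the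
  image of a decomposable multivector under \<open>\<flat>\<close>.\<close>

abbreviation fprod :: "'e list \<Rightarrow> 'e alt" where
  "fprod xs \<equiv> cprod (map (\<lambda>x w. \<omega> [x, w]) xs)"

lemma alternating_fprod: "alternating (fprod xs)"
  by (rule alternating_cprod) (auto simp: linear_\<omega>)

lemma fprod_T: "fprod (map T xs) = cprod (map (\<bullet>) xs)"
  by (simp add: o_def T)

text \<open>The matrix of \<open>\<omega>\<close> is antisymmetric, so transposing the determinant
  costs one sign for each row.\<close>

lemma fprod_transpose: "fprod xs ys = (-1) ^ length ys * fprod ys xs"
proof -
  have *: "covector (\<lambda>x. \<omega> [x, y]) = - musical y" for y
    by (auto simp: fun_eq_iff covector_def fun_app intro: \<omega>_antisym)
  have "cprod (map (\<lambda>y x. \<omega> [x, y]) ys) = (-1) ^ length ys *\<^sub>R fprod ys"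
    by (induction ys) (simp_all add: *)
  then show ?thesis
    unfolding cprod_transpose[of "\<lambda>x w. \<omega> [x, w]" xs ys] by (simp add: fun_app)
qed

lemma alternating_fprod_left: "alternating (\<lambda>xs. fprod xs ys)"
proof -
  have "(\<lambda>xs. fprod xs ys) = (-1) ^ length ys *\<^sub>R fprod ys"
    by (rule ext) (simp add: fprod_transpose[of _ ys] fun_app)
  then show ?thesis by (simp add: alternating_scale alternating_fprod)
qed

lemma flat_alt_fprod: "flat_alt \<omega> P ys = P (\<lambda>xs. fprod xs ys)"
proof -
  have "(\<lambda>zs. \<omega> (x # zs)) = musical x" for x
    using \<iota>_\<omega>[of x] by (simp add: \<iota>_def)
  then show ?thesis unfolding flat_alt_def cprod_def by (simp add: o_def)
qed

end

lemma multivector_add: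
  "multivector P \<Longrightarrow> alternating \<alpha> \<Longrightarrow> alternating \<beta> \<Longrightarrow> P (\<alpha> + \<beta>) = P \<alpha> + P \<beta>"
  by (simp add: multivector_def plus_fun_def)

lemma multivector_scale:
  "multivector P \<Longrightarrow> alternating \<alpha> \<Longrightarrow> P (r *\<^sub>R \<alpha>) = r * P \<alpha>"
  by (simp add: multivector_def scaleR_fun_def)

lemma multivector_zero: "multivector P \<Longrightarrow> P 0 = 0"
  using multivector_scale[of P 0 0] by simp

lemma multivector_sum:
  "multivector P \<Longrightarrow> (\<And>i. i \<in> I \<Longrightarrow> alternating (f i)) \<Longrightarrow> P (\<Sum>i\<in>I. f i) = (\<Sum>i\<in>I. P (f i))"
  by (induction I rule: infinite_finite_induct)
    (auto simp: multivector_zero multivector_add alternating_sum)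

context symplectic_space
begin

text \<open>By \<open>fprod_transpose\<close>, the value of \<open>\<flat>P\<close> at
  \<open>ys\<close> is \<open>P\<close> applied to one form that depends on \<open>ys\<close>. As
  these forms span, \<open>P\<close> can be recovered from \<open>\<flat>P\<close>.\<close>

lemma flat_alt_eq:
  assumes "multivector P"
  shows "flat_alt \<omega> P ys = (-1) ^ length ys * P (fprod ys)"
proof -
  have "(\<lambda>xs. fprod xs ys) = (-1) ^ length ys *\<^sub>R fprod ys"
    by (rule ext) (simp add: fprod_transpose[of _ ys] fun_app)
  then show ?thesis
    unfolding flat_alt_fprod using multivector_scale[OF assms alternating_fprod] by simp
qed

lemma flat_alt_inj:
  assumes P: "multivector P" and Q: "multivector Q" and eq: "flat_alt \<omega> P = flat_alt \<omega> Q"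
  shows "P = Q"
proof
  fix \<alpha> :: "'e alt"
  have *: "P (fprod ys) = Q (fprod ys)" for ys
    using fun_cong[OF eq, of ys] by (simp add: flat_alt_eq[OF P] flat_alt_eq[OF Q])
  have c: "P (cprod (map (\<bullet>) J)) = Q (cprod (map (\<bullet>) J))" for J
    using *[of "map T J"] unfolding fprod_T .
  have a: "alternating (cprod (map (\<bullet>) J))" for J :: "'e list"
    using alternating_fprod[of "map T J"] unfolding fprod_T .
  have hom: "P \<beta> = Q \<beta>" if b: "alternating \<beta>" "homog m \<beta>" for m \<beta>
  proof -
    have "R \<beta> = (1 / fact m) * (\<Sum>J\<in>tuples m. \<beta> J * R (cprod (map (\<bullet>) J)))" if "multivector R" for R
      by (subst form_expansion[OF b])
        (simp add: multivector_scale[OF that] multivector_sum[OF that] alternating_sum alternating_scale a)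
    from this[OF P] this[OF Q] show ?thesis by (simp add: c)
  qed
  show "P \<alpha> = Q \<alpha>"
  proof (cases "alternating \<alpha>")
    case False then show ?thesis using P Q by (simp add: multivector_def)
  next
    case True
    have "R \<alpha> = (\<Sum>k\<le>card B. R (component k \<alpha>))" if "multivector R" for R
      using multivector_sum[OF that, of "{..card B}" "\<lambda>k. component k \<alpha>"] sum_components[OF True]
        alternating_component'[OF True] by simp
    from this[OF P] this[OF Q] show ?thesis
      using hom[OF alternating_component'[OF True] homog_component] by simp
  qed
qed

text \<open>The inverse of \<open>\<flat>\<close>. The expansion of \<open>\<alpha>\<close>
  reduces its definition to the products of dual basis covectors, and there
  \<open>flat_alt_eq\<close> prescribes the value, because \<open>dual e = \<flat>(T
  e)\<close>.\<close>

definition sharp :: "'e alt \<Rightarrow> 'e multivec" where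
  "sharp \<xi> \<alpha> = (if alternating \<alpha>
     then \<Sum>m\<le>card B. (-1) ^ m / fact m * (\<Sum>J\<in>tuples m. \<alpha> J * \<xi> (map T J)) else 0)"

lemma multivector_sharp: "multivector (sharp \<xi>)"
proof -
  have "sharp \<xi> (\<alpha> + \<beta>) = sharp \<xi> \<alpha> + sharp \<xi> \<beta>" if "alternating \<alpha>" "alternating \<beta>" for \<alpha> \<beta>
    using that by (simp add: sharp_def alternating_add fun_app algebra_simps sum.distrib)
  moreover have "sharp \<xi> (r *\<^sub>R \<alpha>) = r * sharp \<xi> \<alpha>" if "alternating \<alpha>" for r \<alpha>
    using that by (simp add: sharp_def alternating_scale fun_app sum_distrib_left algebra_simps)
  ultimately show ?thesis
    unfolding multivector_def by (simp add: plus_fun_def scaleR_fun_def sharp_def)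
qed

lemma sharp_homog:
  assumes "alternating \<alpha>" "homog m \<alpha>" "m \<le> card B"
  shows "sharp \<xi> \<alpha> = (-1) ^ m / fact m * (\<Sum>J\<in>tuples m. \<alpha> J * \<xi> (map T J))"
proof -
  let ?f = "\<lambda>k. (-1) ^ k / fact k * (\<Sum>J\<in>tuples k. \<alpha> J * \<xi> (map T J))"
  have "(\<Sum>J\<in>tuples k. \<alpha> J * \<xi> (map T J)) = 0" if "k \<noteq> m" for k
    using assms(2) that by (intro sum.neutral) (auto simp: homog_def tuples_def)
  then have "(\<Sum>k\<le>card B. ?f k) = (\<Sum>k\<le>card B. if k = m then ?f m else 0)"
    by (intro sum.cong) auto
  also have "\<dots> = ?f m" using assms(3) by simp
  finally show ?thesis using assms(1) by (simp add: sharp_def)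
qed

text \<open>After the substitution \<open>ys = map T zs\<close> the claim is the expansion of the
  pullback of \<open>\<xi>\<close> by \<open>T\<close>, evaluated at \<open>zs\<close>.\<close>

lemma flat_sharp:
  assumes "alternating \<xi>"
  shows "flat_alt \<omega> (sharp \<xi>) = \<xi>"
proof
  fix ys :: "'e list"
  define m where "m = length ys"
  have hf: "homog m (fprod ys)" using homog_cprod[of "map (\<lambda>x w. \<omega> [x, w]) ys"] by (simp add: m_def)
  show "flat_alt \<omega> (sharp \<xi>) ys = \<xi> ys"
  proof (cases "m \<le> card B")
    case False
    then have "\<xi> ys = 0"
      using fun_cong[OF component_gt_dim[OF assms, of m], of ys] by (simp add: component_def m_def fun_app)
    moreover have "fprod ys = 0" using alternating_gt_dim[OF alternating_fprod hf] False by simp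
    ultimately show ?thesis
      by (simp add: flat_alt_eq[OF multivector_sharp] multivector_zero[OF multivector_sharp])
  next
    case True
    have "\<forall>y. \<exists>x. T x = y" using T_surj by blast
    then obtain S where S: "\<And>y. T (S y) = y" by metis
    define zs where "zs = map S ys"
    have ys: "ys = map T zs" by (simp add: zs_def o_def S)
    have lz: "length zs = m" by (simp add: zs_def m_def)
    have "flat_alt \<omega> (sharp \<xi>) ys = (-1) ^ m * sharp \<xi> (fprod ys)"
      by (simp add: flat_alt_eq[OF multivector_sharp] m_def)
    also have "\<dots> = 1 / fact m * (\<Sum>J\<in>tuples m. fprod ys J * \<xi> (map T J))"
      by (simp add: sharp_homog[OF alternating_fprod hf True] power_mult_distrib[symmetric] mult.assoc[symmetric])
    also have "(\<Sum>J\<in>tuples m. fprod ys J * \<xi> (map T J))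
        = (\<Sum>J\<in>tuples m. component m (\<lambda>vs. \<xi> (map T vs)) J * cprod (map (\<bullet>) J) zs)"
    proof (rule sum.cong[OF refl])
      fix J assume "J \<in> tuples m"
      moreover have "fprod ys J = cprod (map (\<bullet>) J) zs"
        unfolding ys fprod_T cprod_transpose[of "(\<bullet>)" zs J] by (simp add: inner_commute)
      ultimately show "fprod ys J * \<xi> (map T J)
          = component m (\<lambda>vs. \<xi> (map T vs)) J * cprod (map (\<bullet>) J) zs"
        by (simp add: component_def tuples_def)
    qed
    also have "1 / fact m * \<dots> = component m (\<lambda>vs. \<xi> (map T vs)) zs"
      using fun_cong[OF form_expansion[OF alternating_component'[OF alternating_pull[OF assms linear_T]]
        homog_component, of m], of zs] by (simp add: fun_app sum_fun_apply)
    also have "\<dots> = \<xi> ys" by (simp add: component_def lz ys)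
    finally show ?thesis .
  qed
qed

subsection \<open>The star operator at a point\<close>

definition star_pt :: "'e alt \<Rightarrow> 'e alt" where
  "star_pt \<xi> = contract (sharp \<xi>) (\<omega>p n)"

text \<open>Injectivity of \<open>\<flat>\<close> allows any preimage of \<open>\<xi>\<close> to
  be used for the star operator.\<close>

lemma star_pt_eqI:
  assumes "multivector P" "flat_alt \<omega> P = \<xi>" "alternating \<xi>"
  shows "contract P (\<omega>p n) = star_pt \<xi>"
  using flat_alt_inj[OF assms(1) multivector_sharp] flat_sharp[OF assms(3)] assms(2)
  unfolding star_pt_def by metis

lemma alternating_append:
  fixes \<eta> :: "'e alt"
  assumes "alternating \<eta>"
  shows "alternating (\<lambda>xs. \<eta> (xs @ ys))" "alternating (\<lambda>ys. \<eta> (xs @ ys))"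
proof -
  show "alternating (\<lambda>xs. \<eta> (xs @ ys))" using assms by (simp add: alternating_def)
  have "linear (\<lambda>v. \<eta> (xs @ us @ v # ws))" for us ws
    using alternating_linear[OF assms, of "xs @ us" ws] by simp
  then show "alternating (\<lambda>ys. \<eta> (xs @ ys))" using assms by (simp add: alternating_def)
qed

lemma star_pt_apply:
  "star_pt \<xi> ys = (\<Sum>m\<le>card B. (-1) ^ m / fact m * (\<Sum>J\<in>tuples m. \<omega>p n (J @ ys) * \<xi> (map T J)))"
  unfolding star_pt_def contract_def sharp_def using alternating_append(1)[OF alternating_\<omega>p] by simp

lemma linear_star_pt: "linear star_pt"
  by (rule linearI)
    (simp_all add: fun_eq_iff star_pt_apply fun_app algebra_simps sum.distrib sum_distrib_left)

lemmas star_pt_simps = linear_add[OF linear_star_pt] linear_diff[OF linear_star_pt]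
  linear_scale[OF linear_star_pt] linear_neg[OF linear_star_pt] linear_0[OF linear_star_pt]

lemma alternating_star_pt: "alternating (star_pt \<xi>)"
proof -
  have "star_pt \<xi> = (\<Sum>m\<le>card B. ((-1) ^ m / fact m) *\<^sub>R
      (\<Sum>J\<in>tuples m. \<xi> (map T J) *\<^sub>R (\<lambda>ys. \<omega>p n (J @ ys))))"
    by (simp add: fun_eq_iff star_pt_apply sum_fun_apply fun_app mult.commute)
  then show ?thesis
    by (simp only:) (intro alternating_sum alternating_scale alternating_append(2) alternating_\<omega>p)
qed

lemma star_pt_degree:
  assumes "homog p \<xi>" "p + length ys \<noteq> 2 * n"
  shows "star_pt \<xi> ys = 0"
proof -
  have "\<omega>p n (J @ ys) * \<xi> (map T J) = 0" for J
    using assms homog_\<omega>p[of n] by (cases "length J = p") (auto simp: homog_def)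
  then show ?thesis
    unfolding star_pt_apply by (simp only: sum.neutral_const mult_zero_right)
qed

lemma homog_star_pt: "homog p \<xi> \<Longrightarrow> p + q = 2 * n \<Longrightarrow> homog q (star_pt \<xi>)"
  unfolding homog_def[of q] by (auto intro: star_pt_degree)

lemma star_pt_unit: "star_pt alt_unit = \<omega>p n"
proof -
  let ?P = "\<lambda>\<alpha>. if alternating \<alpha> then \<alpha> [] else (0::real)"
  have P: "multivector ?P"
    using alternating_add alternating_scale
    unfolding multivector_def plus_fun_def scaleR_fun_def by auto
  have "flat_alt \<omega> ?P = alt_unit"
  proof
    fix ys
    show "flat_alt \<omega> ?P ys = alt_unit ys"
      unfolding flat_alt_eq[OF P] using alternating_fprod[of ys] homog_cprod[of "map (\<lambda>x w. \<omega> [x, w]) ys"]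
      by (cases ys) (auto simp: alt_unit_def homog_def)
  qed
  from star_pt_eqI[OF P this alternating_unit] show ?thesis
    using alternating_append(1)[OF alternating_\<omega>p]
    by (auto simp: fun_eq_iff contract_def)
qed

text \<open>If \<open>P\<close> corresponds to \<open>\<xi>\<close>, then \<open>P \<and>
  v\<close> corresponds to \<open>\<xi> \<and> \<flat>v\<close>, and inserting \<open>P \<and>
  v\<close> into a form means to insert \<open>P\<close> and then \<open>v\<close>.\<close>

lemma star_pt_wedge_right:
  assumes \<xi>: "alternating \<xi>"
  shows "star_pt (\<xi> \<and>\<^sub>a musical v) = \<iota> v (star_pt \<xi>)"
proof -
  let ?P = "sharp \<xi>"
  let ?Q = "\<lambda>\<alpha>. if alternating \<alpha> then ?P (\<lambda>xs. \<alpha> (xs @ [v])) else 0"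
  note P = multivector_sharp[of \<xi>]
  have Q: "multivector ?Q"
    unfolding multivector_def
  proof (intro conjI allI impI)
    fix \<alpha> \<beta> :: "'e alt" assume ab: "alternating \<alpha> \<and> alternating \<beta>"
    have "alternating (\<lambda>vs. \<alpha> vs + \<beta> vs)" using ab alternating_add unfolding plus_fun_def by blast
    moreover have "?P (\<lambda>xs. \<alpha> (xs @ [v]) + \<beta> (xs @ [v])) = ?P (\<lambda>xs. \<alpha> (xs @ [v])) + ?P (\<lambda>xs. \<beta> (xs @ [v]))"
      using ab P unfolding multivector_def by (auto intro: alternating_append)
    ultimately show "?Q (\<lambda>vs. \<alpha> vs + \<beta> vs) = ?Q \<alpha> + ?Q \<beta>" using ab by simp
  next
    fix r and \<alpha> :: "'e alt" assume a: "alternating \<alpha>"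
    have "alternating (\<lambda>vs. r * \<alpha> vs)" using a alternating_scale unfolding scaleR_fun_def by auto
    moreover have "?P (\<lambda>xs. r * \<alpha> (xs @ [v])) = r * ?P (\<lambda>xs. \<alpha> (xs @ [v]))"
      using multivector_scale[OF P alternating_append(1)[OF a]] unfolding scaleR_fun_def by simp
    ultimately show "?Q (\<lambda>vs. r * \<alpha> vs) = r * ?Q \<alpha>" using a by simp
  qed auto
  note alt = alternating_fprod_left
  have "flat_alt \<omega> ?Q = \<xi> \<and>\<^sub>a musical v"
  proof
    fix ys :: "'e list"
    let ?m = "length ys"
    let ?s = "\<lambda>I. shuffle_sign ?m I * musical v (nths ys ({..<?m} - I))"
    \<comment> \<open>expanding only the product with the last factor leaves forms to which the
      linear \<open>?P\<close> applies\<close>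
    have "flat_alt \<omega> ?Q ys = ?P (\<lambda>xs. fprod (xs @ [v]) ys)"
      unfolding flat_alt_fprod using alt by simp
    also have "(\<lambda>xs. fprod (xs @ [v]) ys) = (\<Sum>I\<in>Pow {..<?m}. ?s I *\<^sub>R (\<lambda>xs. fprod xs (nths ys I)))"
      by (simp add: fun_eq_iff cprod_append wedge_def sum_fun_apply fun_app algebra_simps)
    also have "?P \<dots> = (\<Sum>I\<in>Pow {..<?m}. ?s I * ?P (\<lambda>xs. fprod xs (nths ys I)))"
      using P alt by (simp add: multivector_sum multivector_scale alternating_scale)
    also have "\<dots> = (flat_alt \<omega> ?P \<and>\<^sub>a musical v) ys"
      unfolding wedge_def flat_alt_fprod by (simp add: algebra_simps)
    finally show "flat_alt \<omega> ?Q ys = (\<xi> \<and>\<^sub>a musical v) ys" unfolding flat_sharp[OF \<xi>] .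
  qed
  from star_pt_eqI[OF Q this alternating_wedge[OF \<xi> alternating_musical]]
  have "star_pt (\<xi> \<and>\<^sub>a musical v) = contract ?Q (\<omega>p n)" by simp
  also have "\<dots> = \<iota> v (star_pt \<xi>)"
    using alternating_append(1)[OF alternating_\<omega>p]
    by (simp add: fun_eq_iff contract_def star_pt_def fun_app)
  finally show ?thesis .
qed

lemma star_pt_wedge:
  assumes "alternating \<xi>"
  shows "star_pt (musical v \<and>\<^sub>a \<xi>) = \<iota> v (star_pt (grade_inv \<xi>))"
  unfolding wedge_commute_odd[OF grade_inv_covector]
  by (rule star_pt_wedge_right[OF alternating_grade_inv[OF assms]])

text \<open>The star operator exchanges contraction with \<open>v\<close> and multiplication by
  \<open>\<flat>v\<close>. One half is \<open>star_pt_wedge\<close>; this half follows by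
  induction over products of covectors, as \<open>\<omega> [u, v] + \<omega> [v, u] =
  0\<close>.\<close>

lemma star_pt_\<iota>:
  assumes "alternating \<xi>" "homog p \<xi>"
  shows "star_pt (\<iota> v \<xi>) = musical v \<and>\<^sub>a star_pt (grade_inv \<xi>)"
  using assms
proof (induction rule: alternating_induct)
  case unit
  have "musical v \<and>\<^sub>a \<omega>p n = 0"
    using homog_wedge[OF homog_covector homog_\<omega>p] card_basis
    by (intro alternating_gt_dim[of _ "1 + 2 * n"] alternating_wedge alternating_musical alternating_\<omega>p) auto
  then show ?case
    by (simp only: \<iota>_alt_unit grade_inv_homog[OF homog_unit] star_pt_unit star_pt_simps power_0 scaleR_one)
next
  case (scale q r \<alpha>)
  have "grade_inv (r *\<^sub>R \<alpha>) = r *\<^sub>R grade_inv \<alpha>" by (simp add: grade_inv_def fun_eq_iff fun_app)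
  then show ?case using scale by (simp add: star_pt_simps)
next
  case (add q \<alpha> \<beta>)
  have "grade_inv (\<alpha> + \<beta>) = grade_inv \<alpha> + grade_inv \<beta>"
    by (simp add: grade_inv_def fun_eq_iff fun_app algebra_simps)
  then show ?case using add by (simp add: star_pt_simps)
next
  case (wedge q e \<alpha>)
  define u where "u = T e"
  have d: "dual e = musical u" by (simp add: u_def musical_T)
  have g: "grade_inv \<alpha> = (-1) ^ q *\<^sub>R \<alpha>" using wedge by (simp add: grade_inv_homog)
  have s: "(-1) ^ q * (-1) ^ q = (1::real)" by (simp add: power_mult_distrib[symmetric])
  have 1: "star_pt (\<iota> v (grade_inv \<alpha>)) = musical v \<and>\<^sub>a star_pt \<alpha>"
    using wedge.IH by (simp add: g star_pt_simps s)
  have "star_pt (\<iota> v (musical u \<and>\<^sub>a \<alpha>)) = \<omega> [u, v] *\<^sub>R star_pt \<alpha> - star_pt (musical u \<and>\<^sub>a \<iota> v \<alpha>)"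
    by (simp add: \<iota>_covector_wedge star_pt_simps)
  also have "star_pt (musical u \<and>\<^sub>a \<iota> v \<alpha>) = - \<iota> u (star_pt (\<iota> v (grade_inv \<alpha>)))"
    using wedge by (simp add: star_pt_wedge alternating_\<iota> \<iota>_grade_inv star_pt_simps)
  also have "\<dots> = - \<omega> [v, u] *\<^sub>R star_pt \<alpha> + musical v \<and>\<^sub>a \<iota> u (star_pt \<alpha>)"
    unfolding 1 by (simp add: \<iota>_covector_wedge)
  also have "\<omega> [u, v] *\<^sub>R star_pt \<alpha> - (- \<omega> [v, u] *\<^sub>R star_pt \<alpha> + musical v \<and>\<^sub>a \<iota> u (star_pt \<alpha>))
      = - (musical v \<and>\<^sub>a \<iota> u (star_pt \<alpha>))"
    using \<omega>_antisym[of u v] by simp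
  also have "\<dots> = musical v \<and>\<^sub>a star_pt (grade_inv (musical u \<and>\<^sub>a \<alpha>))"
    using wedge by (simp add: grade_inv_wedge grade_inv_covector star_pt_simps star_pt_wedge alternating_grade_inv)
  finally show ?case unfolding d .
qed

end

text \<open>The sign \<open>(-1)\<^bsup>p(p-1)/2\<^esup>\<close>; the recursion is the form in
  which it arises from the induction on the degree.\<close>

fun star_sign :: "nat \<Rightarrow> real" where
  "star_sign 0 = 1"
| "star_sign (Suc p) = (-1) ^ p * star_sign p"

context symplectic_space
begin

text \<open>The case of scalars. Contraction does not suffice to compare the two sides, because
  the degree of \<open>\<omega>p j\<close> may be 0; multiplication by covectors does, because it
  is not the top degree.\<close>

lemma star_pt_\<omega>p:
  "i + j = n \<Longrightarrow> star_pt (\<omega>p i) = (fact n * fact i / fact j) *\<^sub>R \<omega>p j"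
proof (induction i arbitrary: j)
  case 0 then show ?case using star_pt_unit by simp
next
  case (Suc i)
  let ?c = "fact n * fact (Suc i) / fact j"
  let ?\<delta> = "star_pt (\<omega>p (Suc i)) - ?c *\<^sub>R \<omega>p j"
  have IH: "star_pt (\<omega>p i) = (fact n * fact i / fact (Suc j)) *\<^sub>R \<omega>p (Suc j)"
    using Suc.prems by (intro Suc.IH) simp
  have even: "grade_inv (\<omega>p k) = \<omega>p k" for k
    using grade_inv_Lk[OF homog_unit, of k] by simp
  have "musical v \<and>\<^sub>a ?\<delta> = 0" for v
  proof -
    have "musical v \<and>\<^sub>a star_pt (\<omega>p (Suc i)) = star_pt (\<iota> v (\<omega>p (Suc i)))"
      unfolding star_pt_\<iota>[OF alternating_\<omega>p homog_\<omega>p] even ..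
    also have "\<dots> = real (Suc i) *\<^sub>R \<iota> v (star_pt (\<omega>p i))"
      unfolding \<iota>_\<omega>p star_pt_simps star_pt_wedge[OF alternating_\<omega>p] even ..
    also have "\<dots> = (real (Suc i) * (fact n * fact i / fact (Suc j)) * real (Suc j)) *\<^sub>R (musical v \<and>\<^sub>a \<omega>p j)"
      unfolding IH \<iota>_scale \<iota>_\<omega>p by (simp only: scaleR_scaleR mult.assoc)
    also have "real (Suc i) * (fact n * fact i / fact (Suc j)) * real (Suc j) = ?c"
      unfolding fact_Suc by (simp add: field_simps del: of_nat_Suc)
    finally show ?thesis by simp
  qed
  then have "dual e \<and>\<^sub>a ?\<delta> = 0" for e
    using musical_T[of e] by metis
  moreover have "homog (2 * j) ?\<delta>"
    using Suc.prems by (intro homog_diff homog_scale homog_\<omega>p homog_star_pt[OF homog_\<omega>p]) simp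
  ultimately have "?\<delta> = 0"
    using Suc.prems card_basis
    by (intro annihilated_zero[of ?\<delta> "2 * j"] alternating_diff alternating_scale alternating_star_pt alternating_\<omega>p) auto
  then show ?case by simp
qed

text \<open>Both sides are compared after contraction with a vector. On the left, contraction
  becomes multiplication by a covector under the star operator, and the product rule expresses it
  by the same statement for the next power of \<open>L\<close> and for the contraction of
  \<open>\<alpha>\<close>, which is primitive of smaller degree. So there is an outer induction on
  the degree and an inner one on \<open>j\<close>, starting with
  \<open>L\<^bsup>i+1\<^esup>\<alpha> = 0\<close>.\<close>

theorem star_pt_primitive:
  assumes "alternating \<alpha>" "homog p \<alpha>" "p + i + j = n" "Lk (Suc (i + j)) \<alpha> = 0"
  shows "star_pt (Lk i \<alpha>) = (star_sign p * fact n * fact i / fact j) *\<^sub>R Lk j \<alpha>"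
  using assms
proof (induction p arbitrary: i j \<alpha>)
  case 0
  have *: "Lk k \<alpha> = \<alpha> [] *\<^sub>R \<omega>p k" for k
    by (subst homog_0_unit[OF 0(2)]) (simp only: Lk_simps)
  show ?case unfolding * star_pt_simps using 0 by (simp add: star_pt_\<omega>p)
next
  case (Suc p)
  note alt = Suc.prems(1) and hom = Suc.prems(2)
  let ?s = "(-1) ^ Suc p :: real"
  have distrib: "s *\<^sub>R (s *\<^sub>R \<beta> - c *\<^sub>R \<gamma>) = (s * s) *\<^sub>R \<beta> + (- s * c) *\<^sub>R \<gamma>"
    for s c :: real and \<beta> \<gamma> :: "'e alt"
    by (simp add: scaleR_diff_right)
  have ss: "?s * ?s = 1" by (simp add: power_mult_distrib[symmetric])
  have step: "real (Suc i) *\<^sub>R \<iota> v (star_pt (Lk i \<alpha>)) = musical v \<and>\<^sub>a star_pt (Lk (Suc i) \<alpha>)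
      + (real (Suc i) * (star_sign (Suc p) * fact n * fact i / fact j)) *\<^sub>R Lk j (\<iota> v \<alpha>)"
    if ij: "Suc p + i + j = n" and kill: "Lk (Suc (i + j)) \<alpha> = 0" for i j v
  proof -
    note aL = alternating_Lk[OF alt] and gL = grade_inv_Lk[OF hom]
    have "\<iota> v (star_pt (Lk i \<alpha>)) = star_pt (musical v \<and>\<^sub>a grade_inv (Lk i \<alpha>))"
      by (simp only: star_pt_wedge[OF alternating_grade_inv[OF aL]] grade_inv_grade_inv)
    also have "\<dots> = ?s *\<^sub>R star_pt (musical v \<and>\<^sub>a Lk i \<alpha>)"
      unfolding gL wedge_simps star_pt_simps ..
    finally have "real (Suc i) *\<^sub>R \<iota> v (star_pt (Lk i \<alpha>))
        = ?s *\<^sub>R star_pt (real (Suc i) *\<^sub>R (musical v \<and>\<^sub>a Lk i \<alpha>))"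
      by (simp only: star_pt_simps scaleR_scaleR mult.commute)
    also have "real (Suc i) *\<^sub>R (musical v \<and>\<^sub>a Lk i \<alpha>) = \<iota> v (Lk (Suc i) \<alpha>) - Lk (Suc i) (\<iota> v \<alpha>)"
      unfolding \<iota>_Lk by simp
    also have "star_pt \<dots> = ?s *\<^sub>R (musical v \<and>\<^sub>a star_pt (Lk (Suc i) \<alpha>)) - star_pt (Lk (Suc i) (\<iota> v \<alpha>))"
      unfolding star_pt_simps star_pt_\<iota>[OF aL homog_Lk[OF hom]] gL wedge_simps ..
    also have "star_pt (Lk (Suc i) (\<iota> v \<alpha>)) = (star_sign p * fact n * fact (Suc i) / fact j) *\<^sub>R Lk j (\<iota> v \<alpha>)"
      using ij Lk_\<iota>_eq_0[OF kill, of v]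
      by (intro Suc.IH[OF alternating_\<iota>[OF alt] homog_\<iota>[OF hom]]) simp_all
    also have "?s *\<^sub>R (?s *\<^sub>R (musical v \<and>\<^sub>a star_pt (Lk (Suc i) \<alpha>))
          - (star_sign p * fact n * fact (Suc i) / fact j) *\<^sub>R Lk j (\<iota> v \<alpha>))
        = (?s * ?s) *\<^sub>R (musical v \<and>\<^sub>a star_pt (Lk (Suc i) \<alpha>))
          + (- ?s * (star_sign p * fact n * fact (Suc i) / fact j)) *\<^sub>R Lk j (\<iota> v \<alpha>)"
      by (rule distrib)
    also have "- ?s * (star_sign p * fact n * fact (Suc i) / fact j)
        = real (Suc i) * (star_sign (Suc p) * fact n * fact i / fact j)"
      unfolding fact_Suc by (simp add: field_simps del: of_nat_Suc)
    finally show ?thesis unfolding ss scaleR_one .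
  qed
  show ?case using Suc.prems(3,4)
  proof (induction j arbitrary: i)
    case 0
    let ?c = "star_sign (Suc p) * fact n * fact i / fact 0"
    have eq: "\<iota> v (star_pt (Lk i \<alpha>)) = \<iota> v (?c *\<^sub>R Lk 0 \<alpha>)" for v
    proof -
      have "Lk (Suc i) \<alpha> = 0" using 0 by simp
      then have "real (Suc i) *\<^sub>R \<iota> v (star_pt (Lk i \<alpha>)) = (real (Suc i) * ?c) *\<^sub>R Lk 0 (\<iota> v \<alpha>)"
        unfolding step[OF 0] by (simp only: star_pt_simps wedge_simps add_0_left)
      also have "\<dots> = real (Suc i) *\<^sub>R \<iota> v (?c *\<^sub>R Lk 0 \<alpha>)"
        unfolding funpow_0 \<iota>_scale scaleR_scaleR ..
      finally show ?thesis unfolding scaleR_cancel_left by (simp del: of_nat_Suc)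
    qed
    have h1: "homog (Suc p) (star_pt (Lk i \<alpha>))"
      using 0 by (intro homog_star_pt[OF homog_Lk[OF hom]]) simp
    have h2: "homog (Suc p) (?c *\<^sub>R Lk 0 \<alpha>)" using homog_scale[OF hom] by (simp only: funpow_0)
    show ?case by (rule homog_eqI[OF h1 h2 _ eq]) simp
  next
    case (Suc j)
    let ?c = "star_sign (Suc p) * fact n * fact i / fact (Suc j)"
    let ?c' = "star_sign (Suc p) * fact n * fact (Suc i) / fact j"
    have eq: "\<iota> v (star_pt (Lk i \<alpha>)) = \<iota> v (?c *\<^sub>R Lk (Suc j) \<alpha>)" for v
    proof -
      have IH: "star_pt (Lk (Suc i) \<alpha>) = ?c' *\<^sub>R Lk j \<alpha>"
        using Suc.prems by (intro Suc.IH) simp_all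
      have "real (Suc i) *\<^sub>R \<iota> v (star_pt (Lk i \<alpha>))
          = ?c' *\<^sub>R (musical v \<and>\<^sub>a Lk j \<alpha>) + (real (Suc i) * ?c) *\<^sub>R Lk (Suc j) (\<iota> v \<alpha>)"
        unfolding step[OF Suc.prems] IH wedge_simps ..
      also have "?c' = real (Suc i) * (?c * real (Suc j))"
        unfolding fact_Suc by (simp add: field_simps del: of_nat_Suc)
      also have "\<dots> *\<^sub>R (musical v \<and>\<^sub>a Lk j \<alpha>) + (real (Suc i) * ?c) *\<^sub>R Lk (Suc j) (\<iota> v \<alpha>)
          = real (Suc i) *\<^sub>R \<iota> v (?c *\<^sub>R Lk (Suc j) \<alpha>)"
        unfolding \<iota>_scale \<iota>_Lk by (simp only: scaleR_scaleR scaleR_add_right mult.assoc)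
      finally show ?thesis unfolding scaleR_cancel_left by (simp del: of_nat_Suc)
    qed
    have h1: "homog (Suc p + 2 * Suc j) (star_pt (Lk i \<alpha>))"
      using Suc.prems by (intro homog_star_pt[OF homog_Lk[OF hom]]) simp
    have h2: "homog (Suc p + 2 * Suc j) (?c *\<^sub>R Lk (Suc j) \<alpha>)"
      by (intro homog_scale homog_Lk hom)
    show ?case by (rule homog_eqI[OF h1 h2 _ eq]) simp
  qed
qed

end

section \<open>Abstract Lefschetz theory\<close>

text \<open>What the argument uses about the invariant forms: a graded space in which
  \<open>L\<close> satisfies hard Lefschetz, a differential that commutes with \<open>L\<close>,
  and a star operator that is known on the powers of \<open>L\<close> applied to primitive
  elements.\<close>

locale lefschetz_complex =
  fixes n :: nat and \<Omega> :: "nat \<Rightarrow> 'b::real_vector set" and L d s :: "'b \<Rightarrow> 'b"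
  assumes subspace_\<Omega>: "subspace (\<Omega> p)"
    and \<Omega>_gt: "x \<in> \<Omega> p \<Longrightarrow> 2 * n < p \<Longrightarrow> x = 0"
    and L_\<Omega>: "x \<in> \<Omega> p \<Longrightarrow> L x \<in> \<Omega> (p + 2)"
    and linear_L: "linear L"
    and d_\<Omega>: "x \<in> \<Omega> p \<Longrightarrow> d x \<in> \<Omega> (Suc p)"
    and d_add: "x \<in> \<Omega> p \<Longrightarrow> y \<in> \<Omega> p \<Longrightarrow> d (x + y) = d x + d y"
    and d_scale: "x \<in> \<Omega> p \<Longrightarrow> d (r *\<^sub>R x) = r *\<^sub>R d x"
    and d_d: "x \<in> \<Omega> p \<Longrightarrow> d (d x) = 0"
    and d_L: "x \<in> \<Omega> p \<Longrightarrow> d (L x) = L (d x)"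
    and L_inj: "x \<in> \<Omega> p \<Longrightarrow> p + k \<le> n \<Longrightarrow> (L ^^ k) x = 0 \<Longrightarrow> x = 0"
    and L_surj: "y \<in> \<Omega> (n + k) \<Longrightarrow> k \<le> n \<Longrightarrow> \<exists>x\<in>\<Omega> (n - k). (L ^^ k) x = y"
    and s_add: "x \<in> \<Omega> p \<Longrightarrow> y \<in> \<Omega> p \<Longrightarrow> s (x + y) = s x + s y"
    and s_scale: "x \<in> \<Omega> p \<Longrightarrow> s (r *\<^sub>R x) = r *\<^sub>R s x"
    and s_primitive: "x \<in> \<Omega> p \<Longrightarrow> p + i + j = n \<Longrightarrow> (L ^^ Suc (i + j)) x = 0 \<Longrightarrow>
          s ((L ^^ i) x) = (star_sign p * fact n * fact i / fact j) *\<^sub>R (L ^^ j) x"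
begin

lemma zero_\<Omega>: "0 \<in> \<Omega> p" and add_\<Omega>: "x \<in> \<Omega> p \<Longrightarrow> y \<in> \<Omega> p \<Longrightarrow> x + y \<in> \<Omega> p"
  and scale_\<Omega>: "x \<in> \<Omega> p \<Longrightarrow> r *\<^sub>R x \<in> \<Omega> p" and diff_\<Omega>: "x \<in> \<Omega> p \<Longrightarrow> y \<in> \<Omega> p \<Longrightarrow> x - y \<in> \<Omega> p"
  and sum_\<Omega>: "(\<And>i. i \<in> I \<Longrightarrow> f i \<in> \<Omega> p) \<Longrightarrow> sum f I \<in> \<Omega> p"
  using subspace_\<Omega> by (auto intro: subspace_0 subspace_add subspace_mul subspace_diff subspace_sum)

lemma d_0: "d 0 = 0" and s_0: "s 0 = 0"
  using d_scale[OF zero_\<Omega>, of 0] s_scale[OF zero_\<Omega>, of 0] by simp_all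

lemma d_diff: "x \<in> \<Omega> p \<Longrightarrow> y \<in> \<Omega> p \<Longrightarrow> d (x - y) = d x - d y"
  using d_add[of x p "(-1) *\<^sub>R y"] d_scale[of y p "-1"] scale_\<Omega>[of y p "-1"] by simp

lemma d_sum: "(\<And>i. i \<in> I \<Longrightarrow> f i \<in> \<Omega> p) \<Longrightarrow> d (\<Sum>i\<in>I. f i) = (\<Sum>i\<in>I. d (f i))"
  by (induction I rule: infinite_finite_induct) (auto simp: d_0 intro!: d_add[of _ p] sum_\<Omega> trans[OF d_add])

lemma s_sum: "(\<And>i. i \<in> I \<Longrightarrow> f i \<in> \<Omega> p) \<Longrightarrow> s (\<Sum>i\<in>I. f i) = (\<Sum>i\<in>I. s (f i))"
  by (induction I rule: infinite_finite_induct) (auto simp: s_0 intro!: s_add[of _ p] sum_\<Omega> trans[OF s_add])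

lemma linear_Lk: "linear (L ^^ k)"
proof (induction k)
  case 0 show ?case by (rule linearI) simp_all
next
  case (Suc k) then show ?case using linear_compose[OF Suc linear_L] by (simp add: o_def)
qed

lemmas Lk_simps = linear_add[OF linear_Lk] linear_diff[OF linear_Lk] linear_scale[OF linear_Lk]
  linear_0[OF linear_Lk] linear_sum[OF linear_Lk]

lemma Lk_\<Omega>: "x \<in> \<Omega> p \<Longrightarrow> (L ^^ k) x \<in> \<Omega> (p + 2 * k)"
proof (induction k)
  case (Suc k) then show ?case using L_\<Omega>[of "(L ^^ k) x" "p + 2 * k"] by (simp add: add_ac)
qed simp

lemma d_Lk: "x \<in> \<Omega> p \<Longrightarrow> d ((L ^^ k) x) = (L ^^ k) (d x)"
proof (induction k)
  case (Suc k) then show ?case using d_L[OF Lk_\<Omega>[OF Suc.prems, of k]] by simp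
qed simp

lemma Lk_Lk: "(L ^^ i) ((L ^^ j) x) = (L ^^ (i + j)) x"
  by (simp add: funpow_add)

lemma Lk_zero_mono: "(L ^^ i) x = 0 \<Longrightarrow> i \<le> j \<Longrightarrow> (L ^^ j) x = 0"
  using Lk_Lk[of "j - i" i x] by (simp add: Lk_simps)

subsection \<open>Primitive elements\<close>

text \<open>The primitive elements of degree \<open>n - k\<close>. The convention for \<open>k >
  n\<close> allows sums over all pairs \<open>(i, j)\<close> without a restriction on \<open>i +
  j\<close>.\<close>

definition Prim :: "nat \<Rightarrow> 'b set" where
  "Prim k = (if k \<le> n then {x \<in> \<Omega> (n - k). (L ^^ Suc k) x = 0} else {0})"

lemma Prim_zero: "0 \<in> Prim k"
  using linear_0[OF linear_Lk, of "Suc k"] by (simp add: Prim_def zero_\<Omega>)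

lemma Prim_gt: "x \<in> Prim k \<Longrightarrow> n < k \<Longrightarrow> x = 0"
  by (simp add: Prim_def)

lemma Prim_add: "x \<in> Prim k \<Longrightarrow> y \<in> Prim k \<Longrightarrow> x + y \<in> Prim k"
  using Lk_simps(1)[of "Suc k" x y] by (auto simp: Prim_def add_\<Omega> split: if_splits)

lemma Prim_scale: "x \<in> Prim k \<Longrightarrow> r *\<^sub>R x \<in> Prim k"
  using Lk_simps(3)[of "Suc k" r x] by (auto simp: Prim_def scale_\<Omega> split: if_splits)

lemma Prim_\<Omega>: "x \<in> Prim k \<Longrightarrow> x \<in> \<Omega> (n - k)"
  by (auto simp: Prim_def zero_\<Omega> split: if_splits)

lemma Prim_kill: "x \<in> Prim k \<Longrightarrow> k < i \<Longrightarrow> (L ^^ i) x = 0"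
  by (rule Lk_zero_mono[of "Suc k"]) (auto simp: Prim_def linear_0[OF linear_L] Lk_simps split: if_splits)

lemma Prim_inj:
  assumes "x \<in> Prim k" "(L ^^ k) x = 0" shows "x = 0"
proof (cases "k \<le> n")
  case True then show ?thesis using assms L_inj[of x "n - k" k] Prim_\<Omega> by simp
next
  case False then show ?thesis using assms Prim_gt by simp
qed

text \<open>The element \<open>L\<^sup>k(dx)\<close> has degree \<open>n + (k + 1)\<close>, so it
  is \<open>L\<^bsup>k+1\<^esup>b\<close> for some \<open>b\<close>; then \<open>L\<^sup>k\<close>
  kills \<open>a = dx - Lb\<close>. Both are primitive because \<open>L\<^bsup>k+1\<^esup>dx = d
  L\<^bsup>k+1\<^esup>x = 0\<close>.\<close>

lemma d_Prim:
  assumes x: "x \<in> Prim k"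
  obtains a b where "d x = a + L b" "b \<in> Prim (Suc k)" "a \<in> Prim (k - 1)" "k = 0 \<Longrightarrow> a = 0"
    "x = 0 \<Longrightarrow> a = 0 \<and> b = 0"
proof (cases "x = 0")
  case True
  then show ?thesis using that[of 0 0] by (simp add: d_0 Prim_zero linear_0[OF linear_L])
next
  case False
  then have kn: "k \<le> n" using x Prim_gt by (meson not_le)
  note x\<Omega> = Prim_\<Omega>[OF x]
  have kill: "(L ^^ Suc k) (d x) = 0"
    using d_Lk[OF x\<Omega>, of "Suc k"] Prim_kill[OF x, of "Suc k"] by (simp only: lessI d_0)
  have dx: "d x \<in> \<Omega> (Suc (n - k))" by (rule d_\<Omega>[OF x\<Omega>])
  have Ldx: "(L ^^ k) (d x) \<in> \<Omega> (n + Suc k)" using Lk_\<Omega>[OF dx, of k] kn by (simp add: add.commute)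
  obtain b where b: "b \<in> Prim (Suc k)" and Lb: "(L ^^ Suc k) b = (L ^^ k) (d x)"
  proof (cases "Suc k \<le> n")
    case True
    from L_surj[OF Ldx True] obtain b where b: "b \<in> \<Omega> (n - Suc k)" "(L ^^ Suc k) b = (L ^^ k) (d x)"
      by blast
    have "(L ^^ Suc (Suc k)) b = L ((L ^^ Suc k) b)" by simp
    also have "\<dots> = (L ^^ Suc k) (d x)" unfolding b(2) by simp
    finally have "b \<in> Prim (Suc k)" using True b(1) kill by (simp add: Prim_def)
    then show ?thesis using that b(2) by blast
  next
    case False
    then have "(L ^^ k) (d x) = 0" using \<Omega>_gt[OF Ldx] kn by simp
    then show ?thesis using that[of 0] Prim_zero Lk_simps(4)[of "Suc k"] by simp
  qed
  define a where "a = d x - L b"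
  have La: "(L ^^ k) a = 0"
    unfolding a_def Lk_simps using Lb by (simp add: funpow_swap1)
  have "a \<in> Prim (k - 1)"
  proof (cases k)
    case 0 then show ?thesis using La Prim_zero by simp
  next
    case (Suc l)
    have "L b \<in> \<Omega> (Suc (n - k))"
    proof (cases "Suc k \<le> n")
      case True
      then have "n - Suc k + 2 = Suc (n - k)" by simp
      then show ?thesis using L_\<Omega>[OF Prim_\<Omega>[OF b]] by simp
    next
      case False
      then show ?thesis using Prim_gt[OF b] by (simp add: linear_0[OF linear_L] zero_\<Omega>)
    qed
    then have "a \<in> \<Omega> (Suc (n - k))" unfolding a_def using dx by (rule diff_\<Omega>[rotated])
    moreover have "Suc (n - k) = n - l" using Suc kn by simp
    ultimately show ?thesis using La Suc kn by (simp add: Prim_def)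
  qed
  moreover have "k = 0 \<Longrightarrow> a = 0" using La by simp
  moreover have "d x = a + L b" by (simp add: a_def)
  ultimately show ?thesis using that[of a b] b False by blast
qed

subsection \<open>Lefschetz decomposition\<close>

text \<open>Terms are indexed by pairs \<open>(i, j)\<close> with \<open>X i j\<close> primitive
  of degree \<open>n - (i + j)\<close>, since in these indices the star operator is the exchange
  of \<open>i\<close> and \<open>j\<close>.\<close>

definition assemble :: "(nat \<Rightarrow> nat \<Rightarrow> 'b) \<Rightarrow> 'b" where
  "assemble X = (\<Sum>i\<le>n. \<Sum>j\<le>n. (L ^^ i) (X i j))"

text \<open>The second condition says that \<open>L\<^sup>i (X i j)\<close> has degree \<open>p =
  n + i - j\<close>.\<close>

definition prim_family :: "nat \<Rightarrow> (nat \<Rightarrow> nat \<Rightarrow> 'b) \<Rightarrow> bool" where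
  "prim_family p X \<longleftrightarrow> (\<forall>i j. X i j \<in> Prim (i + j)) \<and> (\<forall>i j. n + i \<noteq> p + j \<longrightarrow> X i j = 0)"

lemma prim_family_Prim: "prim_family p X \<Longrightarrow> X i j \<in> Prim (i + j)"
  and prim_family_deg: "prim_family p X \<Longrightarrow> n + i \<noteq> p + j \<Longrightarrow> X i j = 0"
  and prim_family_gt: "prim_family p X \<Longrightarrow> n < i + j \<Longrightarrow> X i j = 0"
  unfolding prim_family_def by (auto intro: Prim_gt)

lemma prim_family_term_\<Omega>:
  assumes "prim_family p X" shows "(L ^^ i) (X i j) \<in> \<Omega> p"
proof (cases "n + i = p + j \<and> i + j \<le> n")
  case True
  then have eq: "n - (i + j) + 2 * i = p" by arith
  show ?thesis
    using Lk_\<Omega>[OF Prim_\<Omega>[OF prim_family_Prim[OF assms, of i j]], of i] unfolding eq .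
next
  case False
  then have "X i j = 0" using prim_family_deg[OF assms] prim_family_gt[OF assms] by (meson not_le)
  then show ?thesis by (simp add: Lk_simps zero_\<Omega>)
qed

lemma assemble_\<Omega>: "prim_family p X \<Longrightarrow> assemble X \<in> \<Omega> p"
  unfolding assemble_def by (intro sum_\<Omega> prim_family_term_\<Omega>)

lemma assemble_add: "assemble (\<lambda>i j. X i j + Y i j) = assemble X + assemble Y"
  by (simp add: assemble_def Lk_simps sum.distrib)

lemma prim_family_add:
  "prim_family p X \<Longrightarrow> prim_family p Y \<Longrightarrow> prim_family p (\<lambda>i j. X i j + Y i j)"
  by (auto simp: prim_family_def Prim_add)

lemma double_sum_single:
  fixes f :: "nat \<Rightarrow> nat \<Rightarrow> 'b"
  assumes "a \<le> n" "b \<le> n" "\<And>i j. i \<noteq> a \<or> j \<noteq> b \<Longrightarrow> f i j = 0"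
  shows "(\<Sum>i\<le>n. \<Sum>j\<le>n. f i j) = f a b"
proof -
  have "(\<Sum>j\<le>n. f a j) = (\<Sum>j\<le>n. if j = b then f a b else 0)"
    using assms(3) by (intro sum.cong) auto
  then have a: "(\<Sum>j\<le>n. f a j) = f a b" using assms(2) by simp
  have "(\<Sum>i\<le>n. \<Sum>j\<le>n. f i j) = (\<Sum>i\<le>n. if i = a then f a b else 0)"
    using a assms(3) by (intro sum.cong[OF refl]) auto
  then show ?thesis using assms(1) by simp
qed

text \<open>Let \<open>(a, b)\<close> be the index of a nonzero term with the largest power of
  \<open>L\<close>. Then \<open>L\<^sup>b\<close> kills all other terms, and it sends this one to
  \<open>L\<^bsup>a+b\<^esup>(X a b)\<close>, which cannot vanish.\<close>

lemma assemble_unique: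
  assumes X: "prim_family p X" and 0: "assemble X = 0"
  shows "X i j = 0"
proof (rule ccontr)
  assume "X i j \<noteq> 0"
  define I where "I = {i. \<exists>j. X i j \<noteq> 0}"
  have bound: "i \<le> n \<and> j \<le> n" if "X i j \<noteq> 0" for i j
    using prim_family_gt[OF X, of i j] that by (meson add_leD1 add_leD2 not_le)
  have "finite I" using bound by (intro finite_subset[of I "{..n}"]) (auto simp: I_def)
  moreover have "I \<noteq> {}" using \<open>X i j \<noteq> 0\<close> by (auto simp: I_def)
  ultimately have M: "Max I \<in> I" "\<And>i. i \<in> I \<Longrightarrow> i \<le> Max I" by auto
  define a where "a = Max I"
  obtain b where ab: "X a b \<noteq> 0" using M(1) by (auto simp: I_def a_def)
  have deg: "n + a = p + b" using prim_family_deg[OF X] ab by blast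
  have vanish: "(L ^^ (b + i)) (X i j) = 0" if ne: "i \<noteq> a \<or> j \<noteq> b" for i j
  proof (cases "X i j = 0")
    case True then show ?thesis by (simp add: Lk_simps)
  next
    case False
    then have "i \<in> I" by (auto simp: I_def)
    then have "i \<le> a" using M(2) by (simp add: a_def)
    moreover have "n + i = p + j" using False prim_family_deg[OF X] by blast
    ultimately have "j < b" using deg ne by linarith
    then show ?thesis by (intro Prim_kill[OF prim_family_Prim[OF X]]) simp
  qed
  have "(L ^^ b) (assemble X) = (\<Sum>i\<le>n. \<Sum>j\<le>n. (L ^^ (b + i)) (X i j))"
    by (simp add: assemble_def Lk_simps Lk_Lk)
  also have "\<dots> = (L ^^ (b + a)) (X a b)"
    using bound[OF ab] vanish by (intro double_sum_single) auto
  finally have "(L ^^ (a + b)) (X a b) = 0" by (simp add: 0 Lk_simps add.commute)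
  then show False using Prim_inj[OF prim_family_Prim[OF X]] ab by blast
qed

lemma sum_shift_up:
  fixes h :: "nat \<Rightarrow> 'b"
  assumes "h n = 0"
  shows "(\<Sum>i\<le>n. h i) = (\<Sum>i\<le>n. case i of 0 \<Rightarrow> 0 | Suc i' \<Rightarrow> h i')"
proof (cases n)
  case 0 then show ?thesis using assms by simp
next
  case (Suc m)
  show ?thesis unfolding Suc
    by (subst (2) sum.atMost_Suc_shift) (use assms Suc in simp)
qed

lemma sum_shift_down:
  fixes h :: "nat \<Rightarrow> 'b"
  assumes "h 0 = 0" "h (Suc n) = 0"
  shows "(\<Sum>j\<le>n. h j) = (\<Sum>j\<le>n. h (Suc j))"
  using sum.atMost_Suc_shift[of h n] assms by simp

text \<open>A term \<open>L\<^sup>i(Lb)\<close> moves to the row \<open>i + 1\<close>, while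
  \<open>L\<^sup>i a\<close> stays in its row but moves to the column that its degree prescribes.
  The terms that leave the range vanish.\<close>

lemma assemble_shift:
  fixes A B :: "nat \<Rightarrow> nat \<Rightarrow> 'b"
  assumes A: "\<And>i. (L ^^ i) (A i 0) = 0" "\<And>i. A i (Suc n) = 0" and B: "\<And>j. B n j = 0"
  shows "(\<Sum>i\<le>n. \<Sum>j\<le>n. (L ^^ i) (A i j + L (B i j)))
    = assemble (\<lambda>i j. A i (Suc j) + (case i of 0 \<Rightarrow> 0 | Suc i' \<Rightarrow> B i' j))"
proof -
  have "(\<Sum>i\<le>n. \<Sum>j\<le>n. (L ^^ i) (A i j + L (B i j)))
      = (\<Sum>i\<le>n. \<Sum>j\<le>n. (L ^^ i) (A i j)) + (\<Sum>i\<le>n. \<Sum>j\<le>n. (L ^^ Suc i) (B i j))"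
    by (simp add: Lk_simps sum.distrib funpow_swap1)
  also have "(\<Sum>i\<le>n. \<Sum>j\<le>n. (L ^^ i) (A i j)) = (\<Sum>i\<le>n. \<Sum>j\<le>n. (L ^^ i) (A i (Suc j)))"
    using A by (intro sum.cong[OF refl] sum_shift_down) (auto simp: Lk_simps)
  also have "(\<Sum>i\<le>n. \<Sum>j\<le>n. (L ^^ Suc i) (B i j))
      = (\<Sum>i\<le>n. case i of 0 \<Rightarrow> 0 | Suc i' \<Rightarrow> \<Sum>j\<le>n. (L ^^ Suc i') (B i' j))"
    using B by (intro sum_shift_up) (simp add: Lk_simps linear_0[OF linear_L])
  also have "\<dots> = (\<Sum>i\<le>n. \<Sum>j\<le>n. (L ^^ i) (case i of 0 \<Rightarrow> 0 | Suc i' \<Rightarrow> B i' j))"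
    by (intro sum.cong refl) (auto simp: Lk_simps split: nat.split)
  finally show ?thesis by (simp add: assemble_def Lk_simps sum.distrib)
qed

lemma L_assemble:
  assumes "prim_family p X"
  shows "L (assemble X) = assemble (\<lambda>i j. case i of 0 \<Rightarrow> 0 | Suc i' \<Rightarrow> X i' (Suc j))"
proof -
  have "L (assemble X) = (\<Sum>i\<le>n. \<Sum>j\<le>n. (L ^^ Suc i) (X i j))"
    by (simp add: assemble_def linear_sum[OF linear_L])
  also have "\<dots> = (\<Sum>i\<le>n. \<Sum>j\<le>n. (L ^^ Suc i) (X i (Suc j)))"
  proof (rule sum.cong[OF refl], rule sum_shift_down)
    fix i
    show "(L ^^ Suc i) (X i 0) = 0" using prim_family_Prim[OF assms, of i 0] by (intro Prim_kill[of _ i]) auto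
    show "(L ^^ Suc i) (X i (Suc n)) = 0"
      using prim_family_gt[OF assms, of i "Suc n"] Lk_simps(4)[of "Suc i"] by simp
  qed
  also have "\<dots> = (\<Sum>i\<le>n. \<Sum>j\<le>n. (L ^^ i) (0 + L (X i (Suc j))))"
    by (simp add: funpow_swap1)
  also have "\<dots> = assemble (\<lambda>i j. 0 + (case i of 0 \<Rightarrow> 0 | Suc i' \<Rightarrow> X i' (Suc j)))"
    using prim_family_gt[OF assms] by (intro assemble_shift) (auto simp: Lk_simps)
  finally show ?thesis by simp
qed

lemma prim_family_L:
  assumes "prim_family p X"
  shows "prim_family (p + 2) (\<lambda>i j. case i of 0 \<Rightarrow> 0 | Suc i' \<Rightarrow> X i' (Suc j))"
  unfolding prim_family_def
proof (intro conjI allI impI)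
  fix i j
  show "(case i of 0 \<Rightarrow> 0 | Suc i' \<Rightarrow> X i' (Suc j)) \<in> Prim (i + j)"
    using prim_family_Prim[OF assms, of _ "Suc j"] Prim_zero by (auto split: nat.split)
  assume "n + i \<noteq> p + 2 + j"
  then show "(case i of 0 \<Rightarrow> 0 | Suc i' \<Rightarrow> X i' (Suc j)) = 0"
    using prim_family_deg[OF assms] by (auto split: nat.split)
qed

text \<open>The sums of powers of \<open>L\<close> applied to primitive elements of
  \<open>C\<close>; for \<open>C\<close> the closed elements, these turn out to be the harmonic
  elements.\<close>

definition assembled :: "'b set \<Rightarrow> nat \<Rightarrow> 'b set" where
  "assembled C p = {assemble X |X. prim_family p X \<and> (\<forall>i j. X i j \<in> C)}"

lemma assembled_add:
  assumes "x \<in> assembled C p" "y \<in> assembled C p"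
    and C: "\<And>k x y. x \<in> Prim k \<Longrightarrow> y \<in> Prim k \<Longrightarrow> x \<in> C \<Longrightarrow> y \<in> C \<Longrightarrow> x + y \<in> C"
  shows "x + y \<in> assembled C p"
proof -
  obtain X Y where X: "x = assemble X" "prim_family p X" "\<forall>i j. X i j \<in> C"
    and Y: "y = assemble Y" "prim_family p Y" "\<forall>i j. Y i j \<in> C" using assms(1,2) by (auto simp: assembled_def)
  have "\<forall>i j. X i j + Y i j \<in> C"
    using C prim_family_Prim[OF X(2)] prim_family_Prim[OF Y(2)] X(3) Y(3) by blast
  then show ?thesis
    unfolding assembled_def using X Y prim_family_add[OF X(2) Y(2)]
    by (intro CollectI exI[of _ "\<lambda>i j. X i j + Y i j"]) (simp add: assemble_add)
qed

lemma assembled_L: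
  assumes "x \<in> assembled C p" "0 \<in> C" shows "L x \<in> assembled C (p + 2)"
proof -
  obtain X where X: "x = assemble X" "prim_family p X" "\<forall>i j. X i j \<in> C" using assms(1) by (auto simp: assembled_def)
  show ?thesis
    unfolding assembled_def using X L_assemble[OF X(2)] prim_family_L[OF X(2)] assms(2)
    by (intro CollectI exI[of _ "\<lambda>i j. case i of 0 \<Rightarrow> 0 | Suc i' \<Rightarrow> X i' (Suc j)"])
      (auto split: nat.split)
qed

lemma assembled_Lk: "x \<in> assembled C p \<Longrightarrow> 0 \<in> C \<Longrightarrow> (L ^^ k) x \<in> assembled C (p + 2 * k)"
proof (induction k)
  case (Suc k) then show ?case using assembled_L[of "(L ^^ k) x" C "p + 2 * k"] by (simp add: add_ac)
qed simp

lemma assembled_zero: assumes "0 \<in> C" shows "0 \<in> assembled C p"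
  unfolding assembled_def using assms
  by (intro CollectI exI[of _ "\<lambda>i j. 0"]) (simp add: assemble_def Lk_simps prim_family_def Prim_zero)

lemma assembled_Prim:
  assumes "x \<in> Prim k" "k \<le> n" "x \<in> C" "0 \<in> C"
  shows "x \<in> assembled C (n - k)"
proof -
  let ?X = "\<lambda>i j. if i = 0 \<and> j = k then x else 0"
  define f where "f = (\<lambda>i j. (L ^^ i) (?X i j))"
  have "(\<Sum>i\<le>n. \<Sum>j\<le>n. f i j) = f 0 k"
    using assms(2) by (intro double_sum_single) (auto simp: f_def Lk_simps)
  then have "assemble ?X = (L ^^ 0) (?X 0 k)" by (simp add: assemble_def f_def)
  moreover have "prim_family (n - k) ?X"
    using assms(1,2) by (auto simp: prim_family_def Prim_zero)
  ultimately show ?thesis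
    unfolding assembled_def using assms(3,4) by (intro CollectI exI[of _ ?X]) auto
qed

text \<open>As \<open>L\<^bsup>k+1\<^esup>x = L\<^bsup>k+2\<^esup>y\<close> for some
  \<open>y\<close>, the difference \<open>x - Ly\<close> is primitive, and \<open>y\<close> has
  smaller degree.\<close>

lemma lefschetz_low:
  assumes "p \<le> n" "x \<in> \<Omega> p" shows "x \<in> assembled UNIV p"
  using assms
proof (induction p arbitrary: x rule: less_induct)
  case (less p)
  define k where "k = n - p"
  have k: "p = n - k" "k \<le> n" using less.prems by (auto simp: k_def)
  have Lx: "(L ^^ Suc k) x \<in> \<Omega> (n + (k + 2))"
    using Lk_\<Omega>[OF less.prems(2), of "Suc k"] k by (simp add: algebra_simps)
  show ?case
  proof (cases "k + 2 \<le> n")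
    case False
    then have "(L ^^ Suc k) x = 0" using \<Omega>_gt[OF Lx] by simp
    then have "x \<in> Prim k" using less.prems k by (simp add: Prim_def)
    then show ?thesis unfolding k(1) using k(2) by (intro assembled_Prim) auto
  next
    case True
    from L_surj[OF Lx True] obtain y where y: "y \<in> \<Omega> (n - (k + 2))" "(L ^^ (k + 2)) y = (L ^^ Suc k) x"
      by blast
    have p2: "n - (k + 2) + 2 = p" "n - (k + 2) < p" "n - (k + 2) \<le> n" using True k by auto
    have Ly: "L y \<in> \<Omega> p" using L_\<Omega>[OF y(1)] p2 by simp
    have "(L ^^ Suc k) (x - L y) = 0"
      unfolding Lk_simps using y(2) by (simp add: funpow_swap1)
    then have "x - L y \<in> Prim k"
      using diff_\<Omega>[OF less.prems(2) Ly] k by (simp add: Prim_def)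
    then have "x - L y \<in> assembled UNIV p" unfolding k(1) using k(2) by (intro assembled_Prim) auto
    moreover have "L y \<in> assembled UNIV p"
      using assembled_L[OF less.IH[OF p2(2,3) y(1)]] p2(1) by simp
    ultimately have "(x - L y) + L y \<in> assembled UNIV p" by (rule assembled_add) auto
    then show ?thesis by simp
  qed
qed

lemma lefschetz_decomposition:
  assumes "x \<in> \<Omega> p" shows "x \<in> assembled UNIV p"
proof (cases "p \<le> n")
  case True then show ?thesis using assms by (rule lefschetz_low)
next
  case False
  define k where "k = p - n"
  have p: "p = n + k" using False by (simp add: k_def)
  show ?thesis
  proof (cases "k \<le> n")
    case True
    obtain y where y: "y \<in> \<Omega> (n - k)" "(L ^^ k) y = x" using L_surj[of x k] assms p True by auto
    have "n - k + 2 * k = p" using True p by simp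
    then show ?thesis using assembled_Lk[OF lefschetz_low[OF _ y(1)], of k] y(2) by simp
  next
    case False
    then have "x = 0" using assms \<Omega>_gt p by simp
    then show ?thesis by (simp add: assembled_zero)
  qed
qed

subsection \<open>Harmonic elements have closed primitive components\<close>

text \<open>The factor in \<open>\<star>L\<^sup>i x = c\<^sub>i\<^sub>j L\<^sup>j x\<close> for
  \<open>x\<close> primitive of degree \<open>n - (i + j)\<close>.\<close>

definition star_coeff :: "nat \<Rightarrow> nat \<Rightarrow> real" where
  "star_coeff i j = star_sign (n - (i + j)) * fact n * fact i / fact j"

lemma star_sign_nonzero: "star_sign p \<noteq> 0"
  by (induction p) auto

lemma star_sign_Suc_Suc: "star_sign (Suc (Suc p)) = - star_sign p"
  by (simp add: power_mult_distrib[symmetric] mult.assoc[symmetric])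

lemma star_coeff_nonzero: "star_coeff i j \<noteq> 0"
  by (simp add: star_coeff_def star_sign_nonzero)

text \<open>The degrees of the primitive elements differ by 2, so the signs are opposite.\<close>

lemma star_coeff_differs:
  assumes "i + j + 2 \<le> n" shows "star_coeff (Suc i) (Suc j) \<noteq> star_coeff i j"
proof -
  define m where "m = n - (i + j + 2)"
  have m: "n - (Suc i + Suc j) = m" "n - (i + j) = Suc (Suc m)" using assms by (auto simp: m_def)
  have "star_coeff (Suc i) (Suc j) - star_coeff i j
      = star_sign m * (fact n * fact (Suc i) / fact (Suc j) + fact n * fact i / fact j)"
    unfolding star_coeff_def m star_sign_Suc_Suc by (simp add: algebra_simps del: fact_Suc)
  moreover have "fact n * fact (Suc i) / fact (Suc j) + fact n * fact i / fact j > (0::real)"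
    by (intro add_pos_pos divide_pos_pos mult_pos_pos) (simp_all del: fact_Suc)
  ultimately show ?thesis using star_sign_nonzero[of m] by auto
qed

lemma prim_family_star:
  assumes "prim_family p X" "p + q = 2 * n"
  shows "prim_family q (\<lambda>i j. star_coeff j i *\<^sub>R X j i)"
  unfolding prim_family_def
proof (intro conjI allI impI)
  fix i j
  show "star_coeff j i *\<^sub>R X j i \<in> Prim (i + j)"
    using Prim_scale[OF prim_family_Prim[OF assms(1), of j i]] by (simp only: add.commute)
  assume "n + i \<noteq> q + j"
  then have "X j i = 0" using assms(2) by (intro prim_family_deg[OF assms(1)]) arith
  then show "star_coeff j i *\<^sub>R X j i = 0" by simp
qed

lemma s_assemble:
  assumes X: "prim_family p X"
  shows "s (assemble X) = assemble (\<lambda>i j. star_coeff j i *\<^sub>R X j i)"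
proof -
  have "s ((L ^^ i) (X i j)) = star_coeff i j *\<^sub>R (L ^^ j) (X i j)" for i j
  proof (cases "i + j \<le> n")
    case True
    then show ?thesis
      unfolding star_coeff_def using prim_family_Prim[OF X, of i j] Prim_kill[of "X i j" "i + j" "Suc (i + j)"]
      by (intro s_primitive) (auto dest: Prim_\<Omega>)
  next
    case False
    then have "X i j = 0" using prim_family_gt[OF X] by simp
    then show ?thesis by (simp add: Lk_simps s_0)
  qed
  then have "s (assemble X) = (\<Sum>i\<le>n. \<Sum>j\<le>n. star_coeff i j *\<^sub>R (L ^^ j) (X i j))"
    unfolding assemble_def using prim_family_term_\<Omega>[OF X] by (simp add: s_sum[of _ _ p] sum_\<Omega>)
  also have "\<dots> = assemble (\<lambda>i j. star_coeff j i *\<^sub>R X j i)"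
    unfolding assemble_def by (subst sum.swap) (simp add: Lk_simps)
  finally show ?thesis .
qed

lemma s_\<Omega>:
  assumes "x \<in> \<Omega> p" "p + q = 2 * n" shows "s x \<in> \<Omega> q"
proof -
  obtain X where X: "x = assemble X" "prim_family p X"
    using lefschetz_decomposition[OF assms(1)] by (auto simp: assembled_def)
  show ?thesis unfolding X(1) s_assemble[OF X(2)] by (rule assemble_\<Omega>[OF prim_family_star[OF X(2) assms(2)]])
qed

lemma d_assemble:
  assumes X: "prim_family p X"
  assumes dX: "\<And>i j. d (X i j) = A i j + L (B i j)"
    and A: "\<And>i j. A i j \<in> Prim (i + j - 1)" "A 0 0 = 0"
    and B: "\<And>i j. B i j \<in> Prim (Suc (i + j))"
    and AB0: "\<And>i j. X i j = 0 \<Longrightarrow> A i j = 0 \<and> B i j = 0"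
  defines "F \<equiv> \<lambda>i j. A i (Suc j) + (case i of 0 \<Rightarrow> 0 | Suc i' \<Rightarrow> B i' j)"
  shows "d (assemble X) = assemble F" "prim_family (Suc p) F"
proof -
  have "d (assemble X) = (\<Sum>i\<le>n. \<Sum>j\<le>n. d ((L ^^ i) (X i j)))"
    unfolding assemble_def using prim_family_term_\<Omega>[OF X] by (simp add: d_sum[of _ _ p] sum_\<Omega>)
  also have "\<dots> = (\<Sum>i\<le>n. \<Sum>j\<le>n. (L ^^ i) (A i j + L (B i j)))"
    by (simp only: d_Lk[OF Prim_\<Omega>[OF prim_family_Prim[OF X]]] dX)
  also have "\<dots> = assemble F" unfolding F_def
  proof (rule assemble_shift)
    show "(L ^^ i) (A i 0) = 0" for i
      using Prim_kill[OF A(1)[of i 0], of i] A(2) by (cases i) simp_all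
    show "A i (Suc n) = 0" for i
      using AB0 prim_family_gt[OF X, of i "Suc n"] by simp
    show "B n j = 0" for j
      using B[of n j] by (auto intro: Prim_gt)
  qed
  finally show "d (assemble X) = assemble F" .
  show "prim_family (Suc p) F"
    unfolding prim_family_def F_def
  proof (intro conjI allI impI)
    fix i j
    show "A i (Suc j) + (case i of 0 \<Rightarrow> 0 | Suc i' \<Rightarrow> B i' j) \<in> Prim (i + j)"
      using A(1)[of i "Suc j"] B[of _ j] by (intro Prim_add) (auto simp: Prim_zero split: nat.split)
    assume "n + i \<noteq> Suc p + j"
    then show "A i (Suc j) + (case i of 0 \<Rightarrow> 0 | Suc i' \<Rightarrow> B i' j) = 0"
      using AB0 prim_family_deg[OF X] by (auto split: nat.split)
  qed
qed

text \<open>Write \<open>d(X i j) = A i j + L(B i j)\<close>. The decomposition of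
  \<open>dx\<close> is \<open>F\<close>, and that of \<open>d(sx)\<close> is \<open>F'\<close>; as
  both elements vanish (the second after the injective map \<open>s\<close>), uniqueness gives the
  equations \<open>E1\<close> and \<open>E2\<close> for the same pairs of \<open>A\<close> and
  \<open>B\<close>, but with different coefficients.\<close>

theorem harmonic_imp_closed_primitive:
  assumes x: "x \<in> \<Omega> p" "p \<le> 2 * n" and dx: "d x = 0" and \<delta>x: "s (d (s x)) = 0"
  shows "x \<in> assembled {x. d x = 0} p"
proof -
  obtain X where X: "x = assemble X" "prim_family p X"
    using lefschetz_decomposition[OF x(1)] by (auto simp: assembled_def)
  have "\<exists>a b. d (X i j) = a + L b \<and> b \<in> Prim (Suc (i + j)) \<and> a \<in> Prim (i + j - 1) \<and>
      (i + j = 0 \<longrightarrow> a = 0) \<and> (X i j = 0 \<longrightarrow> a = 0 \<and> b = 0)" for i j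
    by (rule d_Prim[OF prim_family_Prim[OF X(2), of i j]]) blast
  then obtain A B where dX: "\<And>i j. d (X i j) = A i j + L (B i j)"
    and B: "\<And>i j. B i j \<in> Prim (Suc (i + j))" and A: "\<And>i j. A i j \<in> Prim (i + j - 1)"
    and A0: "\<And>i j. i + j = 0 \<longrightarrow> A i j = 0"
    and AB0: "\<And>i j. X i j = 0 \<longrightarrow> A i j = 0 \<and> B i j = 0"
    by metis
  have A00: "A 0 0 = 0" using A0 by simp
  define q where "q = 2 * n - p"
  have pq: "p + q = 2 * n" "Suc q + (p - 1) = 2 * n \<or> p = 0" using x(2) by (auto simp: q_def)
  define F where "F = (\<lambda>i j. A i (Suc j) + (case i of 0 \<Rightarrow> 0 | Suc i' \<Rightarrow> B i' j))"
  define X' where "X' = (\<lambda>i j. star_coeff j i *\<^sub>R X j i)"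
  define F' where "F' = (\<lambda>i j. star_coeff (Suc j) i *\<^sub>R A (Suc j) i + (case i of 0 \<Rightarrow> 0 | Suc i' \<Rightarrow> star_coeff j i' *\<^sub>R B j i'))"
  have 1: "d (assemble X) = assemble F" "prim_family (Suc p) F"
    unfolding F_def using d_assemble[OF X(2) dX A A00 B] AB0 by blast+
  then have E1: "F i j = 0" for i j
    using assemble_unique[OF 1(2)] dx X(1) by simp
  have X': "prim_family q X'" "s x = assemble X'"
    unfolding X'_def X(1) using prim_family_star[OF X(2) pq(1)] s_assemble[OF X(2)] by auto
  have 2: "d (assemble X') = assemble F' \<and> prim_family (Suc q) F'"
  proof -
    have d': "d (X' i j) = star_coeff j i *\<^sub>R A j i + L (star_coeff j i *\<^sub>R B j i)" for i j
      unfolding X'_def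
      using d_scale[OF Prim_\<Omega>[OF prim_family_Prim[OF X(2)]]] dX
      by (simp add: linear_scale[OF linear_L] scaleR_add_right)
    have "d (assemble X') = assemble (\<lambda>i j. star_coeff (Suc j) i *\<^sub>R A (Suc j) i + (case i of 0 \<Rightarrow> 0 | Suc i' \<Rightarrow> star_coeff j i' *\<^sub>R B j i')) \<and>
       prim_family (Suc q) (\<lambda>i j. star_coeff (Suc j) i *\<^sub>R A (Suc j) i + (case i of 0 \<Rightarrow> 0 | Suc i' \<Rightarrow> star_coeff j i' *\<^sub>R B j i'))"
    proof (intro conjI)
      have a: "star_coeff j i *\<^sub>R A j i \<in> Prim (i + j - 1)" for i j
        using A[of j i] by (simp add: Prim_scale add.commute)
      have a0: "star_coeff 0 0 *\<^sub>R A 0 0 = 0" using A00 by simp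
      have b: "star_coeff j i *\<^sub>R B j i \<in> Prim (Suc (i + j))" for i j
        using B[of j i] by (simp add: Prim_scale add.commute)
      have ab: "X' i j = 0 \<Longrightarrow> star_coeff j i *\<^sub>R A j i = 0 \<and> star_coeff j i *\<^sub>R B j i = 0" for i j
        using AB0 star_coeff_nonzero by (simp add: X'_def)
      show "d (assemble X') = assemble (\<lambda>i j. star_coeff (Suc j) i *\<^sub>R A (Suc j) i + (case i of 0 \<Rightarrow> 0 | Suc i' \<Rightarrow> star_coeff j i' *\<^sub>R B j i'))"
        by (rule d_assemble(1)[OF X'(1) d' a a0 b ab])
      show "prim_family (Suc q) (\<lambda>i j. star_coeff (Suc j) i *\<^sub>R A (Suc j) i + (case i of 0 \<Rightarrow> 0 | Suc i' \<Rightarrow> star_coeff j i' *\<^sub>R B j i'))"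
        by (rule d_assemble(2)[OF X'(1) d' a a0 b ab])
    qed
    then show ?thesis unfolding F'_def .
  qed
  have E2: "F' i j = 0" for i j
  proof (cases "p = 0")
    case True
    then show ?thesis
      using 2 assemble_\<Omega>[of "Suc q" F'] assemble_unique[of "Suc q" F'] \<Omega>_gt[of "assemble F'" "Suc q"] by (simp add: q_def)
  next
    case False
    then have q: "Suc q + (p - 1) = 2 * n" using pq by simp
    have "assemble (\<lambda>i j. star_coeff j i *\<^sub>R F' j i) = 0"
      using s_assemble[of "Suc q" F'] 2 \<delta>x X'(2) by simp
    from assemble_unique[OF prim_family_star[OF conjunct2[OF 2] q] this, where i=j and j=i]
    have "star_coeff i j *\<^sub>R F' i j = 0" .
    then show ?thesis using star_coeff_nonzero by simp
  qed
  have AB: "A (Suc i) (Suc j) = 0 \<and> B i j = 0" for i j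
  proof -
    have e1: "A (Suc i) (Suc j) = - B i j" using E1[of "Suc i" j] by (simp add: F_def eq_neg_iff_add_eq_0)
    have e2: "star_coeff (Suc i) (Suc j) *\<^sub>R A (Suc i) (Suc j) + star_coeff i j *\<^sub>R B i j = 0"
      using E2[of "Suc j" i] by (simp add: F'_def)
    show ?thesis
    proof (cases "i + j + 2 \<le> n")
      case True
      have "(star_coeff i j - star_coeff (Suc i) (Suc j)) *\<^sub>R B i j = 0"
        using e2 unfolding e1 scaleR_minus_right uminus_add_conv_diff scaleR_diff_left .
      then show ?thesis using star_coeff_differs[OF True] e1 by simp
    next
      case False
      then have "X (Suc i) (Suc j) = 0" using prim_family_gt[OF X(2)] by simp
      then show ?thesis using AB0 e1 by simp
    qed
  qed
  have "A 0 (Suc j) = 0" for j using E1[of 0 j] by (simp add: F_def)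
  moreover have "A (Suc i) 0 = 0" for i using E2[of 0 i] star_coeff_nonzero by (simp add: F'_def)
  ultimately have "A i j = 0" for i j using A00 AB by (cases i; cases j) auto
  then have "d (X i j) = 0" for i j using dX AB by (simp add: linear_0[OF linear_L])
  then show ?thesis unfolding assembled_def using X by blast
qed

lemma closed_primitive_imp_harmonic:
  assumes "x \<in> assembled {x. d x = 0} p" "p \<le> 2 * n"
  shows "x \<in> \<Omega> p" "d x = 0" "s (d (s x)) = 0"
proof -
  obtain X where X: "x = assemble X" "prim_family p X" "\<And>i j. d (X i j) = 0"
    using assms by (auto simp: assembled_def)
  have closed: "d (assemble Y) = 0" if Y: "prim_family q Y" "\<And>i j. d (Y i j) = 0" for q Y
  proof -
    have "d (assemble Y) = (\<Sum>i\<le>n. \<Sum>j\<le>n. d ((L ^^ i) (Y i j)))"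
      unfolding assemble_def using prim_family_term_\<Omega>[OF Y(1)] by (simp add: d_sum[of _ _ q] sum_\<Omega>)
    then show ?thesis
      by (simp add: d_Lk[OF Prim_\<Omega>[OF prim_family_Prim[OF Y(1)]]] Y(2) Lk_simps)
  qed
  show "x \<in> \<Omega> p" "d x = 0" using X assemble_\<Omega> closed by auto
  have "d (star_coeff j i *\<^sub>R X j i) = 0" for i j
    using d_scale[OF Prim_\<Omega>[OF prim_family_Prim[OF X(2)]]] X(3) by simp
  then have "d (s x) = 0"
    unfolding X(1) s_assemble[OF X(2)] using assms(2)
    by (intro closed[of "2 * n - p"] prim_family_star[OF X(2)]) auto
  then show "s (d (s x)) = 0" by (simp add: s_0)
qed

subsection \<open>The equivalence\<close>

definition Z :: "nat \<Rightarrow> 'b set" where "Z p = {x \<in> \<Omega> p. d x = 0}"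

text \<open>There are no elements of negative degree, so only 0 is exact in degree 0.\<close>

definition Bd :: "nat \<Rightarrow> 'b set" where "Bd p = (case p of 0 \<Rightarrow> {0} | Suc q \<Rightarrow> d ` \<Omega> q)"

lemma Bd_zero: "0 \<in> Bd p"
  using imageI[OF zero_\<Omega>, of d] by (cases p) (simp_all add: Bd_def d_0)

lemma Bd_add:
  assumes "x \<in> Bd p" "y \<in> Bd p" shows "x + y \<in> Bd p"
proof (cases p)
  case 0 then show ?thesis using assms by (simp add: Bd_def)
next
  case (Suc q)
  then obtain u v where "u \<in> \<Omega> q" "x = d u" "v \<in> \<Omega> q" "y = d v" using assms by (auto simp: Bd_def)
  then have "x + y = d (u + v)" "u + v \<in> \<Omega> q" using d_add add_\<Omega> by auto
  then show ?thesis using Suc by (simp add: Bd_def)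
qed

lemma Bd_L:
  assumes "x \<in> Bd p" shows "L x \<in> Bd (p + 2)"
proof (cases p)
  case 0 then show ?thesis using assms Bd_zero[of 2] by (simp add: Bd_def linear_0[OF linear_L])
next
  case (Suc q)
  then obtain y where "y \<in> \<Omega> q" "x = d y" using assms by (auto simp: Bd_def)
  then have "L x = d (L y)" "L y \<in> \<Omega> (q + 2)" using d_L L_\<Omega> by auto
  then show ?thesis using Suc by (simp add: Bd_def)
qed

lemma Bd_Lk: "x \<in> Bd p \<Longrightarrow> (L ^^ k) x \<in> Bd (p + 2 * k)"
proof (induction k)
  case (Suc k) then show ?case using Bd_L[of "(L ^^ k) x" "p + 2 * k"] by (simp add: add_ac)
qed simp

text \<open>Surjectivity in cohomology makes a closed element primitive up to \<open>L\<close> of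
  an element of smaller degree and an exact correction.\<close>

lemma closed_primitive_representative_low:
  assumes lef: "\<And>k z. k \<le> n \<Longrightarrow> z \<in> Z (n + k) \<Longrightarrow> \<exists>w\<in>Z (n - k). z - (L ^^ k) w \<in> Bd (n + k)"
  assumes "p \<le> n" "z \<in> Z p"
  shows "\<exists>x\<in>assembled {x. d x = 0} p. z - x \<in> Bd p"
  using assms(2,3)
proof (induction p arbitrary: z rule: less_induct)
  case (less p)
  note z = less.prems(2)[unfolded Z_def, simplified]
  define k where "k = n - p"
  have k: "p = n - k" "k \<le> n" using less.prems by (auto simp: k_def)
  have Lz: "(L ^^ Suc k) z \<in> \<Omega> (n + (k + 2))"
    using Lk_\<Omega>[of z p "Suc k"] z k by (simp add: algebra_simps)
  show ?case
  proof (cases "k + 2 \<le> n")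
    case False
    then have "(L ^^ Suc k) z = 0" using \<Omega>_gt[OF Lz] by simp
    then have "z \<in> Prim k" using z k by (simp add: Prim_def)
    then have "z \<in> assembled {x. d x = 0} p"
      unfolding k(1) using k(2) z d_0 by (intro assembled_Prim) auto
    then show ?thesis by (intro bexI[of _ z]) (simp_all add: Bd_zero)
  next
    case True
    have "d ((L ^^ Suc k) z) = 0"
      using z d_Lk[of z p "Suc k"] by (simp only: Lk_simps)
    with Lz lef[OF True, of "(L ^^ Suc k) z"] obtain w where
      w: "w \<in> \<Omega> (n - (k + 2))" "d w = 0" and wB: "(L ^^ Suc k) z - (L ^^ (k + 2)) w \<in> Bd (n + (k + 2))"
      by (auto simp: Z_def)
    obtain \<beta> where \<beta>: "\<beta> \<in> \<Omega> (n + Suc k)" "(L ^^ Suc k) z - (L ^^ (k + 2)) w = d \<beta>"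
      using wB by (auto simp: Bd_def)
    obtain \<alpha> where \<alpha>: "\<alpha> \<in> \<Omega> (n - Suc k)" "(L ^^ Suc k) \<alpha> = \<beta>"
      using L_surj[OF \<beta>(1)] True by auto
    have p2: "n - (k + 2) + 2 = p" "n - (k + 2) < p" "n - (k + 2) \<le> n" "Suc (n - Suc k) = p"
      using True k by auto
    \<comment> \<open>closed, cohomologous to \<open>z - L w\<close>, and primitive because
      \<open>L\<^bsup>k+1\<^esup>\<close> maps it to \<open>d\<beta> - d\<beta>\<close>\<close>
    define z' where "z' = z - L w - d \<alpha>"
    have Lw: "L w \<in> \<Omega> p" "d (L w) = 0"
      using L_\<Omega>[OF w(1)] p2 d_L[OF w(1)] w(2) by (simp_all add: linear_0[OF linear_L])
    have d\<alpha>: "d \<alpha> \<in> \<Omega> p" "d (d \<alpha>) = 0" using d_\<Omega>[OF \<alpha>(1)] p2 d_d[OF \<alpha>(1)] by simp_all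
    have z': "z' \<in> \<Omega> p" "d z' = 0"
      unfolding z'_def using z Lw d\<alpha> by (simp_all add: diff_\<Omega> d_diff[of _ p])
    have "(L ^^ Suc k) z' = (L ^^ Suc k) z - (L ^^ (k + 2)) w - d ((L ^^ Suc k) \<alpha>)"
      unfolding z'_def Lk_simps d_Lk[OF \<alpha>(1)] by (simp add: funpow_swap1)
    also have "\<dots> = 0" unfolding \<alpha>(2) \<beta>(2) by simp
    finally have "z' \<in> Prim k" using z'(1) k by (simp add: Prim_def)
    then have z'd: "z' \<in> assembled {x. d x = 0} p"
      unfolding k(1) using k(2) z'(2) d_0 by (intro assembled_Prim) auto
    from less.IH[OF p2(2,3)] w obtain w' where
      w': "w' \<in> assembled {x. d x = 0} (n - (k + 2))" "w - w' \<in> Bd (n - (k + 2))"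
      by (auto simp: Z_def)
    have "L w' \<in> assembled {x. d x = 0} p" using assembled_L[OF w'(1)] d_0 p2(1) by simp
    then have "z' + L w' \<in> assembled {x. d x = 0} p"
      using z'd by (intro assembled_add) (auto dest!: Prim_\<Omega> simp: d_add)
    moreover have "z - (z' + L w') = d \<alpha> + L (w - w')"
      by (simp add: z'_def linear_diff[OF linear_L])
    moreover have "d \<alpha> + L (w - w') \<in> Bd p"
      using Bd_L[OF w'(2)] p2 \<alpha>(1) by (intro Bd_add) (auto simp: Bd_def split: nat.split)
    ultimately show ?thesis by metis
  qed
qed

theorem harmonic_iff_lefschetz:
  "(\<forall>p. \<forall>z\<in>Z p. \<exists>x\<in>Z p. s (d (s x)) = 0 \<and> z - x \<in> Bd p) \<longleftrightarrow>
   (\<forall>k\<le>n. \<forall>z\<in>Z (n + k). \<exists>w\<in>Z (n - k). z - (L ^^ k) w \<in> Bd (n + k))"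
proof
  assume harm: "\<forall>p. \<forall>z\<in>Z p. \<exists>x\<in>Z p. s (d (s x)) = 0 \<and> z - x \<in> Bd p"
  show "\<forall>k\<le>n. \<forall>z\<in>Z (n + k). \<exists>w\<in>Z (n - k). z - (L ^^ k) w \<in> Bd (n + k)"
  proof (intro allI impI ballI)
    fix k z assume k: "k \<le> n" and "z \<in> Z (n + k)"
    then obtain x where x: "x \<in> Z (n + k)" "s (d (s x)) = 0" "z - x \<in> Bd (n + k)"
      using harm by blast
    then obtain X where X: "x = assemble X" "prim_family (n + k) X" "\<And>i j. d (X i j) = 0"
      using harmonic_imp_closed_primitive[of x "n + k"] k by (auto simp: Z_def assembled_def)
    \<comment> \<open>only indices with \<open>i = k + j\<close> contribute, so the truncated
      difference \<open>i - k\<close> is exact\<close>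
    define w where "w = (\<Sum>i\<le>n. \<Sum>j\<le>n. (L ^^ (i - k)) (X i j))"
    have w\<Omega>: "(L ^^ (i - k)) (X i j) \<in> \<Omega> (n - k)" and Lw: "(L ^^ k) ((L ^^ (i - k)) (X i j)) = (L ^^ i) (X i j)"
      for i j
    proof -
      have "(L ^^ (i - k)) (X i j) \<in> \<Omega> (n - k) \<and> (L ^^ k) ((L ^^ (i - k)) (X i j)) = (L ^^ i) (X i j)"
      proof (cases "X i j = 0")
        case True then show ?thesis by (simp add: Lk_simps zero_\<Omega>)
      next
        case False
        then have ij: "i = k + j" "i + j \<le> n"
          using prim_family_deg[OF X(2), of i j] prim_family_gt[OF X(2), of i j] by (auto simp: not_le[symmetric])
        then have "n - (i + j) + 2 * (i - k) = n - k" by simp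
        then have "(L ^^ (i - k)) (X i j) \<in> \<Omega> (n - k)"
          using Lk_\<Omega>[OF Prim_\<Omega>[OF prim_family_Prim[OF X(2)]], of "i - k" i j] by simp
        then show ?thesis using ij(1) by (simp add: Lk_Lk)
      qed
      then show "(L ^^ (i - k)) (X i j) \<in> \<Omega> (n - k)" "(L ^^ k) ((L ^^ (i - k)) (X i j)) = (L ^^ i) (X i j)"
        by auto
    qed
    have "(L ^^ k) w = x" by (simp add: w_def Lk_simps Lw X(1) assemble_def)
    moreover have "w \<in> \<Omega> (n - k)" unfolding w_def by (intro sum_\<Omega> w\<Omega>)
    moreover have "d w = 0"
      unfolding w_def
      by (simp add: d_sum[of _ _ "n - k"] sum_\<Omega> w\<Omega> d_Lk[OF Prim_\<Omega>[OF prim_family_Prim[OF X(2)]]] X(3) Lk_simps)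
    ultimately show "\<exists>w\<in>Z (n - k). z - (L ^^ k) w \<in> Bd (n + k)"
      using x(3) by (intro bexI[of _ w]) (auto simp: Z_def)
  qed
next
  assume "\<forall>k\<le>n. \<forall>z\<in>Z (n + k). \<exists>w\<in>Z (n - k). z - (L ^^ k) w \<in> Bd (n + k)"
  then have lef: "\<And>k z. k \<le> n \<Longrightarrow> z \<in> Z (n + k) \<Longrightarrow> \<exists>w\<in>Z (n - k). z - (L ^^ k) w \<in> Bd (n + k)"
    by blast
  show "\<forall>p. \<forall>z\<in>Z p. \<exists>x\<in>Z p. s (d (s x)) = 0 \<and> z - x \<in> Bd p"
  proof (intro allI ballI)
    fix p z assume z: "z \<in> Z p"
    show "\<exists>x\<in>Z p. s (d (s x)) = 0 \<and> z - x \<in> Bd p"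
    proof (cases "p \<le> 2 * n")
      case False
      then have "z = 0" using z \<Omega>_gt by (auto simp: Z_def)
      then show ?thesis
        by (intro bexI[of _ 0]) (auto simp: Z_def zero_\<Omega> d_0 s_0 Bd_zero)
    next
      case True
      have "\<exists>x\<in>assembled {x. d x = 0} p. z - x \<in> Bd p"
      proof (cases "p \<le> n")
        case True then show ?thesis using closed_primitive_representative_low[OF lef _ z] by blast
      next
        case False
        define k where "k = p - n"
        have k: "p = n + k" "k \<le> n" "n - k + 2 * k = p" using False True by (auto simp: k_def)
        obtain w where w: "w \<in> Z (n - k)" "z - (L ^^ k) w \<in> Bd p" using lef[OF k(2)] z k(1) by auto
        obtain w' where w': "w' \<in> assembled {x. d x = 0} (n - k)" "w - w' \<in> Bd (n - k)"
          using closed_primitive_representative_low[OF lef _ w(1)] by auto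
        have "(L ^^ k) w' \<in> assembled {x. d x = 0} p"
          using assembled_Lk[OF w'(1), of k] d_0 k(3) by simp
        moreover have "z - (L ^^ k) w' = (z - (L ^^ k) w) + (L ^^ k) (w - w')"
          by (simp add: Lk_simps)
        moreover have "\<dots> \<in> Bd p" using Bd_Lk[OF w'(2), of k] k(3) w(2) by (intro Bd_add) auto
        ultimately show ?thesis by metis
      qed
      then obtain x where "x \<in> assembled {x. d x = 0} p" "z - x \<in> Bd p" by blast
      then show ?thesis using closed_primitive_imp_harmonic[of x p] True by (auto simp: Z_def)
    qed
  qed
qed

end

section \<open>Smooth functions\<close>

abbreviation D where "D f x v \<equiv> frechet_derivative f (at x) v"

lemma D_eqI: "(f has_derivative f') (at x) \<Longrightarrow> D f x v = f' v"
  using frechet_derivative_at by metis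

lemma has_derivative_D: "f differentiable at x \<Longrightarrow> (f has_derivative D f x) (at x)"
  by (simp add: frechet_derivative_works)

text \<open>This also holds where \<open>f\<close> is not differentiable, since the derivative is
  chosen among the same candidates on both sides.\<close>

lemma D_cong:
  assumes "open S" "x \<in> S" "\<And>y. y \<in> S \<Longrightarrow> f y = g y"
  shows "D f x v = D g x v"
proof (cases "f differentiable at x")
  case True
  then show ?thesis using frechet_derivative_transform_within_open[OF True assms] by simp
next
  case False
  have "(f has_derivative f') (at x) \<longleftrightarrow> (g has_derivative f') (at x)" for f'
    using has_derivative_transform_within_open[OF _ assms(1,2), of f f' UNIV g]
      has_derivative_transform_within_open[OF _ assms(1,2), of g f' UNIV f] assms(3) by auto
  then show ?thesis unfolding frechet_derivative_def by simp
qed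

lemma differentiable_on_cong:
  assumes "\<And>y. y \<in> S \<Longrightarrow> f y = g y" "f differentiable_on S"
  shows "g differentiable_on S"
  using assms unfolding differentiable_on_def
  by (metis (no_types, lifting) differentiable_transform_within zero_less_one)

lemma Ck_on_cong:
  assumes "open S" "\<And>x. x \<in> S \<Longrightarrow> f x = g x" "Ck_on k S f"
  shows "Ck_on k S g"
  using assms
proof (induction k arbitrary: f g)
  case 0 then show ?case by (simp cong: continuous_on_cong)
next
  case (Suc k)
  have "Ck_on k S (\<lambda>x. D g x v)" for v
  proof (rule Suc.IH[OF Suc.prems(1)])
    show "D f x v = D g x v" if "x \<in> S" for x
      by (rule D_cong[OF Suc.prems(1) that Suc.prems(2)])
    show "Ck_on k S (\<lambda>x. D f x v)" using Suc.prems(3) by simp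
  qed
  then show ?case using Suc.prems differentiable_on_cong[of S f g] by simp
qed

lemma Ck_on_Suc:
  assumes "open S" shows "Ck_on (Suc k) S f \<Longrightarrow> Ck_on k S f"
proof (induction k arbitrary: f)
  case 0 then show ?case by (simp add: differentiable_imp_continuous_on)
next
  case (Suc k)
  then have "Ck_on k S (\<lambda>x. D f x v)" for v by (intro Suc.IH) simp
  then show ?case using Suc.prems by simp
qed

lemma Ck_on_differentiable: "open S \<Longrightarrow> Ck_on (Suc k) S f \<Longrightarrow> x \<in> S \<Longrightarrow> f differentiable at x"
  by (simp add: differentiable_on_eq_differentiable_at)

lemma Ck_onI:
  assumes "open S" "\<And>x. x \<in> S \<Longrightarrow> (f has_derivative f' x) (at x)" "\<And>v. Ck_on k S (\<lambda>x. f' x v)"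
  shows "Ck_on (Suc k) S f"
proof -
  have "Ck_on k S (\<lambda>x. D f x v)" for v
    by (rule Ck_on_cong[OF assms(1) _ assms(3)[of v]]) (simp add: D_eqI[OF assms(2)])
  then show ?thesis
    using assms(1,2) by (auto simp: differentiable_on_eq_differentiable_at differentiable_def)
qed

lemma Ck_on_const: "open S \<Longrightarrow> Ck_on k S (\<lambda>x. c)"
proof (induction k arbitrary: c)
  case (Suc k) then show ?case by (intro Ck_onI[where f'="\<lambda>x v. 0"]) auto
qed simp

lemma Ck_on_add:
  assumes "open S" "Ck_on k S f" "Ck_on k S g"
  shows "Ck_on k S (\<lambda>x. f x + g x)"
  using assms(2,3)
proof (induction k arbitrary: f g)
  case 0 then show ?case by (simp add: continuous_on_add)
next
  case (Suc k)
  show ?case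
  proof (rule Ck_onI[OF assms(1)])
    show "((\<lambda>x. f x + g x) has_derivative (\<lambda>v. D f x v + D g x v)) (at x)" if "x \<in> S" for x
      using Suc.prems Ck_on_differentiable[OF assms(1)] that
      by (intro has_derivative_add has_derivative_D) blast+
    show "Ck_on k S (\<lambda>x. D f x v + D g x v)" for v
      using Suc.prems by (intro Suc.IH) simp_all
  qed
qed

lemma Ck_on_mult:
  fixes f g :: "'e::real_normed_vector \<Rightarrow> real"
  assumes "open S" "Ck_on k S f" "Ck_on k S g"
  shows "Ck_on k S (\<lambda>x. f x * g x)"
  using assms(2,3)
proof (induction k arbitrary: f g)
  case 0 then show ?case by (simp add: continuous_on_mult)
next
  case (Suc k)
  note lower = Ck_on_Suc[OF assms(1)]
  show ?case
  proof (rule Ck_onI[OF assms(1)])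
    show "((\<lambda>x. f x * g x) has_derivative (\<lambda>v. f x * D g x v + D f x v * g x)) (at x)" if "x \<in> S" for x
      using Suc.prems Ck_on_differentiable[OF assms(1)] that
      by (intro has_derivative_mult has_derivative_D) blast+
    show "Ck_on k S (\<lambda>x. f x * D g x v + D f x v * g x)" for v
      using Suc.prems lower[OF Suc.prems(1)] lower[OF Suc.prems(2)]
      by (intro Ck_on_add[OF assms(1)] Suc.IH) simp_all
  qed
qed

lemma Ck_on_inverse:
  fixes f :: "'e::real_normed_vector \<Rightarrow> real"
  assumes "open S" "Ck_on k S f" "\<And>x. x \<in> S \<Longrightarrow> f x \<noteq> 0"
  shows "Ck_on k S (\<lambda>x. inverse (f x))"
  using assms(2,3)
proof (induction k arbitrary: f)
  case 0 then show ?case by (simp add: continuous_on_inverse)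
next
  case (Suc k)
  have inv: "Ck_on k S (\<lambda>x. inverse (f x))"
    using Suc.IH[OF Ck_on_Suc[OF assms(1) Suc.prems(1)]] Suc.prems(2) by blast
  show ?case
  proof (rule Ck_onI[OF assms(1)])
    show "((\<lambda>x. inverse (f x)) has_derivative (\<lambda>v. (-1) * (inverse (f x) * D f x v * inverse (f x)))) (at x)"
      if "x \<in> S" for x
    proof -
      have "(f has_derivative D f x) (at x)"
        by (rule has_derivative_D[OF Ck_on_differentiable[OF assms(1) Suc.prems(1) that]])
      from Deriv.has_derivative_inverse[OF Suc.prems(2)[OF that] this] show ?thesis by simp
    qed
    show "Ck_on k S (\<lambda>x. (-1) * (inverse (f x) * D f x v * inverse (f x)))" for v
      using Suc.prems inv by (intro Ck_on_mult[OF assms(1)] Ck_on_const[OF assms(1)]) simp_all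
  qed
qed

lemma Ck_on_inner:
  fixes f :: "'e::real_normed_vector \<Rightarrow> 'f::real_inner"
  assumes "open S" "Ck_on k S f"
  shows "Ck_on k S (\<lambda>x. w \<bullet> f x)"
  using assms(2)
proof (induction k arbitrary: f)
  case 0 then show ?case by (simp add: continuous_on_inner)
next
  case (Suc k)
  show ?case
  proof (rule Ck_onI[OF assms(1)])
    show "((\<lambda>x. w \<bullet> f x) has_derivative (\<lambda>v. w \<bullet> D f x v)) (at x)" if "x \<in> S" for x
      using Ck_on_differentiable[OF assms(1) Suc.prems that]
      by (intro has_derivative_inner_right has_derivative_D)
    show "Ck_on k S (\<lambda>x. w \<bullet> D f x v)" for v
      using Suc.prems by (intro Suc.IH) simp
  qed
qed

lemma smooth_on_cong:
  "open S \<Longrightarrow> (\<And>x. x \<in> S \<Longrightarrow> f x = g x) \<Longrightarrow> smooth_on S f \<Longrightarrow> smooth_on S g"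
  using Ck_on_cong unfolding smooth_on_def by blast

lemma smooth_on_const: "open S \<Longrightarrow> smooth_on S (\<lambda>x. c)"
  and smooth_on_add: "open S \<Longrightarrow> smooth_on S f1 \<Longrightarrow> smooth_on S g1 \<Longrightarrow> smooth_on S (\<lambda>x. f1 x + g1 x)"
  and smooth_on_mult: "open S \<Longrightarrow> smooth_on S f \<Longrightarrow> smooth_on S g \<Longrightarrow> smooth_on S (\<lambda>x. f x * g x :: real)"
  and smooth_on_inverse: "open S \<Longrightarrow> smooth_on S f \<Longrightarrow> (\<And>x. x \<in> S \<Longrightarrow> f x \<noteq> 0) \<Longrightarrow>
        smooth_on S (\<lambda>x. inverse (f x))"
  and smooth_on_inner: "open S \<Longrightarrow> smooth_on S h \<Longrightarrow> smooth_on S (\<lambda>x. w \<bullet> h x)"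
  unfolding smooth_on_def by (auto intro: Ck_on_const Ck_on_add Ck_on_mult Ck_on_inverse Ck_on_inner)

lemma smooth_on_divide:
  "open S \<Longrightarrow> smooth_on S f \<Longrightarrow> smooth_on S g \<Longrightarrow> (\<And>x. x \<in> S \<Longrightarrow> g x \<noteq> 0) \<Longrightarrow> smooth_on S (\<lambda>x. f x / g x :: real)"
  unfolding divide_inverse by (intro smooth_on_mult smooth_on_inverse)

lemma smooth_on_sum:
  "open S \<Longrightarrow> (\<And>i. i \<in> I \<Longrightarrow> smooth_on S (f i)) \<Longrightarrow> smooth_on S (\<lambda>x. \<Sum>i\<in>I. f i x)"
  by (induction I rule: infinite_finite_induct) (auto intro: smooth_on_const smooth_on_add)

lemma smooth_on_differentiable: "open S \<Longrightarrow> smooth_on S f \<Longrightarrow> x \<in> S \<Longrightarrow> f differentiable at x"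
  unfolding smooth_on_def using Ck_on_differentiable by blast

lemma smooth_on_D: "smooth_on S f \<Longrightarrow> smooth_on S (\<lambda>x. D f x v)"
  unfolding smooth_on_def by (metis Ck_on.simps(2))

lemma smooth_on_continuous: "smooth_on S f \<Longrightarrow> continuous_on S f"
  unfolding smooth_on_def by (metis Ck_on.simps(1))

subsection \<open>Symmetry of second derivatives\<close>

lemma directional_real_derivative:
  fixes f :: "'e::real_normed_vector \<Rightarrow> real"
  assumes "f differentiable at (p + s *\<^sub>R u)"
  shows "((\<lambda>s. f (p + s *\<^sub>R u)) has_real_derivative D f (p + s *\<^sub>R u) u) (at s)"
proof -
  have 1: "((\<lambda>s. p + s *\<^sub>R u) has_derivative (\<lambda>h. h *\<^sub>R u)) (at s)"
    by (auto intro!: derivative_eq_intros)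
  have "((\<lambda>s. f (p + s *\<^sub>R u)) has_derivative (\<lambda>h. D f (p + s *\<^sub>R u) (h *\<^sub>R u))) (at s)"
    using has_derivative_compose[OF 1 has_derivative_D[OF assms]] by simp
  moreover have "D f (p + s *\<^sub>R u) (h *\<^sub>R u) = h * D f (p + s *\<^sub>R u) u" for h
    using linear_scale[OF linear_frechet_derivative[OF assms]] by simp
  ultimately show ?thesis
    unfolding has_field_derivative_def
    by (elim has_derivative_eq_rhs) (simp add: fun_eq_iff mult.commute)
qed

text \<open>Two applications of the mean value theorem. The left-hand side is symmetric in
  \<open>u\<close> and \<open>v\<close>, the right-hand side is a mixed derivative in a fixed
  order.\<close>

lemma second_difference:
  fixes f :: "'e::real_normed_vector \<Rightarrow> real"
  assumes S: "open S" and f: "smooth_on S f" and t: "0 < t"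
    and box: "\<And>a b. a \<in> {0..t} \<Longrightarrow> b \<in> {0..t} \<Longrightarrow> x + a *\<^sub>R u + b *\<^sub>R v \<in> S"
  shows "\<exists>a\<in>{0..t}. \<exists>b\<in>{0..t}. f (x + t *\<^sub>R u + t *\<^sub>R v) - f (x + t *\<^sub>R u) - f (x + t *\<^sub>R v) + f x
     = t * t * D (\<lambda>y. D f y u) (x + a *\<^sub>R u + b *\<^sub>R v) v"
proof -
  note df = smooth_on_differentiable[OF S f]
  note ddf = smooth_on_differentiable[OF S smooth_on_D[OF f]]
  define g where "g = (\<lambda>a. f ((x + t *\<^sub>R v) + a *\<^sub>R u) - f (x + a *\<^sub>R u))"
  have swap: "x + t *\<^sub>R v + a *\<^sub>R u = x + a *\<^sub>R u + t *\<^sub>R v" for a by (simp add: algebra_simps)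
  have dg: "(g has_real_derivative D f (x + t *\<^sub>R v + a *\<^sub>R u) u - D f (x + a *\<^sub>R u) u) (at a)"
    if "0 \<le> a" "a \<le> t" for a
    unfolding g_def using box[of a t] box[of a 0] that t
    by (intro DERIV_diff directional_real_derivative df) (auto simp: swap)
  from MVT2[OF t dg] obtain a where a: "0 < a" "a < t"
    and ga: "g t - g 0 = (t - 0) * (D f (x + t *\<^sub>R v + a *\<^sub>R u) u - D f (x + a *\<^sub>R u) u)" by blast
  have dh: "((\<lambda>b. D f (x + a *\<^sub>R u + b *\<^sub>R v) u) has_real_derivative
      D (\<lambda>y. D f y u) (x + a *\<^sub>R u + b *\<^sub>R v) v) (at b)" if "0 \<le> b" "b \<le> t" for b
    using box[of a b] that a by (intro directional_real_derivative ddf) auto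
  from MVT2[OF t dh] obtain b where b: "0 < b" "b < t"
    and hb: "D f (x + a *\<^sub>R u + t *\<^sub>R v) u - D f (x + a *\<^sub>R u + 0 *\<^sub>R v) u
      = (t - 0) * D (\<lambda>y. D f y u) (x + a *\<^sub>R u + b *\<^sub>R v) v" by blast
  have "f (x + t *\<^sub>R u + t *\<^sub>R v) - f (x + t *\<^sub>R u) - f (x + t *\<^sub>R v) + f x = g t - g 0"
    by (simp add: g_def algebra_simps)
  also have "\<dots> = t * t * D (\<lambda>y. D f y u) (x + a *\<^sub>R u + b *\<^sub>R v) v"
    using ga hb by (simp add: swap)
  finally show ?thesis using a b by (intro bexI[of _ a] bexI[of _ b]) auto
qed

text \<open>If the mixed derivatives at \<open>x\<close> were different, they would remain
  separated in a small neighbourhood by continuity; but there \<open>second_difference\<close>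
  provides points where they agree.\<close>

lemma second_derivative_symmetric:
  fixes f :: "'e::real_normed_vector \<Rightarrow> real"
  assumes S: "open S" and f: "smooth_on S f" and x: "x \<in> S"
  shows "D (\<lambda>y. D f y u) x v = D (\<lambda>y. D f y v) x u"
proof (rule ccontr)
  let ?P = "\<lambda>y. D (\<lambda>y. D f y u) y v" and ?Q = "\<lambda>y. D (\<lambda>y. D f y v) y u"
  assume ne: "?P x \<noteq> ?Q x"
  define \<epsilon> where "\<epsilon> = \<bar>?P x - ?Q x\<bar> / 2"
  have \<epsilon>: "0 < \<epsilon>" using ne by (simp add: \<epsilon>_def)
  have cont: "isCont ?P x" "isCont ?Q x"
    using smooth_on_continuous[OF smooth_on_D[OF smooth_on_D[OF f]]] S x
    by (simp_all add: continuous_on_eq_continuous_at)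
  obtain d1 where d1: "0 < d1" "\<And>y. dist y x < d1 \<Longrightarrow> dist (?P y) (?P x) < \<epsilon>"
    using cont(1) \<epsilon> unfolding continuous_at_eps_delta by blast
  obtain d2 where d2: "0 < d2" "\<And>y. dist y x < d2 \<Longrightarrow> dist (?Q y) (?Q x) < \<epsilon>"
    using cont(2) \<epsilon> unfolding continuous_at_eps_delta by blast
  obtain d3 where d3: "0 < d3" "\<And>y. dist y x < d3 \<Longrightarrow> y \<in> S"
    using S x unfolding open_dist by blast
  define r where "r = min d1 (min d2 d3)"
  have r: "0 < r" using d1 d2 d3 by (simp add: r_def)
  \<comment> \<open>the parallelogram with sides \<open>t u\<close> and \<open>t v\<close> lies in
    the ball of radius \<open>r\<close>; adding 1 covers \<open>u = v = 0\<close>\<close>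
  define t where "t = r / (norm u + norm v + 1)"
  have t: "0 < t" using r by (simp add: t_def add_nonneg_pos)
  have near: "dist (x + a *\<^sub>R u + b *\<^sub>R v) x < r" if "a \<in> {0..t}" "b \<in> {0..t}" for a b
  proof -
    have "dist (x + a *\<^sub>R u + b *\<^sub>R v) x \<le> norm (a *\<^sub>R u) + norm (b *\<^sub>R v)"
      using norm_triangle_ineq[of "a *\<^sub>R u" "b *\<^sub>R v"] by (simp add: dist_norm add.assoc)
    also have "\<dots> \<le> t * norm u + t * norm v"
      using that by (intro add_mono) (auto intro: mult_right_mono)
    also have "\<dots> < t * (norm u + norm v + 1)" using t by (simp add: algebra_simps)
    also have "\<dots> = r"
      using add_nonneg_pos[of "norm u + norm v" 1] by (simp add: t_def)
    finally show ?thesis .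
  qed
  have box: "x + a *\<^sub>R u + b *\<^sub>R v \<in> S" "x + a *\<^sub>R v + b *\<^sub>R u \<in> S"
    if "a \<in> {0..t}" "b \<in> {0..t}" for a b
    using near[OF that] near[OF that(2,1)] d3 by (auto simp: r_def algebra_simps)
  obtain a b where ab: "a \<in> {0..t}" "b \<in> {0..t}"
    and 1: "f (x + t *\<^sub>R u + t *\<^sub>R v) - f (x + t *\<^sub>R u) - f (x + t *\<^sub>R v) + f x
      = t * t * ?P (x + a *\<^sub>R u + b *\<^sub>R v)"
    using second_difference[OF S f t box(1)] by blast
  obtain c e where ce: "c \<in> {0..t}" "e \<in> {0..t}"
    and 2: "f (x + t *\<^sub>R v + t *\<^sub>R u) - f (x + t *\<^sub>R v) - f (x + t *\<^sub>R u) + f x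
      = t * t * ?Q (x + c *\<^sub>R v + e *\<^sub>R u)"
    using second_difference[OF S f t box(2)] by blast
  have comm: "x + t *\<^sub>R v + t *\<^sub>R u = x + t *\<^sub>R u + t *\<^sub>R v" by (simp add: algebra_simps)
  have "t * t * ?P (x + a *\<^sub>R u + b *\<^sub>R v) = t * t * ?Q (x + c *\<^sub>R v + e *\<^sub>R u)"
    using 1 2[unfolded comm] by linarith
  then have eq: "?P (x + a *\<^sub>R u + b *\<^sub>R v) = ?Q (x + c *\<^sub>R v + e *\<^sub>R u)" using t by simp
  have sw: "x + c *\<^sub>R v + e *\<^sub>R u = x + e *\<^sub>R u + c *\<^sub>R v" by (simp add: algebra_simps)
  have "dist (x + c *\<^sub>R v + e *\<^sub>R u) x < d2"
    using near[OF ce(2,1)] unfolding sw by (simp add: r_def)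
  then have "dist (?Q (x + c *\<^sub>R v + e *\<^sub>R u)) (?Q x) < \<epsilon>" by (rule d2(2))
  moreover have "dist (?P (x + a *\<^sub>R u + b *\<^sub>R v)) (?P x) < \<epsilon>"
    using near[OF ab] by (intro d1) (simp add: r_def)
  ultimately show False using eq by (simp add: \<epsilon>_def dist_real_def abs_if split: if_splits)
qed

lemma second_derivative_symmetric_vector:
  fixes F :: "'e::real_normed_vector \<Rightarrow> 'f::real_inner"
  assumes S: "open S" and F: "smooth_on S F" and x: "x \<in> S"
  shows "D (\<lambda>y. D F y u) x v = D (\<lambda>y. D F y v) x u"
proof -
  have D_inner: "D (\<lambda>y. w \<bullet> G y) y v = w \<bullet> D G y v"
    if "smooth_on S G" "y \<in> S" for w y v and G :: "'e \<Rightarrow> 'f"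
    using smooth_on_differentiable[OF S that]
    by (intro D_eqI has_derivative_inner_right has_derivative_D)
  have DD: "D (\<lambda>y. D (\<lambda>y. w \<bullet> F y) y u) x v = w \<bullet> D (\<lambda>y. D F y u) x v" for w u v
  proof -
    have "D (\<lambda>y. D (\<lambda>y. w \<bullet> F y) y u) x v = D (\<lambda>y. w \<bullet> D F y u) x v"
      by (rule D_cong[OF S x]) (rule D_inner[OF F])
    then show ?thesis using D_inner[OF smooth_on_D[OF F] x] by simp
  qed
  have "w \<bullet> D (\<lambda>y. D F y u) x v = w \<bullet> D (\<lambda>y. D F y v) x u" for w
    using second_derivative_symmetric[OF S smooth_on_inner[OF S F] x, of w u v] unfolding DD .
  then show ?thesis using vector_eq_ldot by blast
qed

section \<open>Smooth families of alternating forms and their exterior derivative\<close>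

text \<open>The local representative of a form in a chart, without reference to the
  manifold.\<close>

definition smooth_family :: "'e::real_normed_vector set \<Rightarrow> ('e \<Rightarrow> 'e alt) \<Rightarrow> bool" where
  "smooth_family S \<alpha> \<longleftrightarrow> (\<forall>x\<in>S. alternating (\<alpha> x)) \<and> (\<forall>vs. smooth_on S (\<lambda>x. \<alpha> x vs))"

lemma smooth_family_alternating: "smooth_family S \<alpha> \<Longrightarrow> x \<in> S \<Longrightarrow> alternating (\<alpha> x)"
  and smooth_family_smooth: "smooth_family S \<alpha> \<Longrightarrow> smooth_on S (\<lambda>x. \<alpha> x vs)"
  by (simp_all add: smooth_family_def)

lemma smooth_family_differentiable:
  "open S \<Longrightarrow> smooth_family S \<alpha> \<Longrightarrow> x \<in> S \<Longrightarrow> (\<lambda>x. \<alpha> x vs) differentiable at x"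
  using smooth_on_differentiable smooth_family_smooth by blast

lemma smooth_family_cong:
  "open S \<Longrightarrow> (\<And>x. x \<in> S \<Longrightarrow> \<alpha> x = \<beta> x) \<Longrightarrow> smooth_family S \<alpha> \<Longrightarrow> smooth_family S \<beta>"
  unfolding smooth_family_def using smooth_on_cong[of S "\<lambda>x. \<alpha> x _" "\<lambda>x. \<beta> x _"] by simp

lemma smooth_family_const: "open S \<Longrightarrow> alternating \<alpha> \<Longrightarrow> smooth_family S (\<lambda>x. \<alpha>)"
  by (simp add: smooth_family_def smooth_on_const)

lemma smooth_family_add:
  "open S \<Longrightarrow> smooth_family S \<alpha> \<Longrightarrow> smooth_family S \<beta> \<Longrightarrow> smooth_family S (\<lambda>x. \<alpha> x + \<beta> x)"
  by (auto simp: smooth_family_def fun_app intro: alternating_add smooth_on_add)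

lemma smooth_family_scale:
  "open S \<Longrightarrow> smooth_on S f \<Longrightarrow> smooth_family S \<alpha> \<Longrightarrow> smooth_family S (\<lambda>x. f x *\<^sub>R \<alpha> x)"
  by (auto simp: smooth_family_def fun_app intro: alternating_scale smooth_on_mult)

lemma smooth_family_sum:
  "open S \<Longrightarrow> (\<And>i. i \<in> I \<Longrightarrow> smooth_family S (\<alpha> i)) \<Longrightarrow> smooth_family S (\<lambda>x. \<Sum>i\<in>I. \<alpha> i x)"
  by (auto simp: smooth_family_def sum_fun_apply intro!: alternating_sum smooth_on_sum)

lemma smooth_family_wedge:
  "open S \<Longrightarrow> smooth_family S \<alpha> \<Longrightarrow> smooth_family S \<beta> \<Longrightarrow> smooth_family S (\<lambda>x. \<alpha> x \<and>\<^sub>a \<beta> x)"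
  by (auto simp: smooth_family_def wedge_def[abs_def] alternating_wedge[unfolded wedge_def[abs_def]]
    intro!: smooth_on_sum smooth_on_mult smooth_on_const)

lemma smooth_family_\<iota>: "smooth_family S \<alpha> \<Longrightarrow> smooth_family S (\<lambda>x. \<iota> v (\<alpha> x))"
  by (auto simp: smooth_family_def \<iota>_apply intro: alternating_\<iota>)

text \<open>Alternation over the choice of an argument. The exterior derivative is the case where
  \<open>k v\<close> is the derivative in direction \<open>v\<close>; the Hessian of a coordinate
  change is another case.\<close>

definition skew :: "('e \<Rightarrow> 'e alt) \<Rightarrow> 'e alt" where
  "skew k vs = (\<Sum>i<length vs. (-1) ^ i * k (vs ! i) (take i vs @ drop (Suc i) vs))"

lemma skew_Nil: "skew k [] = 0"
  by (simp add: skew_def)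

lemma skew_Cons: "skew k (u # us) = k u us - skew (\<lambda>v. \<iota> u (k v)) us"
  unfolding skew_def list.size add_0_right add_Suc_right sum.lessThan_Suc_shift
  by (simp add: sum_negf \<iota>_apply)

lemma skew_diff: "skew (\<lambda>v. k v - l v) = skew k - skew l"
  by (auto simp: skew_def fun_eq_iff fun_app sum_subtractf algebra_simps)

lemma skew_add: "skew (\<lambda>v. k v + l v) = skew k + skew l"
  by (auto simp: skew_def fun_eq_iff fun_app sum.distrib algebra_simps)

lemma skew_scale: "skew (\<lambda>v. r *\<^sub>R k v) = r *\<^sub>R skew k"
  by (auto simp: skew_def fun_eq_iff fun_app sum_distrib_left algebra_simps)

text \<open>Choosing two arguments in both orders gives opposite signs. This is the common reason
  for \<open>d\<^sup>2 = 0\<close> and for the compatibility of \<open>d\<close> with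
  pullbacks.\<close>

lemma skew_skew:
  assumes "\<And>a b. K a b = K b a"
  shows "skew (\<lambda>a. skew (K a)) = 0"
proof
  fix vs show "skew (\<lambda>a. skew (K a)) vs = 0 vs"
    using assms
  proof (induction vs arbitrary: K)
    case Nil then show ?case by (simp add: skew_Nil fun_app)
  next
    case (Cons u us)
    have 1: "\<iota> u (skew (K v)) = K v u - skew (\<lambda>b. \<iota> u (K v b))" for v
      by (auto simp: fun_eq_iff skew_Cons fun_app)
    have "skew (\<lambda>a. skew (K a)) (u # us)
        = skew (K u) us - (skew (\<lambda>v. K v u) us - skew (\<lambda>v. skew (\<lambda>b. \<iota> u (K v b))) us)"
      unfolding skew_Cons 1 skew_diff by (simp add: fun_app)
    moreover have "skew (\<lambda>v. skew (\<lambda>b. \<iota> u (K v b))) us = 0 us"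
      by (rule Cons.IH) (simp add: Cons.prems)
    moreover have "(\<lambda>v. K v u) = K u" using Cons.prems by (simp add: fun_eq_iff)
    ultimately show ?case by (simp add: fun_app)
  qed
qed

text \<open>The derivative of a family of forms in a constant direction.\<close>

definition pd :: "'e::real_normed_vector \<Rightarrow> ('e \<Rightarrow> 'e alt) \<Rightarrow> 'e \<Rightarrow> 'e alt" where
  "pd v \<alpha> x = (\<lambda>vs. D (\<lambda>y. \<alpha> y vs) x v)"

text \<open>The exterior derivative in a chart.\<close>

definition dd :: "('e::real_normed_vector \<Rightarrow> 'e alt) \<Rightarrow> 'e \<Rightarrow> 'e alt" where
  "dd \<alpha> x = skew (\<lambda>v. pd v \<alpha> x)"

lemma pd_cong:
  assumes "open S" "x \<in> S" "\<And>y. y \<in> S \<Longrightarrow> \<alpha> y = \<beta> y" shows "pd v \<alpha> x = pd v \<beta> x"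
  unfolding pd_def using D_cong[OF assms(1,2), of "\<lambda>y. \<alpha> y _" "\<lambda>y. \<beta> y _"] assms(3) by simp

lemma dd_cong:
  assumes "open S" "x \<in> S" "\<And>y. y \<in> S \<Longrightarrow> \<alpha> y = \<beta> y" shows "dd \<alpha> x = dd \<beta> x"
  unfolding dd_def using pd_cong[OF assms] by simp

context
  fixes S :: "'e::real_normed_vector set" assumes S: "open S"
begin

lemma pd_has_derivative:
  assumes "smooth_family S \<alpha>" "x \<in> S"
  shows "((\<lambda>y. \<alpha> y vs) has_derivative (\<lambda>v. pd v \<alpha> x vs)) (at x)"
  unfolding pd_def using has_derivative_D[OF smooth_family_differentiable[OF S assms]] .

lemma pd_linear_direction:
  assumes "smooth_family S \<alpha>" "x \<in> S"
  shows "linear (\<lambda>v. pd v \<alpha> x vs)"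
  unfolding pd_def using linear_frechet_derivative[OF smooth_family_differentiable[OF S assms]] .

lemma pd_add:
  assumes "smooth_family S \<alpha>" "smooth_family S \<beta>" "x \<in> S"
  shows "pd v (\<lambda>y. \<alpha> y + \<beta> y) x = pd v \<alpha> x + pd v \<beta> x"
proof
  fix vs
  have "((\<lambda>y. \<alpha> y vs + \<beta> y vs) has_derivative (\<lambda>v. pd v \<alpha> x vs + pd v \<beta> x vs)) (at x)"
    using assms by (intro has_derivative_add pd_has_derivative)
  from D_eqI[OF this] show "pd v (\<lambda>y. \<alpha> y + \<beta> y) x vs = (pd v \<alpha> x + pd v \<beta> x) vs"
    by (simp add: pd_def fun_app)
qed

lemma pd_scale:
  assumes "smooth_family S \<alpha>" "x \<in> S"
  shows "pd v (\<lambda>y. r *\<^sub>R \<alpha> y) x = r *\<^sub>R pd v \<alpha> x"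
proof
  fix vs
  have "((\<lambda>y. r *\<^sub>R \<alpha> y vs) has_derivative (\<lambda>v. r *\<^sub>R pd v \<alpha> x vs)) (at x)"
    using assms by (intro has_derivative_scaleR_right pd_has_derivative)
  from D_eqI[OF this] show "pd v (\<lambda>y. r *\<^sub>R \<alpha> y) x vs = (r *\<^sub>R pd v \<alpha> x) vs"
    by (simp add: pd_def fun_app)
qed

lemma pd_wedge:
  assumes "smooth_family S \<alpha>" "smooth_family S \<beta>" "x \<in> S"
  shows "pd v (\<lambda>y. \<alpha> y \<and>\<^sub>a \<beta> y) x = pd v \<alpha> x \<and>\<^sub>a \<beta> x + \<alpha> x \<and>\<^sub>a pd v \<beta> x"
proof
  fix vs :: "'e list"
  let ?s = "shuffle_sign (length vs)" and ?c = "\<lambda>I. {..<length vs} - I"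
  have "((\<lambda>y. (\<alpha> y \<and>\<^sub>a \<beta> y) vs) has_derivative (\<lambda>v. \<Sum>I\<in>Pow {..<length vs}.
      (?s I * \<alpha> x (nths vs I)) * pd v \<beta> x (nths vs (?c I)) +
      (?s I * pd v \<alpha> x (nths vs I)) * \<beta> x (nths vs (?c I)))) (at x)"
    unfolding wedge_def using assms
    by (intro has_derivative_sum has_derivative_mult has_derivative_mult_right pd_has_derivative)
  from D_eqI[OF this] show "pd v (\<lambda>y. \<alpha> y \<and>\<^sub>a \<beta> y) x vs
      = (pd v \<alpha> x \<and>\<^sub>a \<beta> x + \<alpha> x \<and>\<^sub>a pd v \<beta> x) vs"
    by (simp add: pd_def[of v "\<lambda>y. \<alpha> y \<and>\<^sub>a \<beta> y"] wedge_def fun_app sum.distrib algebra_simps)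
qed

lemma smooth_family_pd:
  assumes \<alpha>: "smooth_family S \<alpha>" shows "smooth_family S (pd v \<alpha>)"
  unfolding smooth_family_def
proof (intro conjI ballI allI)
  show "smooth_on S (\<lambda>x. pd v \<alpha> x vs)" for vs
    unfolding pd_def by (rule smooth_on_D[OF smooth_family_smooth[OF \<alpha>]])
next
  fix x assume x: "x \<in> S"
  note a = smooth_family_alternating[OF \<alpha>]
  show "alternating (pd v \<alpha> x)"
    unfolding alternating_def
  proof (intro conjI allI impI linearI)
    fix us ws and b c :: 'e
    have "D (\<lambda>y. \<alpha> y (us @ (b + c) # ws)) x v = D (\<lambda>y. \<alpha> y (us @ b # ws) + \<alpha> y (us @ c # ws)) x v"
      by (rule D_cong[OF S x]) (simp add: linear_add[OF alternating_linear[OF a]])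
    also have "\<dots> = pd v \<alpha> x (us @ b # ws) + pd v \<alpha> x (us @ c # ws)"
      using \<alpha> x by (intro D_eqI has_derivative_add pd_has_derivative)
    finally show "pd v \<alpha> x (us @ (b + c) # ws) = pd v \<alpha> x (us @ b # ws) + pd v \<alpha> x (us @ c # ws)"
      by (simp add: pd_def)
  next
    fix us ws r and b :: 'e
    have "D (\<lambda>y. \<alpha> y (us @ (r *\<^sub>R b) # ws)) x v = D (\<lambda>y. r *\<^sub>R \<alpha> y (us @ b # ws)) x v"
      by (rule D_cong[OF S x]) (simp add: linear_scale[OF alternating_linear[OF a]])
    also have "\<dots> = r *\<^sub>R pd v \<alpha> x (us @ b # ws)"
      using \<alpha> x by (intro D_eqI has_derivative_scaleR_right pd_has_derivative)
    finally show "pd v \<alpha> x (us @ (r *\<^sub>R b) # ws) = r *\<^sub>R pd v \<alpha> x (us @ b # ws)"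
      by (simp add: pd_def)
  next
    fix vs :: "'e list" assume "\<not> distinct vs"
    then have "D (\<lambda>y. \<alpha> y vs) x v = D (\<lambda>y. 0) x v"
      using a by (intro D_cong[OF S x]) (simp add: alternating_def)
    then show "pd v \<alpha> x vs = 0" by (simp add: pd_def)
  qed
qed

lemma pd_commute:
  assumes "smooth_family S \<alpha>" "x \<in> S" shows "pd u (pd v \<alpha>) x = pd v (pd u \<alpha>) x"
  unfolding pd_def using second_derivative_symmetric[OF S smooth_family_smooth[OF assms(1)] assms(2)]
  by simp

lemma pd_homog:
  assumes "\<And>y. y \<in> S \<Longrightarrow> homog p (\<alpha> y)" "x \<in> S" shows "homog p (pd v \<alpha> x)"
  unfolding homog_def
proof (intro allI impI)
  fix vs :: "'e list" assume "length vs \<noteq> p"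
  then have "D (\<lambda>y. \<alpha> y vs) x v = D (\<lambda>y. 0) x v"
    using assms(1) by (intro D_cong[OF S assms(2)]) (simp add: homog_def)
  then show "pd v \<alpha> x vs = 0" by (simp add: pd_def)
qed

lemma dd_homog:
  assumes "\<And>y. y \<in> S \<Longrightarrow> homog p (\<alpha> y)" "x \<in> S" shows "homog (Suc p) (dd \<alpha> x)"
  unfolding homog_def dd_def skew_def
proof (intro allI impI sum.neutral ballI)
  fix vs :: "'e list" and i assume "length vs \<noteq> Suc p" "i \<in> {..<length vs}"
  then have "pd (vs ! i) \<alpha> x (take i vs @ drop (Suc i) vs) = 0"
    using pd_homog[OF assms, where v="vs ! i"] by (auto simp: homog_def)
  then show "(-1) ^ i * pd (vs ! i) \<alpha> x (take i vs @ drop (Suc i) vs) = 0" by simp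
qed

lemma dd_add:
  "smooth_family S \<alpha> \<Longrightarrow> smooth_family S \<beta> \<Longrightarrow> x \<in> S \<Longrightarrow> dd (\<lambda>y. \<alpha> y + \<beta> y) x = dd \<alpha> x + dd \<beta> x"
  by (simp add: dd_def pd_add skew_add)

lemma dd_scale:
  "smooth_family S \<alpha> \<Longrightarrow> x \<in> S \<Longrightarrow> dd (\<lambda>y. r *\<^sub>R \<alpha> y) x = r *\<^sub>R dd \<alpha> x"
  by (simp add: dd_def pd_scale skew_scale)

lemma pd_dd:
  assumes "smooth_family S \<alpha>" "x \<in> S" shows "pd u (dd \<alpha>) x = skew (\<lambda>v. pd u (pd v \<alpha>) x)"
proof
  fix vs
  have "((\<lambda>y. dd \<alpha> y vs) has_derivative (\<lambda>u. \<Sum>i<length vs. (-1) ^ i *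
      pd u (pd (vs ! i) \<alpha>) x (take i vs @ drop (Suc i) vs))) (at x)"
    unfolding dd_def skew_def using assms
    by (intro has_derivative_sum has_derivative_mult_right pd_has_derivative smooth_family_pd)
  from D_eqI[OF this] show "pd u (dd \<alpha>) x vs = skew (\<lambda>v. pd u (pd v \<alpha>) x) vs"
    by (simp add: pd_def[of u "dd \<alpha>"] skew_def)
qed

lemma dd_dd:
  assumes "smooth_family S \<alpha>" "x \<in> S" shows "dd (dd \<alpha>) x = 0"
  unfolding dd_def[of "dd \<alpha>"] pd_dd[OF assms] by (rule skew_skew) (rule pd_commute[OF assms])

end

context orthonormal_basis
begin

lemma skew_linear:
  assumes "\<And>vs. linear (\<lambda>v. k v vs)" shows "skew k = (\<Sum>e\<in>B. dual e \<and>\<^sub>a k e)"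
proof
  fix vs
  have "(\<Sum>e\<in>B. dual e \<and>\<^sub>a k e) vs
      = (\<Sum>i<length vs. (-1) ^ i * (\<Sum>e\<in>B. (e \<bullet> vs ! i) * k e (take i vs @ drop (Suc i) vs)))"
    by (simp add: sum_fun_apply covector_wedge_expand sum.swap[of _ B] sum_distrib_left mult.assoc)
  also have "\<dots> = skew k vs"
    unfolding skew_def
  proof (rule sum.cong[OF refl])
    fix i
    let ?ws = "take i vs @ drop (Suc i) vs"
    have "k (vs ! i) ?ws = (\<Sum>e\<in>B. (e \<bullet> vs ! i) *\<^sub>R k e ?ws)"
      by (rule linear_expand[OF assms])
    then show "(-1) ^ i * (\<Sum>e\<in>B. (e \<bullet> vs ! i) * k e ?ws) = (-1) ^ i * k (vs ! i) ?ws"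
      by simp
  qed
  finally show "skew k vs = (\<Sum>e\<in>B. dual e \<and>\<^sub>a k e) vs" ..
qed

lemma dd_eq:
  assumes "open S" "smooth_family S \<alpha>" "x \<in> S"
  shows "dd \<alpha> x = (\<Sum>e\<in>B. dual e \<and>\<^sub>a pd e \<alpha> x)"
  unfolding dd_def by (rule skew_linear[OF pd_linear_direction[OF assms]])

lemma smooth_family_dd:
  fixes S :: "'e set"
  assumes S: "open S" and \<alpha>: "smooth_family S \<alpha>" shows "smooth_family S (dd \<alpha>)"
proof (rule smooth_family_cong[OF S])
  show "smooth_family S (\<lambda>x. \<Sum>e\<in>B. dual e \<and>\<^sub>a pd e \<alpha> x)"
    by (intro smooth_family_sum smooth_family_wedge smooth_family_const smooth_family_pd alternating_dual S \<alpha>)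
qed (simp add: dd_eq[OF S \<alpha>])

text \<open>The product rule for directional derivatives; an even form commutes with the
  covectors.\<close>

lemma dd_wedge_even:
  fixes S :: "'e set"
  assumes S: "open S" and \<omega>: "smooth_family S \<omega>" and \<alpha>: "smooth_family S \<alpha>" and x: "x \<in> S"
    and even: "grade_inv (\<omega> x) = \<omega> x"
  shows "dd (\<lambda>y. \<omega> y \<and>\<^sub>a \<alpha> y) x = dd \<omega> x \<and>\<^sub>a \<alpha> x + \<omega> x \<and>\<^sub>a dd \<alpha> x"
proof -
  have c: "dual e \<and>\<^sub>a \<omega> x \<and>\<^sub>a \<beta> = \<omega> x \<and>\<^sub>a dual e \<and>\<^sub>a \<beta>" for e \<beta>
    by (simp add: wedge_commute_even[OF even, of "dual e"] flip: wedge_assoc)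
  have "dd (\<lambda>y. \<omega> y \<and>\<^sub>a \<alpha> y) x = (\<Sum>e\<in>B. dual e \<and>\<^sub>a (pd e \<omega> x \<and>\<^sub>a \<alpha> x + \<omega> x \<and>\<^sub>a pd e \<alpha> x))"
    unfolding dd_eq[OF S smooth_family_wedge[OF S \<omega> \<alpha>] x] pd_wedge[OF S \<omega> \<alpha> x] ..
  also have "\<dots> = (\<Sum>e\<in>B. (dual e \<and>\<^sub>a pd e \<omega> x) \<and>\<^sub>a \<alpha> x) + (\<Sum>e\<in>B. \<omega> x \<and>\<^sub>a dual e \<and>\<^sub>a pd e \<alpha> x)"
    by (simp add: sum.distrib c wedge_assoc)
  also have "\<dots> = dd \<omega> x \<and>\<^sub>a \<alpha> x + \<omega> x \<and>\<^sub>a dd \<alpha> x"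
    unfolding dd_eq[OF S \<omega> x] dd_eq[OF S \<alpha> x]
    by (simp add: linear_sum[OF wedge_linear_left] linear_sum[OF wedge_linear_right])
  finally show ?thesis .
qed

subsection \<open>Pullbacks\<close>

text \<open>Expanding the first argument in the basis reduces the claim to constant first
  arguments.\<close>

lemma smooth_on_eval:
  fixes S :: "'e set"
  assumes S: "open S" and "smooth_family S \<eta>" "\<And>w e. w \<in> set ws \<Longrightarrow> e \<in> B \<Longrightarrow> smooth_on S (\<lambda>x. e \<bullet> w x)"
  shows "smooth_on S (\<lambda>x. \<eta> x (map (\<lambda>w. w x) ws))"
  using assms(2,3)
proof (induction ws arbitrary: \<eta>)
  case Nil then show ?case by (simp add: smooth_family_smooth)
next
  case (Cons w ws)
  have "smooth_on S (\<lambda>x. \<Sum>e\<in>B. (e \<bullet> w x) * \<iota> e (\<eta> x) (map (\<lambda>w. w x) ws))"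
  proof (rule smooth_on_sum[OF S], rule smooth_on_mult[OF S])
    show "smooth_on S (\<lambda>x. e \<bullet> w x)" if "e \<in> B" for e using Cons.prems(2) that by simp
    show "smooth_on S (\<lambda>x. \<iota> e (\<eta> x) (map (\<lambda>w. w x) ws))" for e
      by (rule Cons.IH[OF smooth_family_\<iota>[OF Cons.prems(1)]]) (use Cons.prems(2) in simp)
  qed
  moreover have "(\<Sum>e\<in>B. (e \<bullet> w x) * \<iota> e (\<eta> x) (map (\<lambda>w. w x) ws)) = \<eta> x (map (\<lambda>w. w x) (w # ws))"
    if "x \<in> S" for x
    using alternating_expand[OF smooth_family_alternating[OF Cons.prems(1) that], where us="[]"]
    by (simp add: \<iota>_apply)
  ultimately show ?case by (rule smooth_on_cong[OF S, rotated])
qed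

text \<open>The product rule for a multilinear form with all arguments varying, again by expanding
  the first argument in the basis.\<close>

lemma pull_has_derivative:
  fixes F :: "'e \<Rightarrow> 'e"
  assumes S': "open S'" and \<eta>: "smooth_family S' \<eta>" and U: "open U" "x \<in> U" "F ` U \<subseteq> S'"
    and F: "F differentiable at x" and ws: "\<And>w. w \<in> set ws \<Longrightarrow> w differentiable at x"
  shows "((\<lambda>y. \<eta> (F y) (map (\<lambda>w. w y) ws)) has_derivative
    (\<lambda>v. pd (D F x v) \<eta> (F x) (map (\<lambda>w. w x) ws) +
      (\<Sum>m<length ws. \<eta> (F x) ((map (\<lambda>w. w x) ws)[m := D (ws ! m) x v])))) (at x)"
  using \<eta> ws
proof (induction ws arbitrary: \<eta>)
  case Nil
  have "F x \<in> S'" using U by auto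
  then show ?case
    using has_derivative_compose[OF has_derivative_D[OF F] pd_has_derivative[OF S' Nil(1)]] by simp
next
  case (Cons w ws)
  note \<eta> = Cons.prems(1)
  have Fx: "F x \<in> S'" using U by auto
  define W where "W y = map (\<lambda>w. w y) ws" for y
  note a = smooth_family_alternating[OF \<eta>]
  have ex: "(\<Sum>e\<in>B. (e \<bullet> z) * \<beta> (e # vs)) = \<beta> (z # vs)" if "alternating \<beta>" for z \<beta> vs
    using alternating_expand[OF that, where us="[]"] by simp
  have "((\<lambda>y. \<Sum>e\<in>B. (e \<bullet> w y) * \<iota> e (\<eta> (F y)) (W y)) has_derivative
    (\<lambda>v. \<Sum>e\<in>B. (e \<bullet> w x) * (pd (D F x v) (\<lambda>y. \<iota> e (\<eta> y)) (F x) (W x) +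
          (\<Sum>m<length ws. \<iota> e (\<eta> (F x)) ((W x)[m := D (ws ! m) x v])))
       + (e \<bullet> D w x v) * \<iota> e (\<eta> (F x)) (W x))) (at x)"
    unfolding W_def using Cons.prems
    by (intro has_derivative_sum has_derivative_mult Cons.IH smooth_family_\<iota>
        has_derivative_inner_right has_derivative_D) auto
  moreover have "(\<Sum>e\<in>B. (e \<bullet> w y) * \<iota> e (\<eta> (F y)) (W y)) = \<eta> (F y) (map (\<lambda>w. w y) (w # ws))"
    if "y \<in> U" for y
    using U(3) that by (simp add: \<iota>_apply ex[OF a] W_def image_subset_iff)
  ultimately have main: "((\<lambda>y. \<eta> (F y) (map (\<lambda>w. w y) (w # ws))) has_derivative
    (\<lambda>v. \<Sum>e\<in>B. (e \<bullet> w x) * (pd (D F x v) (\<lambda>y. \<iota> e (\<eta> y)) (F x) (W x) +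
          (\<Sum>m<length ws. \<iota> e (\<eta> (F x)) ((W x)[m := D (ws ! m) x v])))
       + (e \<bullet> D w x v) * \<iota> e (\<eta> (F x)) (W x))) (at x)"
    by (rule has_derivative_transform_within_open[OF _ U(1,2)])
  have pd\<iota>: "pd u (\<lambda>y. \<iota> e (\<eta> y)) z vs = pd u \<eta> z (e # vs)" for u e z vs
    by (simp add: pd_def \<iota>_apply)
  have "(\<Sum>e\<in>B. (e \<bullet> w x) * (pd (D F x v) (\<lambda>y. \<iota> e (\<eta> y)) (F x) (W x) +
          (\<Sum>m<length ws. \<iota> e (\<eta> (F x)) ((W x)[m := D (ws ! m) x v])))
       + (e \<bullet> D w x v) * \<iota> e (\<eta> (F x)) (W x))
     = pd (D F x v) \<eta> (F x) (w x # W x) + (\<eta> (F x) (D w x v # W x) +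
      (\<Sum>m<length ws. \<eta> (F x) (w x # (W x)[m := D (ws ! m) x v])))" (is "?l = ?r") for v
  proof -
    have "?l = (\<Sum>e\<in>B. (e \<bullet> w x) * pd (D F x v) \<eta> (F x) (e # W x))
        + (\<Sum>m<length ws. \<Sum>e\<in>B. (e \<bullet> w x) * \<eta> (F x) (e # (W x)[m := D (ws ! m) x v]))
        + (\<Sum>e\<in>B. (e \<bullet> D w x v) * \<eta> (F x) (e # W x))"
      by (simp add: \<iota>_apply pd\<iota> sum.distrib distrib_left sum_distrib_left sum.swap[of _ B])
    then show ?thesis
      using ex[OF a[OF Fx]] ex[OF smooth_family_alternating[OF smooth_family_pd[OF S' \<eta>] Fx]] by simp
  qed
  moreover have "(\<Sum>m<length (w # ws). \<eta> (F x) ((map (\<lambda>w. w x) (w # ws))[m := D ((w # ws) ! m) x v]))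
     = \<eta> (F x) (D w x v # W x) + (\<Sum>m<length ws. \<eta> (F x) (w x # (W x)[m := D (ws ! m) x v]))" for v
    unfolding list.size add_0_right add_Suc_right sum.lessThan_Suc_shift by (simp add: W_def)
  ultimately show ?case using main by (simp add: W_def)
qed

text \<open>Besides the pullback of the derivative, the derivative of a pullback contains terms in
  which one argument is replaced by a second derivative of \<open>F\<close>. Moved to the front,
  these terms form the alternation of a symmetric expression, so they cancel.\<close>

lemma dd_pull:
  fixes F :: "'e \<Rightarrow> 'e"
  assumes U: "open U" "smooth_on U F" "F ` U \<subseteq> S'" "x \<in> U" and S': "open S'" and \<eta>: "smooth_family S' \<eta>"
  shows "dd (\<lambda>y vs. \<eta> (F y) (map (D F y) vs)) x vs = dd \<eta> (F x) (map (D F x) vs)"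
proof -
  note a = smooth_family_alternating[OF \<eta>]
  have Fx: "F x \<in> S'" using U by auto
  note a = smooth_family_alternating[OF \<eta> Fx]
  note dF = smooth_on_differentiable[OF U(1) U(2) U(4)]
  define H where "H u v = D (\<lambda>y. D F y v) x u" for u v
  have H: "H u v = H v u" for u v
    unfolding H_def by (rule second_derivative_symmetric_vector[OF U(1,2,4)])
  \<comment> \<open>an argument \<open>v\<close> replaced by the second derivative \<open>H u
    v\<close> and moved to the front\<close>
  define K where "K u v ws = \<eta> (F x) (H u v # map (D F x) ws)" for u v ws
  have Ksym: "K u v = K v u" for u v by (simp add: K_def H fun_eq_iff)
  have pdpull: "pd u (\<lambda>y vs. \<eta> (F y) (map (D F y) vs)) x ws
      = pd (D F x u) \<eta> (F x) (map (D F x) ws) + skew (K u) ws" for u ws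
  proof -
    have "((\<lambda>y. \<eta> (F y) (map (\<lambda>w. w y) (map (\<lambda>v y. D F y v) ws))) has_derivative
      (\<lambda>u. pd (D F x u) \<eta> (F x) (map (\<lambda>w. w x) (map (\<lambda>v y. D F y v) ws)) +
      (\<Sum>m<length (map (\<lambda>v y. D F y v) ws). \<eta> (F x) ((map (\<lambda>w. w x) (map (\<lambda>v y. D F y v) ws))
        [m := D (map (\<lambda>v y. D F y v) ws ! m) x u])))) (at x)"
      using smooth_on_differentiable[OF U(1) smooth_on_D[OF U(2)] U(4)]
      by (intro pull_has_derivative[OF S' \<eta> U(1,4,3) dF]) auto
    from D_eqI[OF this, of u]
    have "pd u (\<lambda>y vs. \<eta> (F y) (map (D F y) vs)) x ws = pd (D F x u) \<eta> (F x) (map (D F x) ws) +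
      (\<Sum>m<length ws. \<eta> (F x) ((map (D F x) ws)[m := H u (ws ! m)]))"
      by (simp add: pd_def o_def H_def)
    also have "(\<Sum>m<length ws. \<eta> (F x) ((map (D F x) ws)[m := H u (ws ! m)])) = skew (K u) ws"
      unfolding skew_def
    proof (rule sum.cong[OF refl])
      fix m assume m: "m \<in> {..<length ws}"
      then have "(map (D F x) ws)[m := H u (ws ! m)]
          = map (D F x) (take m ws) @ H u (ws ! m) # map (D F x) (drop (Suc m) ws)"
        by (simp add: upd_conv_take_nth_drop take_map drop_map)
      then show "\<eta> (F x) ((map (D F x) ws)[m := H u (ws ! m)])
          = (-1) ^ m * K u (ws ! m) (take m ws @ drop (Suc m) ws)"
        using m alternating_move[OF a, of "map (D F x) (take m ws)"] by (simp add: K_def)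
    qed
    finally show ?thesis .
  qed
  have "(\<lambda>u. pd u (\<lambda>y vs. \<eta> (F y) (map (D F y) vs)) x)
      = (\<lambda>u. (\<lambda>ws. pd (D F x u) \<eta> (F x) (map (D F x) ws)) + skew (K u))"
    by (intro ext) (simp only: pdpull plus_fun_apply)
  then have "dd (\<lambda>y vs. \<eta> (F y) (map (D F y) vs)) x vs
      = skew (\<lambda>u. (\<lambda>ws. pd (D F x u) \<eta> (F x) (map (D F x) ws)) + skew (K u)) vs"
    by (simp only: dd_def)
  also have "\<dots> = skew (\<lambda>u ws. pd (D F x u) \<eta> (F x) (map (D F x) ws)) vs"
    unfolding skew_add skew_skew[of K, OF Ksym] by (simp add: fun_app)
  also have "\<dots> = dd \<eta> (F x) (map (D F x) vs)"
    unfolding dd_def skew_def by (simp add: take_map drop_map)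
  finally show ?thesis .
qed

end

section \<open>Smooth families over a smooth symplectic family\<close>

locale symplectic_family = orthonormal_basis B for B :: "'e::real_inner set" +
  fixes S :: "'e set" and \<omega> :: "'e \<Rightarrow> 'e alt" and n :: nat
  assumes open_S: "open S" and smooth_\<omega>: "smooth_family S \<omega>"
    and symplectic: "x \<in> S \<Longrightarrow> symplectic_space B (\<omega> x) n"
begin

lemma smooth_family_Lk:
  assumes "smooth_family S \<alpha>" shows "smooth_family S (\<lambda>x. (((\<and>\<^sub>a) (\<omega> x)) ^^ k) (\<alpha> x))"
proof (induction k)
  case 0 then show ?case using assms by simp
next
  case (Suc k) then show ?case using smooth_family_wedge[OF open_S smooth_\<omega> Suc] by simp
qed

lemma volume_nonzero:
  assumes b: "distinct b" "set b = B" and x: "x \<in> S"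
  shows "(((\<and>\<^sub>a) (\<omega> x)) ^^ n) alt_unit b \<noteq> 0"
proof
  interpret symplectic_space B "\<omega> x" n by (rule symplectic[OF x])
  assume "\<omega>p n b = 0"
  then have "\<omega>p n = 0"
    using homog_\<omega>p[of n] card_basis by (intro top_form_zero[OF alternating_\<omega>p _ b]) auto
  then show False using \<omega>p_nonzero[of n] by simp
qed

lemma basis_list: obtains b where "distinct b" "set b = B"
  using finite_distinct_list[OF finite_basis] by blast

text \<open>Downward induction on the degree \<open>q = 2n - j\<close>. In the top degree,
  \<open>\<eta>\<close> is a smooth multiple of \<open>\<omega>\<^sup>n\<close>. Below,
  \<open>dual e \<and>\<^sub>a \<eta>\<close> is of the form
  \<open>L\<^bsup>k+1\<^esup>\<alpha>\<^sub>e\<close>, and the contraction of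
  \<open>L\<^bsup>k+1\<^esup>\<alpha>\<^sub>e\<close> with \<open>e\<close> has a factor
  \<open>L\<^sup>k\<close>; the sum over \<open>e\<close> of these contractions is a nonzero
  multiple of \<open>\<eta>\<close>. Smoothness is visible from the construction.\<close>

lemma Lk_surj_family:
  assumes "smooth_family S \<eta>" "\<And>x. x \<in> S \<Longrightarrow> homog q (\<eta> x)" "q + j = 2 * n" "n + k \<le> q"
  shows "\<exists>\<alpha>. smooth_family S \<alpha> \<and>
    (\<forall>x\<in>S. homog (q - 2 * k) (\<alpha> x) \<and> (((\<and>\<^sub>a) (\<omega> x)) ^^ k) (\<alpha> x) = \<eta> x)"
  using assms
proof (induction j arbitrary: q k \<eta>)
  case 0
  have q: "q = 2 * n" "k \<le> n" using 0 by auto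
  obtain b where b: "distinct b" "set b = B" by (rule basis_list)
  define u where "u x = (((\<and>\<^sub>a) (\<omega> x)) ^^ n) alt_unit b" for x
  define \<alpha> where "\<alpha> x = (\<eta> x b / u x) *\<^sub>R (((\<and>\<^sub>a) (\<omega> x)) ^^ (n - k)) alt_unit" for x
  note unit = smooth_family_const[OF open_S alternating_unit]
  have "smooth_family S \<alpha>"
    unfolding \<alpha>_def u_def using volume_nonzero[OF b]
    by (intro smooth_family_scale smooth_on_divide smooth_family_smooth[OF 0(1)] open_S
        smooth_family_smooth[OF smooth_family_Lk[OF unit]] smooth_family_Lk[OF unit])
  moreover have "homog (q - 2 * k) (\<alpha> x) \<and> (((\<and>\<^sub>a) (\<omega> x)) ^^ k) (\<alpha> x) = \<eta> x" if x: "x \<in> S" for x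
  proof
    interpret symplectic_space B "\<omega> x" n by (rule symplectic[OF x])
    have "q - 2 * k = 2 * (n - k)" using q by simp
    then show "homog (q - 2 * k) (\<alpha> x)" unfolding \<alpha>_def using homog_scale[OF homog_\<omega>p] by simp
    have "Lk k (\<alpha> x) = (\<eta> x b / u x) *\<^sub>R \<omega>p n"
      unfolding \<alpha>_def Lk_simps using q by (simp flip: funpow_add[THEN fun_cong, unfolded o_apply])
    moreover have "u x *\<^sub>R \<eta> x = \<eta> x b *\<^sub>R \<omega>p n"
      unfolding u_def using 0(2)[OF x] q(1) homog_\<omega>p[of n] card_basis
      by (intro top_form_eq[OF alternating_\<omega>p _ smooth_family_alternating[OF 0(1) x] _ b]) auto
    moreover have "u x \<noteq> 0" unfolding u_def by (rule volume_nonzero[OF b x])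
    ultimately show "Lk k (\<alpha> x) = \<eta> x"
      by (metis (no_types, lifting) divide_inverse_commute scaleR_left_imp_eq scaleR_scaleR
          right_inverse scaleR_one)
  qed
  ultimately show ?case by blast
next
  case (Suc j)
  have q: "q < 2 * n" "k < n" "Suc q + j = 2 * n" "n + Suc k \<le> Suc q" using Suc.prems by auto
  have "\<exists>\<alpha>. smooth_family S \<alpha> \<and> (\<forall>x\<in>S. homog (Suc q - 2 * Suc k) (\<alpha> x) \<and>
      (((\<and>\<^sub>a) (\<omega> x)) ^^ Suc k) (\<alpha> x) = dual e \<and>\<^sub>a \<eta> x)" for e
    using Suc.prems(1,2) q homog_wedge[OF homog_covector]
    by (intro Suc.IH smooth_family_wedge smooth_family_const open_S alternating_dual) fastforce+
  then obtain A where A: "\<And>e. smooth_family S (A e)"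
    and hA: "\<And>e x. x \<in> S \<Longrightarrow> homog (Suc q - 2 * Suc k) (A e x)"
    and LA: "\<And>e x. x \<in> S \<Longrightarrow> (((\<and>\<^sub>a) (\<omega> x)) ^^ Suc k) (A e x) = dual e \<and>\<^sub>a \<eta> x"
    by metis
  \<comment> \<open>the inverse of the factor in \<open>euler'\<close>\<close>
  define r where "r = 1 / (real (2 * n) - real q)"
  define \<alpha> where "\<alpha> x = r *\<^sub>R (\<Sum>e\<in>B. real (Suc k) *\<^sub>R (\<iota> e (\<omega> x) \<and>\<^sub>a A e x) + \<omega> x \<and>\<^sub>a \<iota> e (A e x))" for x
  have "smooth_family S \<alpha>"
    unfolding \<alpha>_def
    by (intro smooth_family_scale smooth_family_sum smooth_family_add smooth_family_wedge
        smooth_family_\<iota> smooth_on_const open_S smooth_\<omega> A)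
  moreover have "homog (q - 2 * k) (\<alpha> x) \<and> (((\<and>\<^sub>a) (\<omega> x)) ^^ k) (\<alpha> x) = \<eta> x" if x: "x \<in> S" for x
  proof
    interpret symplectic_space B "\<omega> x" n by (rule symplectic[OF x])
    define m where "m = Suc q - 2 * Suc k"
    have m: "q - 2 * k = 1 + m" "m + 1 = q - 2 * k" using q Suc.prems by (auto simp: m_def)
    note hA' = hA[OF x, folded m_def]
    have h2: "homog (q - 2 * k) (\<omega> x \<and>\<^sub>a \<iota> e (A e x))" for e
    proof (cases m)
      case 0
      then have "\<iota> e (A e x) = 0" using hA'[of e] homog_\<iota>_0 by simp
      then show ?thesis by (simp add: homog_zero)
    next
      case (Suc l)
      then have "homog (2 + l) (\<omega> x \<and>\<^sub>a \<iota> e (A e x))" using hA'[of e] by (intro homog_wedge homog_\<omega> homog_\<iota>) simp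
      then show ?thesis using Suc m by simp
    qed
    have h1: "homog (q - 2 * k) (\<iota> e (\<omega> x) \<and>\<^sub>a A e x)" for e
      unfolding m(1) \<iota>_\<omega> by (rule homog_wedge[OF homog_covector hA'])
    show "homog (q - 2 * k) (\<alpha> x)"
      unfolding \<alpha>_def by (intro homog_scale homog_sum homog_add h1 h2)
    have "Lk k (real (Suc k) *\<^sub>R (musical e \<and>\<^sub>a A e x) + L (\<iota> e (A e x))) = \<iota> e (dual e \<and>\<^sub>a \<eta> x)" for e
    proof -
      have "\<iota> e (dual e \<and>\<^sub>a \<eta> x) = real (Suc k) *\<^sub>R (musical e \<and>\<^sub>a Lk k (A e x)) + Lk (Suc k) (\<iota> e (A e x))"
        unfolding LA[OF x, symmetric] by (rule \<iota>_Lk)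
      then show ?thesis by (simp only: Lk_simps Lk_covector funpow_Suc_right o_apply)
    qed
    then have "Lk k (\<alpha> x) = r *\<^sub>R (\<Sum>e\<in>B. \<iota> e (dual e \<and>\<^sub>a \<eta> x))"
      unfolding \<alpha>_def \<iota>_\<omega> by (simp only: Lk_simps(3) linear_sum[OF linear_Lk])
    also have "\<dots> = \<eta> x"
      unfolding euler'[OF smooth_family_alternating[OF Suc.prems(1) x] Suc.prems(2)[OF x]]
      using q(1) by (simp add: r_def card_basis)
    finally show "Lk k (\<alpha> x) = \<eta> x" .
  qed
  ultimately show ?case by blast
qed

text \<open>Cramer's rule: contracting \<open>dual e' \<and>\<^sub>a \<omega>\<^sup>n = 0\<close>
  with \<open>T e\<close> expresses the component \<open>e' \<bullet> T e\<close> as a quotient of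
  two forms of top degree.\<close>

lemma smooth_T_component:
  assumes e: "e \<in> B" "e' \<in> B"
  shows "smooth_on S (\<lambda>x. e' \<bullet> symplectic_space.T (\<omega> x) e)"
proof -
  obtain b where b: "distinct b" "set b = B" by (rule basis_list)
  let ?p = "\<lambda>k x. (((\<and>\<^sub>a) (\<omega> x)) ^^ k) alt_unit"
  note unit = smooth_family_const[OF open_S alternating_unit]
  have "smooth_on S (\<lambda>x. real n * (dual e' \<and>\<^sub>a dual e \<and>\<^sub>a ?p (n - 1) x) b / ?p n x b)"
    using volume_nonzero[OF b]
    by (intro smooth_on_divide smooth_on_mult smooth_on_const open_S
        smooth_family_smooth[OF smooth_family_Lk[OF unit]] smooth_family_smooth
        smooth_family_wedge smooth_family_const alternating_dual smooth_family_Lk)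
      (auto intro: alternating_unit)
  moreover have "real n * (dual e' \<and>\<^sub>a dual e \<and>\<^sub>a ?p (n - 1) x) b / ?p n x b = e' \<bullet> symplectic_space.T (\<omega> x) e"
    if x: "x \<in> S" for x
  proof -
    interpret symplectic_space B "\<omega> x" n by (rule symplectic[OF x])
    have "card B \<noteq> 0" using e finite_basis by auto
    then have "n \<noteq> 0" using card_basis by simp
    then obtain m where m: "n = Suc m" by (cases n) auto
    have "dual e' \<and>\<^sub>a \<omega>p n = 0"
      using homog_wedge[OF homog_covector homog_\<omega>p[of n]] card_basis
      by (intro alternating_gt_dim[OF alternating_wedge[OF alternating_dual alternating_\<omega>p]]) auto
    then have "0 = \<iota> (T e) (dual e' \<and>\<^sub>a \<omega>p n)" by simp
    also have "\<dots> = (e' \<bullet> T e) *\<^sub>R \<omega>p n - real n *\<^sub>R (dual e' \<and>\<^sub>a dual e \<and>\<^sub>a \<omega>p m)"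
      unfolding \<iota>_covector_wedge m \<iota>_\<omega>p musical_T by simp
    finally have "(e' \<bullet> T e) *\<^sub>R \<omega>p n = real n *\<^sub>R (dual e' \<and>\<^sub>a dual e \<and>\<^sub>a \<omega>p m)" by simp
    from fun_cong[OF this, of b] show ?thesis
      using volume_nonzero[OF b x] by (simp add: fun_app m field_simps)
  qed
  ultimately show ?thesis by (rule smooth_on_cong[OF open_S, rotated])
qed

lemma smooth_sharp:
  assumes \<xi>: "smooth_family S \<xi>" and \<alpha>: "alternating \<alpha>"
  shows "smooth_on S (\<lambda>x. symplectic_space.sharp B (\<omega> x) (\<xi> x) \<alpha>)"
proof -
  have "smooth_on S (\<lambda>x. \<xi> x (map (symplectic_space.T (\<omega> x)) J))" if "J \<in> tuples m" for J m
  proof -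
    have "smooth_on S (\<lambda>x. \<xi> x (map (\<lambda>w. w x) (map (\<lambda>e x. symplectic_space.T (\<omega> x) e) J)))"
      using that smooth_T_component by (intro smooth_on_eval[OF open_S \<xi>]) (auto simp: tuples_def)
    then show ?thesis by (simp add: o_def)
  qed
  then have "smooth_on S (\<lambda>x. \<Sum>m\<le>card B. (-1) ^ m / fact m *
      (\<Sum>J\<in>tuples m. \<alpha> J * \<xi> x (map (symplectic_space.T (\<omega> x)) J)))"
    by (intro smooth_on_sum smooth_on_mult smooth_on_const open_S)
  then show ?thesis
    by (rule smooth_on_cong[OF open_S, rotated]) (simp add: symplectic_space.sharp_def[OF symplectic] \<alpha>)
qed

end

section \<open>Orthonormal bases of the model space\<close>

text \<open>Gram-Schmidt; zero vectors are discarded before normalization.\<close>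

lemma orthonormal_basis_exists:
  assumes "has_dimension TYPE('e::real_inner) m"
  obtains B :: "'e::real_inner set" where "orthonormal_basis B" "card B = m"
proof -
  obtain B0 :: "'e set" where B0: "finite B0" "independent B0" "span B0 = UNIV" "card B0 = m"
    using assms by (auto simp: has_dimension_def)
  obtain C :: "'e set" where C: "finite C" "span C = span B0" "pairwise orthogonal C"
    using basis_orthogonal[OF B0(1)] by blast
  define B where "B = (\<lambda>x. (1 / norm x) *\<^sub>R x) ` (C - {0})"
  have fin: "finite B" using C(1) by (simp add: B_def)
  have on: "e \<bullet> e' = (if e = e' then 1 else 0)" if ee: "e \<in> B" "e' \<in> B" for e e'
  proof -
    obtain x y where x: "x \<in> C" "x \<noteq> 0" "e = (1 / norm x) *\<^sub>R x"
      and y: "y \<in> C" "y \<noteq> 0" "e' = (1 / norm y) *\<^sub>R y" using ee by (auto simp: B_def)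
    show ?thesis
    proof (cases "x = y")
      case True then show ?thesis using x y by (simp add: dot_square_norm power2_eq_square)
    next
      case False
      then have "x \<bullet> y = 0" using C(3) x(1) y(1) by (auto simp: pairwise_def orthogonal_def)
      then have 0: "e \<bullet> e' = 0" using x y by simp
      moreover have "e \<noteq> e'"
      proof
        assume "e = e'"
        then have "e \<bullet> e = 0" using 0 by simp
        then show False using x by simp
      qed
      ultimately show ?thesis by simp
    qed
  qed
  have "C \<subseteq> span B"
  proof
    fix x assume x: "x \<in> C"
    show "x \<in> span B"
    proof (cases "x = 0")
      case False
      then have "norm x *\<^sub>R ((1 / norm x) *\<^sub>R x) \<in> span B"
        using x by (intro span_scale span_base) (auto simp: B_def)
      then show ?thesis using False by simp
    qed (simp add: span_zero)
  qed
  then have "span C \<subseteq> span B" using span_minimal subspace_span by blast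
  then have spB: "span B = UNIV" using B0(3) C(2) by auto
  have expand: "x = (\<Sum>e\<in>B. (e \<bullet> x) *\<^sub>R e)" for x
  proof -
    obtain u where u: "x = (\<Sum>e\<in>B. u e *\<^sub>R e)"
      using spB span_finite[OF fin] by (metis (no_types, lifting) UNIV_I imageE)
    have "e \<bullet> x = u e" if e: "e \<in> B" for e
    proof -
      have "e \<bullet> x = (\<Sum>e'\<in>B. if e' = e then u e else 0)"
        unfolding u inner_sum_right using e by (intro sum.cong refl) (auto simp: on)
      then show ?thesis using e fin by simp
    qed
    then show ?thesis using u by simp
  qed
  have onb: "orthonormal_basis B" using fin on expand by unfold_locales
  then interpret orthonormal_basis B .
  have "card B = dim (UNIV :: 'e set)" "card B0 = dim (UNIV :: 'e set)"
    using dim_eq_card[of B UNIV] dim_eq_card[of B0 UNIV] independent_basis spB B0 by auto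
  then show ?thesis using that[OF onb] B0(4) by simp
qed

section \<open>Naturality of the sharp map\<close>

lemma cprod_pull: "(\<lambda>vs. cprod fs (map E vs)) = cprod (map (\<lambda>f v. f (E v)) fs)"
proof (induction fs)
  case Nil show ?case by (simp add: alt_unit_def fun_eq_iff)
next
  case (Cons f fs)
  have "(\<lambda>vs. covector f (map E vs)) = covector (\<lambda>v. f (E v))"
    by (rule ext) (auto simp: covector_def length_Suc_conv)
  then show ?case by (simp add: pull_wedge Cons)
qed

text \<open>Pushing the multivector \<open>sharp \<xi>\<close> forward along \<open>E\<close>
  gives a multivector with image \<open>\<xi>'\<close> under \<open>\<flat>\<close>, so uniqueness
  of preimages applies. The map \<open>E\<close> is invertible because it preserves the symplectic
  forms.\<close>

lemma sharp_natural:
  fixes B :: "'e::real_inner set"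
  assumes s1: "symplectic_space B \<omega> n" and s2: "symplectic_space B \<omega>' n" and E: "linear E"
    and \<omega>: "\<omega> = (\<lambda>vs. \<omega>' (map E vs))" and \<xi>: "\<xi> = (\<lambda>vs. \<xi>' (map E vs))"
    and alt: "alternating \<xi>'" "alternating \<alpha>"
  shows "symplectic_space.sharp B \<omega>' \<xi>' \<alpha> = symplectic_space.sharp B \<omega> \<xi> (\<lambda>vs. \<alpha> (map E vs))"
proof -
  interpret s1: symplectic_space B \<omega> n by (rule s1)
  interpret s2: symplectic_space B \<omega>' n by (rule s2)
  have \<omega>E: "\<omega> [v, w] = \<omega>' [E v, E w]" for v w by (simp add: \<omega>)
  have "v = 0" if "E v = 0" for v
  proof (rule s1.nondeg)
    show "\<omega> [v, w] = 0" for w using that linear_0[OF s2.linear_\<omega>(2)] by (simp add: \<omega>E)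
  qed
  then have surj: "surj E" by (rule s1.inj_imp_surj[OF E])
  let ?P = "s1.sharp \<xi>"
  let ?Q = "\<lambda>\<alpha>. if alternating \<alpha> then ?P (\<lambda>vs. \<alpha> (map E vs)) else 0"
  note P = s1.multivector_sharp[of \<xi>]
  have altE: "alternating (\<lambda>vs. \<alpha> (map E vs))" if "alternating \<alpha>" for \<alpha> :: "'e alt"
    using alternating_pull[OF that E] .
  have Q: "multivector ?Q"
    unfolding multivector_def
  proof (intro conjI allI impI)
    fix \<alpha> \<beta> :: "'e alt" assume ab: "alternating \<alpha> \<and> alternating \<beta>"
    have "alternating (\<lambda>vs. \<alpha> vs + \<beta> vs)" using ab alternating_add unfolding plus_fun_def by blast
    moreover have "?P (\<lambda>xs. \<alpha> (map E xs) + \<beta> (map E xs)) = ?P (\<lambda>xs. \<alpha> (map E xs)) + ?P (\<lambda>xs. \<beta> (map E xs))"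
      using multivector_add[OF P altE altE] ab unfolding plus_fun_def by simp
    ultimately show "?Q (\<lambda>vs. \<alpha> vs + \<beta> vs) = ?Q \<alpha> + ?Q \<beta>" using ab by simp
  next
    fix r and \<alpha> :: "'e alt" assume a: "alternating \<alpha>"
    have "alternating (\<lambda>vs. r * \<alpha> vs)" using alternating_scale[OF a, of r] unfolding scaleR_fun_def by simp
    moreover have "?P (\<lambda>xs. r * \<alpha> (map E xs)) = r * ?P (\<lambda>xs. \<alpha> (map E xs))"
      using multivector_scale[OF P altE[OF a]] unfolding scaleR_fun_def by simp
    ultimately show "?Q (\<lambda>vs. r * \<alpha> vs) = r * ?Q \<alpha>" using a by simp
  qed auto
  have "flat_alt \<omega>' ?Q = \<xi>'"
  proof
    fix ys
    obtain zs where ys: "ys = map E zs" using surj by (metis ex_map_conv surjD)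
    have "flat_alt \<omega>' ?Q ys = ?P (\<lambda>vs. s2.fprod (map E vs) ys)"
      unfolding s2.flat_alt_fprod using s2.alternating_fprod_left by simp
    also have "(\<lambda>vs. s2.fprod (map E vs) ys) = (\<lambda>vs. s1.fprod vs zs)"
      unfolding ys using fun_cong[OF cprod_pull, of _ E zs] by (simp add: o_def \<omega>E)
    also have "?P \<dots> = \<xi> zs"
      using fun_cong[OF s1.flat_sharp, of \<xi> zs] altE[OF alt(1)] unfolding s1.flat_alt_fprod \<xi> by simp
    finally show "flat_alt \<omega>' ?Q ys = \<xi>' ys" by (simp add: \<xi> ys)
  qed
  then have "?Q = s2.sharp \<xi>'"
    using s2.flat_alt_inj[OF Q s2.multivector_sharp] s2.flat_sharp[OF alt(1)] by simp
  from fun_cong[OF this, of \<alpha>] show ?thesis using alt(2) by simp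
qed

section \<open>Invariant forms on a symplectic manifold\<close>

locale lefschetz_manifold =
  fixes X :: "'a topology" and A :: "('a, 'e::real_inner) chart set"
    and \<Gamma> :: "'a local_map set" and \<omega> :: "('a, 'e) form" and n :: nat and B :: "'e set"
  assumes manifold: "smooth_manifold (2 * n) X A"
    and pseudogroup: "pseudogroup X A \<Gamma>"
    and inv_symplectic: "inv_symplectic A \<Gamma> \<omega>"
    and onb: "orthonormal_basis B" and card_B: "card B = 2 * n"
begin

sublocale orthonormal_basis B by (rule onb)

abbreviation coord_range :: "('a, 'e) chart \<Rightarrow> 'e set" where "coord_range c \<equiv> snd c ` fst c"

lemma chart:
  assumes "c \<in> A"
  shows "openin X (fst c)" "open (coord_range c)"
    "homeomorphic_map (subtopology X (fst c)) (top_of_set (coord_range c)) (snd c)"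
  using manifold assms unfolding smooth_manifold_def by (auto simp: case_prod_beta)

lemma chart_inj: assumes "c \<in> A" shows "inj_on (snd c) (fst c)"
  using homeomorphic_imp_injective_map[OF chart(3)[OF assms]] openin_subset[OF chart(1)[OF assms]]
  by (simp add: Int_absorb1)

lemma chart_inv: "c \<in> A \<Longrightarrow> q \<in> fst c \<Longrightarrow> chart_inv c (snd c q) = q"
  unfolding chart_inv_def by (rule inv_into_f_f[OF chart_inj])

lemma chart_open_image:
  assumes c: "c \<in> A" and W: "openin X W" "W \<subseteq> fst c" shows "open (snd c ` W)"
proof -
  have "openin (subtopology X (fst c)) W" using W by (simp add: openin_open_subtopology[OF chart(1)[OF c]])
  then have "openin (top_of_set (coord_range c)) (snd c ` W)"
    using homeomorphic_imp_open_map[OF chart(3)[OF c]] by (simp add: open_map_def)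
  then show ?thesis using chart(2)[OF c] openin_open_trans by blast
qed

lemma in_chart_iff: "in_chart A c x \<longleftrightarrow> c \<in> A \<and> x \<in> coord_range c"
  by (simp add: in_chart_def)

text \<open>The compatibility of local representatives in different charts is treated as invariance
  under the identity.\<close>

definition transitions :: "'a local_map set" where "transitions = insert (UNIV, id) \<Gamma>"

lemma transition_domain:
  assumes g: "(U, f) \<in> transitions" and c: "c \<in> A" "c' \<in> A"
  shows "openin X (U \<inter> fst c \<inter> f -` fst c')"
    "smooth_on (snd c ` (U \<inter> fst c \<inter> f -` fst c')) (snd c' \<circ> f \<circ> chart_inv c)"
proof -
  have "openin X (U \<inter> fst c \<inter> f -` fst c') \<and>
    smooth_on (snd c ` (U \<inter> fst c \<inter> f -` fst c')) (snd c' \<circ> f \<circ> chart_inv c)"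
  proof (cases "(U, f) \<in> \<Gamma>")
    case True
    then have ld: "local_diffeo X A (U, f)" using pseudogroup by (auto simp: pseudogroup_def)
    have sm: "smooth_on (snd c ` (U \<inter> fst c \<inter> f -` fst c')) (snd c' \<circ> f \<circ> chart_inv c)"
      using ld c unfolding local_diffeo_def smooth_map_def by (auto simp: case_prod_beta)
    have U: "openin X U" "openin X (f ` U)" and hf: "homeomorphic_map (subtopology X U) (subtopology X (f ` U)) f"
      using ld by (auto simp: local_diffeo_def)
    have V: "openin (subtopology X (f ` U)) (f ` U \<inter> fst c')"
      using chart(1)[OF c(2)] by (simp add: openin_open_subtopology[OF U(2)] openin_Int U(2))
    have "openin (subtopology X U) {x \<in> topspace (subtopology X U). f x \<in> f ` U \<inter> fst c'}"
      by (rule openin_continuous_map_preimage[OF homeomorphic_imp_continuous_map[OF hf] V])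
    also have "{x \<in> topspace (subtopology X U). f x \<in> f ` U \<inter> fst c'} = U \<inter> f -` fst c'"
      using openin_subset[OF U(1)] by auto
    finally have "openin X (U \<inter> f -` fst c')" by (simp add: openin_open_subtopology[OF U(1)])
    then have "openin X ((U \<inter> f -` fst c') \<inter> fst c)" using chart(1)[OF c(1)] by (rule openin_Int)
    then show ?thesis using sm by (simp add: Int_ac)
  next
    case False
    then have Uf: "U = UNIV" "f = id" using g by (auto simp: transitions_def)
    have "smooth_on (snd c ` (fst c \<inter> fst c')) (snd c' \<circ> chart_inv c)"
      using manifold c unfolding smooth_manifold_def by (auto simp: case_prod_beta)
    then show ?thesis using chart(1) c by (simp add: Uf openin_Int)
  qed
  then show "openin X (U \<inter> fst c \<inter> f -` fst c')"
    "smooth_on (snd c ` (U \<inter> fst c \<inter> f -` fst c')) (snd c' \<circ> f \<circ> chart_inv c)" by auto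
qed

lemma form_preserved_iff:
  "form_preserved A (U, f) \<xi> \<longleftrightarrow> (\<forall>c\<in>A. \<forall>c'\<in>A. \<forall>p\<in>U. p \<in> fst c \<and> f p \<in> fst c' \<longrightarrow>
     \<xi> c (snd c p) = (\<lambda>vs. \<xi> c' (snd c' (f p)) (map (coord_deriv c c' f p) vs)))"
  by (simp add: form_preserved_def fun_eq_iff)

text \<open>Near the image of \<open>p\<close>, a local map is in coordinates a smooth map
  \<open>F\<close> between open sets, and invariance of a form is invariance under pullback by
  \<open>F\<close>.\<close>

lemma transition:
  assumes g: "(U, f) \<in> transitions" and c: "c \<in> A" "c' \<in> A" and p: "p \<in> U" "p \<in> fst c" "f p \<in> fst c'"
  obtains N F where "open N" "snd c p \<in> N" "smooth_on N F" "F ` N \<subseteq> coord_range c'" "N \<subseteq> coord_range c"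
    "F (snd c p) = snd c' (f p)" "coord_deriv c c' f p = D F (snd c p)"
    "\<And>\<xi> y. form_preserved A (U, f) \<xi> \<Longrightarrow> y \<in> N \<Longrightarrow> \<xi> c y = (\<lambda>vs. \<xi> c' (F y) (map (D F y) vs))"
proof -
  define W where "W = U \<inter> fst c \<inter> f -` fst c'"
  define F where "F = snd c' \<circ> f \<circ> chart_inv c"
  have Fq: "F (snd c q) = snd c' (f q)" if "q \<in> W" for q
    using that chart_inv[OF c(1)] by (simp add: F_def W_def)
  show ?thesis
  proof (rule that[of "snd c ` W" F])
    show "open (snd c ` W)"
      using transition_domain(1)[OF g c] by (intro chart_open_image[OF c(1)]) (auto simp: W_def)
    show "smooth_on (snd c ` W) F" unfolding W_def F_def by (rule transition_domain(2)[OF g c])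
    show "snd c p \<in> snd c ` W" using p by (auto simp: W_def)
    show "F ` (snd c ` W) \<subseteq> coord_range c'" using Fq by (auto simp: W_def)
    show "snd c ` W \<subseteq> coord_range c" by (auto simp: W_def)
    show "F (snd c p) = snd c' (f p)" using p by (intro Fq) (simp add: W_def)
    show cd: "coord_deriv c c' f p = D F (snd c p)" by (simp add: coord_deriv_def F_def)
    fix \<xi> y assume \<xi>: "form_preserved A (U, f) \<xi>" and "y \<in> snd c ` W"
    then obtain q where q: "q \<in> W" "y = snd c q" by blast
    have "\<xi> c (snd c q) = (\<lambda>vs. \<xi> c' (snd c' (f q)) (map (coord_deriv c c' f q) vs))"
      using \<xi> q(1) c unfolding form_preserved_iff W_def by auto
    then show "\<xi> c y = (\<lambda>vs. \<xi> c' (F y) (map (D F y) vs))"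
      unfolding q(2) Fq[OF q(1)] by (simp add: coord_deriv_def F_def)
  qed
qed

lemma transition_linear:
  assumes g: "(U, f) \<in> transitions" and c: "c \<in> A" "c' \<in> A" and p: "p \<in> U" "p \<in> fst c" "f p \<in> fst c'"
  shows "linear (coord_deriv c c' f p)"
proof -
  obtain N F where "open N" "snd c p \<in> N" "smooth_on N F" "coord_deriv c c' f p = D F (snd c p)"
    by (rule transition[OF assms]) blast
  then show ?thesis using linear_frechet_derivative[OF smooth_on_differentiable] by metis
qed

lemma inv_forms_iff:
  "\<xi> \<in> inv_forms A \<Gamma> \<longleftrightarrow> (\<forall>c x. \<not> in_chart A c x \<longrightarrow> \<xi> c x = 0) \<and>
     (\<forall>c\<in>A. smooth_family (coord_range c) (\<xi> c)) \<and> (\<forall>U f. (U, f) \<in> transitions \<longrightarrow> form_preserved A (U, f) \<xi>)"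
  unfolding inv_forms_def forms_def transitions_def smooth_family_def in_chart_iff zero_fun_def
  by (auto split: if_splits)

lemma inv_forms_outside: "\<xi> \<in> inv_forms A \<Gamma> \<Longrightarrow> \<not> in_chart A c x \<Longrightarrow> \<xi> c x = 0"
  and inv_forms_smooth: "\<xi> \<in> inv_forms A \<Gamma> \<Longrightarrow> c \<in> A \<Longrightarrow> smooth_family (coord_range c) (\<xi> c)"
  and inv_forms_preserved: "\<xi> \<in> inv_forms A \<Gamma> \<Longrightarrow> (U, f) \<in> transitions \<Longrightarrow> form_preserved A (U, f) \<xi>"
  unfolding inv_forms_iff by blast+

lemma inv_forms_alternating: "\<xi> \<in> inv_forms A \<Gamma> \<Longrightarrow> in_chart A c x \<Longrightarrow> alternating (\<xi> c x)"
  by (metis in_chart_iff inv_forms_smooth smooth_family_alternating)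

lemma inv_forms_pull:
  assumes "\<xi> \<in> inv_forms A \<Gamma>" "(U, f) \<in> transitions" "c \<in> A" "c' \<in> A" "p \<in> U" "p \<in> fst c" "f p \<in> fst c'"
  shows "\<xi> c (snd c p) = (\<lambda>vs. \<xi> c' (snd c' (f p)) (map (coord_deriv c c' f p) vs))"
  using inv_forms_preserved[OF assms(1,2)] assms(3-) unfolding form_preserved_iff by blast

lemma inv_formsI:
  assumes "\<And>c x. \<not> in_chart A c x \<Longrightarrow> \<xi> c x = 0"
    and "\<And>c. c \<in> A \<Longrightarrow> smooth_family (coord_range c) (\<xi> c)"
    and "\<And>U f c c' p. (U, f) \<in> transitions \<Longrightarrow> c \<in> A \<Longrightarrow> c' \<in> A \<Longrightarrow> p \<in> U \<Longrightarrow> p \<in> fst c \<Longrightarrow> f p \<in> fst c' \<Longrightarrow>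
       \<xi> c (snd c p) = (\<lambda>vs. \<xi> c' (snd c' (f p)) (map (coord_deriv c c' f p) vs))"
  shows "\<xi> \<in> inv_forms A \<Gamma>"
  unfolding inv_forms_iff form_preserved_iff using assms by blast

lemma inv_forms_zero: "0 \<in> inv_forms A \<Gamma>"
proof (rule inv_formsI)
  have "(0 :: ('a, 'e) form) c = (\<lambda>x. 0)" for c by (simp add: zero_fun_def)
  then show "smooth_family (coord_range c) (0 c)" if "c \<in> A" for c
    using smooth_family_const[OF chart(2)[OF that] alternating_zero] by simp
qed (simp_all add: zero_fun_def)

lemma inv_forms_add: "\<xi> \<in> inv_forms A \<Gamma> \<Longrightarrow> \<zeta> \<in> inv_forms A \<Gamma> \<Longrightarrow> \<xi> + \<zeta> \<in> inv_forms A \<Gamma>"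
proof (rule inv_formsI)
  assume \<xi>: "\<xi> \<in> inv_forms A \<Gamma>" and \<zeta>: "\<zeta> \<in> inv_forms A \<Gamma>"
  show "(\<xi> + \<zeta>) c x = 0" if "\<not> in_chart A c x" for c x
    using inv_forms_outside[OF \<xi> that] inv_forms_outside[OF \<zeta> that] by (simp add: plus_fun_apply)
  have eq: "(\<xi> + \<zeta>) c = (\<lambda>x. \<xi> c x + \<zeta> c x)" for c by (simp add: fun_eq_iff plus_fun_apply)
  show "smooth_family (coord_range c) ((\<xi> + \<zeta>) c)" if "c \<in> A" for c
    unfolding eq using that \<xi> \<zeta> by (intro smooth_family_add chart inv_forms_smooth)
  show "(\<xi> + \<zeta>) c (snd c p) = (\<lambda>vs. (\<xi> + \<zeta>) c' (snd c' (f p)) (map (coord_deriv c c' f p) vs))"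
    if t: "(U, f) \<in> transitions" "c \<in> A" "c' \<in> A" "p \<in> U" "p \<in> fst c" "f p \<in> fst c'" for U f c c' p
    using inv_forms_pull[OF \<xi> t] inv_forms_pull[OF \<zeta> t] by (simp add: plus_fun_def)
qed

lemma inv_forms_scale: "\<xi> \<in> inv_forms A \<Gamma> \<Longrightarrow> r *\<^sub>R \<xi> \<in> inv_forms A \<Gamma>"
proof (rule inv_formsI)
  assume \<xi>: "\<xi> \<in> inv_forms A \<Gamma>"
  show "(r *\<^sub>R \<xi>) c x = 0" if "\<not> in_chart A c x" for c x
    using inv_forms_outside[OF \<xi> that] by (simp add: scaleR_fun_apply)
  have eq: "(r *\<^sub>R \<xi>) c = (\<lambda>x. r *\<^sub>R \<xi> c x)" for c by (simp add: fun_eq_iff scaleR_fun_apply)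
  show "smooth_family (coord_range c) ((r *\<^sub>R \<xi>) c)" if "c \<in> A" for c
    unfolding eq using that \<xi> by (intro smooth_family_scale smooth_on_const chart inv_forms_smooth)
  show "(r *\<^sub>R \<xi>) c (snd c p) = (\<lambda>vs. (r *\<^sub>R \<xi>) c' (snd c' (f p)) (map (coord_deriv c c' f p) vs))"
    if t: "(U, f) \<in> transitions" "c \<in> A" "c' \<in> A" "p \<in> U" "p \<in> fst c" "f p \<in> fst c'" for U f c c' p
    using inv_forms_pull[OF \<xi> t] by (simp add: scaleR_fun_def)
qed

lemma inv_forms_wedge:
  assumes \<xi>: "\<xi> \<in> inv_forms A \<Gamma>" and \<zeta>: "\<zeta> \<in> inv_forms A \<Gamma>"
  shows "form_wedge \<xi> \<zeta> \<in> inv_forms A \<Gamma>"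
proof (rule inv_formsI)
  show "form_wedge \<xi> \<zeta> c x = 0" if "\<not> in_chart A c x" for c x
    using inv_forms_outside[OF \<xi> that] by (simp add: form_wedge_def)
  have eq: "form_wedge \<xi> \<zeta> c = (\<lambda>x. \<xi> c x \<and>\<^sub>a \<zeta> c x)" for c by (simp add: fun_eq_iff form_wedge_def)
  show "smooth_family (coord_range c) (form_wedge \<xi> \<zeta> c)" if "c \<in> A" for c
    unfolding eq using that \<xi> \<zeta> by (intro smooth_family_wedge chart inv_forms_smooth)
  show "form_wedge \<xi> \<zeta> c (snd c p) = (\<lambda>vs. form_wedge \<xi> \<zeta> c' (snd c' (f p)) (map (coord_deriv c c' f p) vs))"
    if t: "(U, f) \<in> transitions" "c \<in> A" "c' \<in> A" "p \<in> U" "p \<in> fst c" "f p \<in> fst c'" for U f c c' p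
    unfolding form_wedge_def pull_wedge inv_forms_pull[OF \<xi> t] inv_forms_pull[OF \<zeta> t] ..
qed

lemma form_component_apply: "form_component p \<xi> c x = component p (\<xi> c x)"
  by (simp add: form_component_def component_def fun_eq_iff)

lemma inv_forms_component:
  assumes \<xi>: "\<xi> \<in> inv_forms A \<Gamma>" shows "form_component k \<xi> \<in> inv_forms A \<Gamma>"
proof (rule inv_formsI)
  show "form_component k \<xi> c x = 0" if "\<not> in_chart A c x" for c x
    using inv_forms_outside[OF \<xi> that] by (simp add: form_component_def fun_eq_iff fun_app)
  show "smooth_family (coord_range c) (form_component k \<xi> c)" if c: "c \<in> A" for c
    unfolding smooth_family_def
  proof (intro conjI ballI allI)
    show "alternating (form_component k \<xi> c x)" if "x \<in> coord_range c" for x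
      unfolding form_component_apply using inv_forms_alternating[OF \<xi>] c that
      by (intro alternating_component') (auto simp: in_chart_iff)
    show "smooth_on (coord_range c) (\<lambda>x. form_component k \<xi> c x vs)" for vs
      unfolding form_component_def
      using smooth_family_smooth[OF inv_forms_smooth[OF \<xi> c]] smooth_on_const[OF chart(2)[OF c]]
      by (cases "length vs = k") simp_all
  qed
  show "form_component k \<xi> c (snd c p) = (\<lambda>vs. form_component k \<xi> c' (snd c' (f p)) (map (coord_deriv c c' f p) vs))"
    if t: "(U, f) \<in> transitions" "c \<in> A" "c' \<in> A" "p \<in> U" "p \<in> fst c" "f p \<in> fst c'" for U f c c' p
    unfolding form_component_def[abs_def] using inv_forms_pull[OF \<xi> t] by (auto simp: fun_eq_iff)
qed

lemma inv_forms_sum: "(\<And>i. i \<in> I \<Longrightarrow> f i \<in> inv_forms A \<Gamma>) \<Longrightarrow> (\<Sum>i\<in>I. f i) \<in> inv_forms A \<Gamma>"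
  by (induction I rule: infinite_finite_induct) (auto intro: inv_forms_zero inv_forms_add)

lemma inv_forms_deg_iff:
  "\<xi> \<in> inv_forms_deg A \<Gamma> p \<longleftrightarrow> \<xi> \<in> inv_forms A \<Gamma> \<and> (\<forall>c x. homog p (\<xi> c x))"
  by (auto simp: inv_forms_deg_def homog_def)

lemma inv_forms_degD: "\<xi> \<in> inv_forms_deg A \<Gamma> p \<Longrightarrow> \<xi> \<in> inv_forms A \<Gamma>"
  and inv_forms_deg_homog: "\<xi> \<in> inv_forms_deg A \<Gamma> p \<Longrightarrow> homog p (\<xi> c x)"
  unfolding inv_forms_deg_iff by blast+

lemma component_deg: "\<xi> \<in> inv_forms A \<Gamma> \<Longrightarrow> form_component p \<xi> \<in> inv_forms_deg A \<Gamma> p"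
  by (simp add: inv_forms_deg_iff inv_forms_component form_component_apply homog_component)

lemma sum_form_components:
  assumes "\<xi> \<in> inv_forms A \<Gamma>" shows "(\<Sum>p\<le>2 * n. form_component p \<xi>) = \<xi>"
proof (intro ext)
  fix c x vs
  have "(\<Sum>p\<le>2 * n. form_component p \<xi>) c x vs = (\<Sum>p\<le>2 * n. component p (\<xi> c x)) vs"
    by (simp add: sum_fun_apply form_component_apply)
  also have "\<dots> = \<xi> c x vs"
  proof (cases "in_chart A c x")
    case True
    then show ?thesis using sum_components[OF inv_forms_alternating[OF assms True]] by (simp add: card_B)
  next
    case False
    then show ?thesis using inv_forms_outside[OF assms False] by (simp add: component_def sum_fun_apply fun_app)
  qed
  finally show "(\<Sum>p\<le>2 * n. form_component p \<xi>) c x vs = \<xi> c x vs" .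
qed

subsection \<open>The exterior derivative\<close>

lemma ext_d_in: "in_chart A c x \<Longrightarrow> ext_d A \<xi> c x = dd (\<xi> c) x"
  by (simp add: fun_eq_iff ext_d_def dd_def skew_def pd_def)

lemma ext_d_out: "\<not> in_chart A c x \<Longrightarrow> ext_d A \<xi> c x = 0"
  by (simp add: fun_eq_iff ext_d_def fun_app)

lemma form_eqI:
  assumes "\<And>c x. in_chart A c x \<Longrightarrow> \<xi> c x = \<zeta> c x" "\<And>c x. \<not> in_chart A c x \<Longrightarrow> \<xi> c x = \<zeta> c x"
  shows "\<xi> = \<zeta>"
  by (intro ext) (metis assms)

lemma ext_d_add:
  assumes "\<xi> \<in> inv_forms A \<Gamma>" "\<zeta> \<in> inv_forms A \<Gamma>"
  shows "ext_d A (\<xi> + \<zeta>) = ext_d A \<xi> + ext_d A \<zeta>"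
proof (rule form_eqI)
  fix c x assume i: "in_chart A c x"
  then have c: "c \<in> A" "x \<in> coord_range c" by (auto simp: in_chart_iff)
  have "(\<xi> + \<zeta>) c = (\<lambda>x. \<xi> c x + \<zeta> c x)" by (simp add: fun_eq_iff plus_fun_apply)
  then show "ext_d A (\<xi> + \<zeta>) c x = (ext_d A \<xi> + ext_d A \<zeta>) c x"
    using dd_add[OF chart(2)[OF c(1)] inv_forms_smooth[OF assms(1) c(1)] inv_forms_smooth[OF assms(2) c(1)] c(2)]
    by (simp add: ext_d_in[OF i] plus_fun_apply[of "ext_d A \<xi>"] plus_fun_apply[of "ext_d A \<xi> c"])
qed (simp add: ext_d_out plus_fun_apply)

lemma ext_d_scale:
  assumes "\<xi> \<in> inv_forms A \<Gamma>" shows "ext_d A (r *\<^sub>R \<xi>) = r *\<^sub>R ext_d A \<xi>"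
proof (rule form_eqI)
  fix c x assume i: "in_chart A c x"
  then have c: "c \<in> A" "x \<in> coord_range c" by (auto simp: in_chart_iff)
  have "(r *\<^sub>R \<xi>) c = (\<lambda>x. r *\<^sub>R \<xi> c x)" by (simp add: fun_eq_iff scaleR_fun_apply)
  then show "ext_d A (r *\<^sub>R \<xi>) c x = (r *\<^sub>R ext_d A \<xi>) c x"
    using dd_scale[OF chart(2)[OF c(1)] inv_forms_smooth[OF assms(1) c(1)] c(2)]
    by (simp add: ext_d_in[OF i] scaleR_fun_apply[of r "ext_d A \<xi>"] scaleR_fun_apply[of r "ext_d A \<xi> c"])
qed (simp add: ext_d_out scaleR_fun_apply)

lemma ext_d_zero: "ext_d A 0 = 0"
  using ext_d_scale[OF inv_forms_zero, of 0] by simp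

lemma ext_d_sum:
  "(\<And>i. i \<in> I \<Longrightarrow> f i \<in> inv_forms A \<Gamma>) \<Longrightarrow> ext_d A (\<Sum>i\<in>I. f i) = (\<Sum>i\<in>I. ext_d A (f i))"
  by (induction I rule: infinite_finite_induct) (simp_all add: ext_d_zero ext_d_add inv_forms_sum)

lemma ext_d_inv_forms:
  assumes \<xi>: "\<xi> \<in> inv_forms A \<Gamma>" shows "ext_d A \<xi> \<in> inv_forms A \<Gamma>"
proof (rule inv_formsI)
  show "ext_d A \<xi> c x = 0" if "\<not> in_chart A c x" for c x by (rule ext_d_out[OF that])
  show "smooth_family (coord_range c) (ext_d A \<xi> c)" if c: "c \<in> A" for c
    by (rule smooth_family_cong[OF chart(2)[OF c] _ smooth_family_dd[OF chart(2)[OF c] inv_forms_smooth[OF \<xi> c]]])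
      (simp add: ext_d_in in_chart_iff c)
  show "ext_d A \<xi> c (snd c p) = (\<lambda>vs. ext_d A \<xi> c' (snd c' (f p)) (map (coord_deriv c c' f p) vs))"
    if t: "(U, f) \<in> transitions" "c \<in> A" "c' \<in> A" "p \<in> U" "p \<in> fst c" "f p \<in> fst c'" for U f c c' p
  proof -
    obtain N F where N: "open N" "snd c p \<in> N" "smooth_on N F" "F ` N \<subseteq> coord_range c'" "N \<subseteq> coord_range c"
      "F (snd c p) = snd c' (f p)" "coord_deriv c c' f p = D F (snd c p)"
      and pull: "\<And>\<xi> y. form_preserved A (U, f) \<xi> \<Longrightarrow> y \<in> N \<Longrightarrow> \<xi> c y = (\<lambda>vs. \<xi> c' (F y) (map (D F y) vs))"
      by (rule transition[OF t]) blast
    have "dd (\<xi> c) (snd c p) = dd (\<lambda>y vs. \<xi> c' (F y) (map (D F y) vs)) (snd c p)"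
      by (rule dd_cong[OF N(1,2)]) (rule pull[OF inv_forms_preserved[OF \<xi> t(1)]])
    also have "\<dots> = (\<lambda>vs. dd (\<xi> c') (snd c' (f p)) (map (coord_deriv c c' f p) vs))"
      using dd_pull[OF N(1,3,4,2) chart(2)[OF t(3)] inv_forms_smooth[OF \<xi> t(3)]]
      by (simp add: fun_eq_iff N(6,7))
    finally show ?thesis using t by (simp add: ext_d_in in_chart_iff)
  qed
qed

lemma ext_d_deg:
  assumes \<xi>: "\<xi> \<in> inv_forms_deg A \<Gamma> p" shows "ext_d A \<xi> \<in> inv_forms_deg A \<Gamma> (Suc p)"
proof -
  have "homog (Suc p) (ext_d A \<xi> c x)" for c x
  proof (cases "in_chart A c x")
    case True
    then have c: "c \<in> A" "x \<in> coord_range c" by (auto simp: in_chart_iff)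
    show ?thesis
      unfolding ext_d_in[OF True] by (rule dd_homog[OF chart(2)[OF c(1)] inv_forms_deg_homog[OF \<xi>] c(2)])
  next
    case False then show ?thesis by (simp add: ext_d_out homog_zero)
  qed
  then show ?thesis using ext_d_inv_forms[OF inv_forms_degD[OF \<xi>]] by (simp add: inv_forms_deg_iff)
qed

lemma ext_d_ext_d:
  assumes \<xi>: "\<xi> \<in> inv_forms A \<Gamma>" shows "ext_d A (ext_d A \<xi>) = 0"
proof (rule form_eqI)
  fix c x assume i: "in_chart A c x"
  then have c: "c \<in> A" "x \<in> coord_range c" by (auto simp: in_chart_iff)
  have "dd (ext_d A \<xi> c) x = dd (dd (\<xi> c)) x"
    by (rule dd_cong[OF chart(2)[OF c(1)] c(2)]) (simp add: ext_d_in in_chart_iff c)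
  then show "ext_d A (ext_d A \<xi>) c x = 0 c x"
    using dd_dd[OF chart(2)[OF c(1)] inv_forms_smooth[OF \<xi> c(1)] c(2)] by (simp add: ext_d_in[OF i] zero_fun_apply)
qed (simp add: ext_d_out zero_fun_apply)

lemma ext_d_component:
  "form_component (Suc p) (ext_d A \<xi>) = ext_d A (form_component p \<xi>)"
  "form_component 0 (ext_d A \<xi>) = 0"
proof -
  show "form_component (Suc p) (ext_d A \<xi>) = ext_d A (form_component p \<xi>)"
  proof (intro ext)
    fix c x vs
    show "form_component (Suc p) (ext_d A \<xi>) c x vs = ext_d A (form_component p \<xi>) c x vs"
      unfolding form_component_def ext_d_def by (cases vs) (auto intro!: sum.cong)
  qed
  show "form_component 0 (ext_d A \<xi>) = 0"
    by (intro ext) (simp add: form_component_def ext_d_def fun_app)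
qed

subsection \<open>The symplectic form\<close>

lemma \<omega>_deg: "\<omega> \<in> inv_forms_deg A \<Gamma> 2" and \<omega>_inv: "\<omega> \<in> inv_forms A \<Gamma>"
  and \<omega>_closed: "ext_d A \<omega> = 0" and \<omega>_nondeg: "nondegenerate A \<omega>"
  using inv_symplectic by (auto simp: inv_symplectic_def inv_forms_deg_def inv_closed_def zero_fun_def)

lemma symplectic_at:
  assumes "in_chart A c x" shows "symplectic_space B (\<omega> c x) n"
proof (intro symplectic_space.intro onb symplectic_space_axioms.intro)
  show "card B = 2 * n" by (rule card_B)
  show "alternating (\<omega> c x)" by (rule inv_forms_alternating[OF \<omega>_inv assms])
  show "homog 2 (\<omega> c x)" by (rule inv_forms_deg_homog[OF \<omega>_deg])
  show "v = 0" if "\<And>w. \<omega> c x [v, w] = 0" for v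
    using \<omega>_nondeg assms that unfolding nondegenerate_def by blast
qed

lemma symplectic_family_chart:
  assumes "c \<in> A" shows "symplectic_family B (coord_range c) (\<omega> c) n"
  using chart(2)[OF assms] inv_forms_smooth[OF \<omega>_inv assms] symplectic_at assms
  by (intro symplectic_family.intro onb symplectic_family_axioms.intro) (auto simp: in_chart_iff)

lemma ext_d_wedge:
  assumes \<xi>: "\<xi> \<in> inv_forms A \<Gamma>" shows "ext_d A (form_wedge \<omega> \<xi>) = form_wedge \<omega> (ext_d A \<xi>)"
proof (rule form_eqI)
  fix c x assume i: "in_chart A c x"
  then have c: "c \<in> A" "x \<in> coord_range c" by (auto simp: in_chart_iff)
  have "form_wedge \<omega> \<xi> c = (\<lambda>x. \<omega> c x \<and>\<^sub>a \<xi> c x)" by (simp add: fun_eq_iff form_wedge_def)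
  moreover have "dd (\<omega> c) x = 0"
    using ext_d_in[OF i, of \<omega>] by (simp add: \<omega>_closed zero_fun_apply)
  ultimately show "ext_d A (form_wedge \<omega> \<xi>) c x = form_wedge \<omega> (ext_d A \<xi>) c x"
    using dd_wedge_even[OF chart(2)[OF c(1)] inv_forms_smooth[OF \<omega>_inv c(1)] inv_forms_smooth[OF \<xi> c(1)] c(2)
      symplectic_space.grade_inv_\<omega>[OF symplectic_at[OF i]]]
    by (simp add: ext_d_in[OF i] form_wedge_def)
qed (simp add: ext_d_out form_wedge_def)

lemma wedge_power_apply: "((form_wedge \<omega>) ^^ k) \<xi> c x = (((\<and>\<^sub>a) (\<omega> c x)) ^^ k) (\<xi> c x)"
  by (induction k) (simp_all add: form_wedge_def)

lemma form_power_in: "in_chart A c x \<Longrightarrow> form_power A \<omega> k c x = (((\<and>\<^sub>a) (\<omega> c x)) ^^ k) alt_unit"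
  by (simp add: form_power_def wedge_power_apply form_one_def)

subsection \<open>The star operator\<close>

text \<open>The pointwise inverse of \<open>\<flat>\<close> depends smoothly on the point and is
  natural, so it maps invariant forms to invariant multivector fields.\<close>

lemma flat_surj:
  assumes \<xi>: "\<xi> \<in> inv_forms A \<Gamma>"
  shows "\<exists>P\<in>inv_multivec_fields A \<Gamma>. flat \<omega> P = \<xi>"
proof -
  define P where "P c x = (if in_chart A c x then symplectic_space.sharp B (\<omega> c x) (\<xi> c x) else (\<lambda>\<alpha>. 0))" for c x
  have mv: "if in_chart A c x then multivector (P c x) else P c x = (\<lambda>\<alpha>. 0)" for c x
    using symplectic_space.multivector_sharp[OF symplectic_at] by (simp add: P_def)
  have sm: "smooth_on (coord_range c) (\<lambda>x. P c x \<alpha>)" if c: "c \<in> A" and \<alpha>: "alternating \<alpha>" for c \<alpha>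
    by (rule smooth_on_cong[OF chart(2)[OF c] _
          symplectic_family.smooth_sharp[OF symplectic_family_chart[OF c] inv_forms_smooth[OF \<xi> c] \<alpha>]])
      (simp add: P_def in_chart_iff c)
  have pres: "multivec_preserved A (U, f) P" if g: "(U, f) \<in> transitions" for U f
    unfolding multivec_preserved_def prod.case
  proof (intro ballI impI allI)
    fix c c' p \<alpha> assume c: "c \<in> A" "c' \<in> A" and p: "p \<in> U" "p \<in> fst c \<and> f p \<in> fst c'" and \<alpha>: "alternating (\<alpha> :: 'e alt)"
    have i: "in_chart A c (snd c p)" "in_chart A c' (snd c' (f p))" using c p by (auto simp: in_chart_iff)
    note t = g c p(1) p(2)[THEN conjunct1] p(2)[THEN conjunct2]
    show "P c' (snd c' (f p)) \<alpha> = P c (snd c p) (\<lambda>vs. \<alpha> (map (coord_deriv c c' f p) vs))"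
      unfolding P_def if_P[OF i(1)] if_P[OF i(2)]
      by (rule sharp_natural[OF symplectic_at[OF i(1)] symplectic_at[OF i(2)] transition_linear[OF t]
            inv_forms_pull[OF \<omega>_inv t] inv_forms_pull[OF \<xi> t] inv_forms_alternating[OF \<xi> i(2)] \<alpha>])
  qed
  have "P \<in> inv_multivec_fields A \<Gamma>"
    unfolding inv_multivec_fields_def multivec_fields_def using mv sm pres by (auto simp: transitions_def)
  moreover have "flat \<omega> P = \<xi>"
  proof (rule form_eqI)
    show "flat \<omega> P c x = \<xi> c x" if "in_chart A c x" for c x
      using symplectic_space.flat_sharp[OF symplectic_at[OF that] inv_forms_alternating[OF \<xi> that]] that
      by (simp add: flat_def P_def)
    show "flat \<omega> P c x = \<xi> c x" if "\<not> in_chart A c x" for c x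
      using that inv_forms_outside[OF \<xi> that] by (simp add: flat_def P_def flat_alt_def fun_eq_iff fun_app)
  qed
  ultimately show ?thesis by blast
qed

lemma inv_multivec_fields_at:
  "P \<in> inv_multivec_fields A \<Gamma> \<Longrightarrow> if in_chart A c x then multivector (P c x) else P c x = (\<lambda>\<alpha>. 0)"
  unfolding inv_multivec_fields_def multivec_fields_def by blast

text \<open>The preimage of \<open>\<xi>\<close> under \<open>\<flat>\<close> that enters the star
  operator is a choice, but pointwise there is only one.\<close>

lemma star_in:
  assumes \<xi>: "\<xi> \<in> inv_forms A \<Gamma>" and i: "in_chart A c x"
  shows "star A \<Gamma> \<omega> n \<xi> c x = symplectic_space.star_pt B (\<omega> c x) n (\<xi> c x)"
proof -
  define P where "P = inv_into (inv_multivec_fields A \<Gamma>) (flat \<omega>) \<xi>"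
  have im: "\<xi> \<in> flat \<omega> ` inv_multivec_fields A \<Gamma>" using flat_surj[OF \<xi>] by blast
  have P: "P \<in> inv_multivec_fields A \<Gamma>" "flat \<omega> P = \<xi>"
    unfolding P_def using inv_into_into[OF im] f_inv_into_f[OF im] by auto
  have "multivector (P c x)"
    using inv_multivec_fields_at[OF P(1), of c x] i by simp
  moreover have "flat_alt (\<omega> c x) (P c x) = \<xi> c x"
    using fun_cong[OF fun_cong[OF P(2), of c], of x] by (simp add: flat_def)
  ultimately show ?thesis
    unfolding star_def form_power_in[OF i] P_def[symmetric]
    by (rule symplectic_space.star_pt_eqI[OF symplectic_at[OF i] _ _ inv_forms_alternating[OF \<xi> i]])
qed

lemma star_out:
  assumes \<xi>: "\<xi> \<in> inv_forms A \<Gamma>" and i: "\<not> in_chart A c x"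
  shows "star A \<Gamma> \<omega> n \<xi> c x = 0"
proof -
  have "inv_into (inv_multivec_fields A \<Gamma>) (flat \<omega>) \<xi> \<in> inv_multivec_fields A \<Gamma>"
    using flat_surj[OF \<xi>] by (intro inv_into_into) blast
  then have "inv_into (inv_multivec_fields A \<Gamma>) (flat \<omega>) \<xi> c x = (\<lambda>\<alpha>. 0)"
    using inv_multivec_fields_at[of _ c x] i by simp
  then show ?thesis by (simp add: star_def contract_def fun_eq_iff fun_app)
qed

lemma star_add:
  assumes "\<xi> \<in> inv_forms A \<Gamma>" "\<zeta> \<in> inv_forms A \<Gamma>"
  shows "star A \<Gamma> \<omega> n (\<xi> + \<zeta>) = star A \<Gamma> \<omega> n \<xi> + star A \<Gamma> \<omega> n \<zeta>"
proof (rule form_eqI)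
  fix c x assume i: "in_chart A c x"
  interpret symplectic_space B "\<omega> c x" n by (rule symplectic_at[OF i])
  show "star A \<Gamma> \<omega> n (\<xi> + \<zeta>) c x = (star A \<Gamma> \<omega> n \<xi> + star A \<Gamma> \<omega> n \<zeta>) c x"
    using star_in[OF assms(1) i] star_in[OF assms(2) i] star_in[OF inv_forms_add[OF assms] i]
    by (simp add: plus_fun_apply[of \<xi>] plus_fun_apply[of "\<xi> c"] plus_fun_apply[of "star A \<Gamma> \<omega> n \<xi>"]
      plus_fun_apply[of "star A \<Gamma> \<omega> n \<xi> c"] star_pt_simps)
next
  fix c x assume "\<not> in_chart A c x"
  then show "star A \<Gamma> \<omega> n (\<xi> + \<zeta>) c x = (star A \<Gamma> \<omega> n \<xi> + star A \<Gamma> \<omega> n \<zeta>) c x"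
    using assms by (simp add: star_out inv_forms_add plus_fun_apply)
qed

lemma star_scale:
  assumes "\<xi> \<in> inv_forms A \<Gamma>"
  shows "star A \<Gamma> \<omega> n (r *\<^sub>R \<xi>) = r *\<^sub>R star A \<Gamma> \<omega> n \<xi>"
proof (rule form_eqI)
  fix c x assume i: "in_chart A c x"
  interpret symplectic_space B "\<omega> c x" n by (rule symplectic_at[OF i])
  show "star A \<Gamma> \<omega> n (r *\<^sub>R \<xi>) c x = (r *\<^sub>R star A \<Gamma> \<omega> n \<xi>) c x"
    using star_in[OF assms i] star_in[OF inv_forms_scale[OF assms] i]
    by (simp add: scaleR_fun_apply[of r \<xi>] scaleR_fun_apply[of r "\<xi> c"] scaleR_fun_apply[of r "star A \<Gamma> \<omega> n \<xi>"]
      scaleR_fun_apply[of r "star A \<Gamma> \<omega> n \<xi> c"] star_pt_simps)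
next
  fix c x assume "\<not> in_chart A c x"
  then show "star A \<Gamma> \<omega> n (r *\<^sub>R \<xi>) c x = (r *\<^sub>R star A \<Gamma> \<omega> n \<xi>) c x"
    using assms by (simp add: star_out inv_forms_scale scaleR_fun_apply)
qed

subsection \<open>The hard Lefschetz isomorphism on invariant forms\<close>

lemma wedge_power_inv: "\<xi> \<in> inv_forms A \<Gamma> \<Longrightarrow> ((form_wedge \<omega>) ^^ k) \<xi> \<in> inv_forms A \<Gamma>"
  by (induction k) (auto intro: inv_forms_wedge \<omega>_inv)

lemma wedge_power_inj:
  assumes \<xi>: "\<xi> \<in> inv_forms_deg A \<Gamma> p" "p + k \<le> n" and 0: "((form_wedge \<omega>) ^^ k) \<xi> = 0"
  shows "\<xi> = 0"
proof (rule form_eqI)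
  fix c x assume i: "in_chart A c x"
  have "(((\<and>\<^sub>a) (\<omega> c x)) ^^ k) (\<xi> c x) = 0"
    unfolding wedge_power_apply[symmetric] 0 by (simp add: zero_fun_apply)
  then show "\<xi> c x = 0 c x"
    using symplectic_space.Lk_inj[OF symplectic_at[OF i] inv_forms_alternating[OF inv_forms_degD[OF \<xi>(1)] i]
      inv_forms_deg_homog[OF \<xi>(1)] \<xi>(2)] by (simp add: zero_fun_apply)
next
  fix c x assume "\<not> in_chart A c x"
  then show "\<xi> c x = 0 c x" using inv_forms_outside[OF inv_forms_degD[OF \<xi>(1)]] by (simp add: zero_fun_apply)
qed

text \<open>The preimage exists in each chart by \<open>Lk_surj_family\<close>. Two
  representatives agree after pullback, because \<open>L\<^sup>k\<close> commutes with pullbacks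
  and is injective in degree \<open>n - k\<close>; so the local preimages define an invariant
  form.\<close>

lemma wedge_power_surj:
  assumes \<eta>: "\<eta> \<in> inv_forms_deg A \<Gamma> (n + k)" and k: "k \<le> n"
  shows "\<exists>\<xi>\<in>inv_forms_deg A \<Gamma> (n - k). ((form_wedge \<omega>) ^^ k) \<xi> = \<eta>"
proof -
  have "\<exists>\<alpha>. smooth_family (coord_range c) \<alpha> \<and>
     (\<forall>x\<in>coord_range c. homog (n + k - 2 * k) (\<alpha> x) \<and> (((\<and>\<^sub>a) (\<omega> c x)) ^^ k) (\<alpha> x) = \<eta> c x)" if c: "c \<in> A" for c
    using k inv_forms_smooth[OF inv_forms_degD[OF \<eta>] c] inv_forms_deg_homog[OF \<eta>]
    by (intro symplectic_family.Lk_surj_family[OF symplectic_family_chart[OF c], where j = "n - k"]) auto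
  then obtain a where a: "\<And>c. c \<in> A \<Longrightarrow> smooth_family (coord_range c) (a c)"
    and ha: "\<And>c x. c \<in> A \<Longrightarrow> x \<in> coord_range c \<Longrightarrow> homog (n + k - 2 * k) (a c x)"
    and La: "\<And>c x. c \<in> A \<Longrightarrow> x \<in> coord_range c \<Longrightarrow> (((\<and>\<^sub>a) (\<omega> c x)) ^^ k) (a c x) = \<eta> c x"
    by metis
  have nk: "n + k - 2 * k = n - k" by simp
  define \<xi> where "\<xi> c x = (if in_chart A c x then a c x else 0)" for c x
  have hom: "homog (n - k) (\<xi> c x)" for c x
    using ha nk by (auto simp: \<xi>_def in_chart_iff homog_zero)
  have L\<xi>: "(((\<and>\<^sub>a) (\<omega> c x)) ^^ k) (\<xi> c x) = \<eta> c x" if "in_chart A c x" for c x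
    using La that by (auto simp: \<xi>_def in_chart_iff)
  have \<xi>_sm: "smooth_family (coord_range c) (\<xi> c)" if c: "c \<in> A" for c
    by (rule smooth_family_cong[OF chart(2)[OF c] _ a[OF c]]) (simp add: \<xi>_def in_chart_iff c)
  have "\<xi> \<in> inv_forms A \<Gamma>"
  proof (rule inv_formsI[OF _ \<xi>_sm])
    show "\<xi> c x = 0" if "\<not> in_chart A c x" for c x using that by (simp add: \<xi>_def)
    fix U f c c' p
    assume t: "(U, f) \<in> transitions" "c \<in> A" "c' \<in> A" "p \<in> U" "p \<in> fst c" "f p \<in> fst c'"
    let ?x = "snd c p" and ?y = "snd c' (f p)" and ?E = "coord_deriv c c' f p"
    have i: "in_chart A c ?x" "in_chart A c' ?y" using t by (auto simp: in_chart_iff)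
    interpret symplectic_space B "\<omega> c ?x" n by (rule symplectic_at[OF i(1)])
    have pull_power: "(\<lambda>vs. ((((\<and>\<^sub>a) (\<omega> c' ?y)) ^^ j) \<beta>) (map ?E vs)) = Lk j (\<lambda>vs. \<beta> (map ?E vs))" for j \<beta>
      by (induction j) (simp_all add: pull_wedge inv_forms_pull[OF \<omega>_inv t])
    have "Lk k (\<lambda>vs. \<xi> c' ?y (map ?E vs)) = \<eta> c ?x"
      unfolding pull_power[symmetric] L\<xi>[OF i(2)] inv_forms_pull[OF inv_forms_degD[OF \<eta>] t] ..
    then have diff0: "Lk k (\<xi> c ?x - (\<lambda>vs. \<xi> c' ?y (map ?E vs))) = 0"
      by (simp add: Lk_simps L\<xi>[OF i(1)])
    have diff_alt: "alternating (\<xi> c ?x - (\<lambda>vs. \<xi> c' ?y (map ?E vs)))"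
      using smooth_family_alternating[OF \<xi>_sm] t
      by (intro alternating_diff alternating_pull transition_linear[OF t]) auto
    have diff_hom: "homog (n - k) (\<xi> c ?x - (\<lambda>vs. \<xi> c' ?y (map ?E vs)))"
      using hom[of c' ?y] by (intro homog_diff hom) (auto simp: homog_def)
    have "\<xi> c ?x - (\<lambda>vs. \<xi> c' ?y (map ?E vs)) = 0"
      by (rule Lk_inj[OF diff_alt diff_hom _ diff0]) (use k in simp)
    then show "\<xi> c ?x = (\<lambda>vs. \<xi> c' ?y (map ?E vs))" by simp
  qed
  then have "\<xi> \<in> inv_forms_deg A \<Gamma> (n - k)" using hom by (simp add: inv_forms_deg_iff)
  moreover have "((form_wedge \<omega>) ^^ k) \<xi> = \<eta>"
  proof (rule form_eqI)
    show "((form_wedge \<omega>) ^^ k) \<xi> c x = \<eta> c x" if "in_chart A c x" for c x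
      using L\<xi>[OF that] by (simp add: wedge_power_apply)
    fix c x assume o: "\<not> in_chart A c x"
    show "((form_wedge \<omega>) ^^ k) \<xi> c x = \<eta> c x"
      using inv_forms_outside[OF wedge_power_inv o] \<open>\<xi> \<in> inv_forms A \<Gamma>\<close> inv_forms_outside[OF inv_forms_degD[OF \<eta>] o]
      by simp
  qed
  ultimately show ?thesis by blast
qed

lemma linear_form_wedge: "linear (form_wedge \<omega>)"
  by (rule linearI) (simp_all add: fun_eq_iff form_wedge_def plus_fun_apply[of "_ :: ('a, 'e) form"]
    plus_fun_apply[of "_ :: 'e \<Rightarrow> 'e alt"] scaleR_fun_apply[of _ "_ :: ('a, 'e) form"]
    scaleR_fun_apply[of _ "_ :: 'e \<Rightarrow> 'e alt"])

lemma subspace_inv_forms_deg: "subspace (inv_forms_deg A \<Gamma> p)"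
proof (rule subspaceI)
  show "0 \<in> inv_forms_deg A \<Gamma> p" by (simp add: inv_forms_deg_iff inv_forms_zero zero_fun_apply homog_zero)
  show "x + y \<in> inv_forms_deg A \<Gamma> p" if "x \<in> inv_forms_deg A \<Gamma> p" "y \<in> inv_forms_deg A \<Gamma> p" for x y
    using that by (auto simp: inv_forms_deg_iff inv_forms_add homog_def plus_fun_apply)
  show "r *\<^sub>R x \<in> inv_forms_deg A \<Gamma> p" if "x \<in> inv_forms_deg A \<Gamma> p" for r x
    using that by (auto simp: inv_forms_deg_iff inv_forms_scale homog_def scaleR_fun_apply)
qed

lemma star_primitive:
  assumes \<xi>: "\<xi> \<in> inv_forms_deg A \<Gamma> p" and pij: "p + i + j = n"
    and prim: "((form_wedge \<omega>) ^^ Suc (i + j)) \<xi> = 0"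
  shows "star A \<Gamma> \<omega> n (((form_wedge \<omega>) ^^ i) \<xi>)
    = (star_sign p * fact n * fact i / fact j) *\<^sub>R ((form_wedge \<omega>) ^^ j) \<xi>"
proof (rule form_eqI)
  note inv = inv_forms_degD[OF \<xi>]
  fix c x assume i: "in_chart A c x"
  interpret symplectic_space B "\<omega> c x" n by (rule symplectic_at[OF i])
  have "Lk (Suc (i + j)) (\<xi> c x) = 0"
    unfolding wedge_power_apply[symmetric] prim by (simp add: zero_fun_apply)
  from star_pt_primitive[OF inv_forms_alternating[OF inv i] inv_forms_deg_homog[OF \<xi>] pij this]
  show "star A \<Gamma> \<omega> n (((form_wedge \<omega>) ^^ i) \<xi>) c x
    = ((star_sign p * fact n * fact i / fact j) *\<^sub>R ((form_wedge \<omega>) ^^ j) \<xi>) c x"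
    unfolding star_in[OF wedge_power_inv[OF inv] i] wedge_power_apply scaleR_fun_apply[of _ "_ :: ('a, 'e) form"]
      scaleR_fun_apply[of _ "_ :: 'e \<Rightarrow> 'e alt"] .
next
  note inv = inv_forms_degD[OF \<xi>]
  fix c x assume o: "\<not> in_chart A c x"
  show "star A \<Gamma> \<omega> n (((form_wedge \<omega>) ^^ i) \<xi>) c x
    = ((star_sign p * fact n * fact i / fact j) *\<^sub>R ((form_wedge \<omega>) ^^ j) \<xi>) c x"
    using inv_forms_outside[OF wedge_power_inv[OF inv] o]
    by (simp add: star_out[OF wedge_power_inv[OF inv] o] scaleR_fun_apply[of _ "_ :: ('a, 'e) form"]
      scaleR_fun_apply[of _ "_ :: 'e \<Rightarrow> 'e alt"])
qed

sublocale LC: lefschetz_complex n "inv_forms_deg A \<Gamma>" "form_wedge \<omega>" "ext_d A" "star A \<Gamma> \<omega> n"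
proof (rule lefschetz_complex.intro)
  fix p k i j :: nat and x y :: "('a, 'e) form" and r :: real
  show "subspace (inv_forms_deg A \<Gamma> p)" by (rule subspace_inv_forms_deg)
  show "linear (form_wedge \<omega>)" by (rule linear_form_wedge)
  show "\<exists>x\<in>inv_forms_deg A \<Gamma> (n - k). ((form_wedge \<omega>) ^^ k) x = y"
    if "y \<in> inv_forms_deg A \<Gamma> (n + k)" "k \<le> n" using that by (rule wedge_power_surj)
  assume x: "x \<in> inv_forms_deg A \<Gamma> p"
  note ix = inv_forms_degD[OF x]
  show "x = 0" if "2 * n < p"
  proof (rule form_eqI)
    show "x c z = 0 c z" if i: "in_chart A c z" for c z
      using alternating_gt_dim[OF inv_forms_alternating[OF ix i] inv_forms_deg_homog[OF x]] \<open>2 * n < p\<close>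
      by (simp add: card_B zero_fun_apply)
    show "x c z = 0 c z" if o: "\<not> in_chart A c z" for c z
      using inv_forms_outside[OF ix o] by (simp add: zero_fun_apply)
  qed
  show "form_wedge \<omega> x \<in> inv_forms_deg A \<Gamma> (p + 2)"
    using homog_wedge[OF inv_forms_deg_homog[OF \<omega>_deg] inv_forms_deg_homog[OF x]] inv_forms_wedge[OF \<omega>_inv ix]
    by (simp add: inv_forms_deg_iff form_wedge_def add.commute)
  show "ext_d A x \<in> inv_forms_deg A \<Gamma> (Suc p)" by (rule ext_d_deg[OF x])
  show "ext_d A (r *\<^sub>R x) = r *\<^sub>R ext_d A x" by (rule ext_d_scale[OF ix])
  show "ext_d A (ext_d A x) = 0" by (rule ext_d_ext_d[OF ix])
  show "ext_d A (form_wedge \<omega> x) = form_wedge \<omega> (ext_d A x)" by (rule ext_d_wedge[OF ix])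
  show "x = 0" if "p + k \<le> n" "((form_wedge \<omega>) ^^ k) x = 0" using wedge_power_inj[OF x that] .
  show "star A \<Gamma> \<omega> n (r *\<^sub>R x) = r *\<^sub>R star A \<Gamma> \<omega> n x" by (rule star_scale[OF ix])
  show "star A \<Gamma> \<omega> n (((form_wedge \<omega>) ^^ i) x) = (star_sign p * fact n * fact i / fact j) *\<^sub>R ((form_wedge \<omega>) ^^ j) x"
    if "p + i + j = n" "((form_wedge \<omega>) ^^ Suc (i + j)) x = 0" by (rule star_primitive[OF x that])
  assume y: "y \<in> inv_forms_deg A \<Gamma> p"
  show "ext_d A (x + y) = ext_d A x + ext_d A y" by (rule ext_d_add[OF ix inv_forms_degD[OF y]])
  show "star A \<Gamma> \<omega> n (x + y) = star A \<Gamma> \<omega> n x + star A \<Gamma> \<omega> n y"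
    by (rule star_add[OF ix inv_forms_degD[OF y]])
qed

subsection \<open>Harmonic forms and cohomology classes\<close>

text \<open>In each degree, \<open>\<delta>\<close> up to sign.\<close>

abbreviation sds :: "('a, 'e) form \<Rightarrow> ('a, 'e) form" where
  "sds \<xi> \<equiv> star A \<Gamma> \<omega> n (ext_d A (star A \<Gamma> \<omega> n \<xi>))"

lemma sds_deg:
  assumes "\<xi> \<in> inv_forms_deg A \<Gamma> k" "k \<le> 2 * n"
  shows "k = 0 \<Longrightarrow> sds \<xi> = 0" "k = Suc l \<Longrightarrow> sds \<xi> \<in> inv_forms_deg A \<Gamma> l"
proof -
  have "star A \<Gamma> \<omega> n \<xi> \<in> inv_forms_deg A \<Gamma> (2 * n - k)" using assms by (intro LC.s_\<Omega>) auto
  then have d: "ext_d A (star A \<Gamma> \<omega> n \<xi>) \<in> inv_forms_deg A \<Gamma> (Suc (2 * n - k))" by (rule ext_d_deg)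
  show "sds \<xi> = 0" if "k = 0" using LC.\<Omega>_gt[OF d] that LC.s_0 by simp
  show "sds \<xi> \<in> inv_forms_deg A \<Gamma> l" if "k = Suc l" using assms(2) that by (intro LC.s_\<Omega>[OF d]) simp
qed

lemma codiff_eq: "codiff A \<Gamma> \<omega> n \<xi> = (\<Sum>k\<le>2 * n. (-1) ^ k *\<^sub>R sds (form_component k \<xi>))"
  by (intro ext) (simp add: codiff_def sum_fun_apply scaleR_fun_apply)

text \<open>The summands of \<open>\<delta>\<close> have different degrees, so there is no
  cancellation between them.\<close>

lemma codiff_zero_iff:
  assumes "\<xi> \<in> inv_forms A \<Gamma>"
  shows "codiff A \<Gamma> \<omega> n \<xi> = 0 \<longleftrightarrow> (\<forall>k\<le>2 * n. sds (form_component k \<xi>) = 0)"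
proof
  assume "\<forall>k\<le>2 * n. sds (form_component k \<xi>) = 0"
  then show "codiff A \<Gamma> \<omega> n \<xi> = 0" unfolding codiff_eq by simp
next
  assume 0: "codiff A \<Gamma> \<omega> n \<xi> = 0"
  let ?y = "\<lambda>k. sds (form_component k \<xi>)"
  note deg = sds_deg[OF component_deg[OF assms]]
  show "\<forall>k\<le>2 * n. ?y k = 0"
  proof (intro allI impI)
    fix k assume k: "k \<le> 2 * n"
    show "?y k = 0"
    proof (cases k)
      case 0 then show ?thesis using deg(1)[OF k] by simp
    next
      case (Suc l)
      show ?thesis
      proof (intro ext)
        fix c x and vs :: "'e list"
        show "?y k c x vs = 0 c x vs"
        proof (cases "length vs = l")
          case False
          then show ?thesis using inv_forms_deg_homog[OF deg(2)[OF k Suc], of c x] by (simp add: homog_def fun_app)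
        next
          case True
          have other: "?y j c x vs = 0" if j: "j \<le> 2 * n" "j \<noteq> k" for j
          proof (cases j)
            case 0 then show ?thesis using deg(1)[OF j(1)] by (simp add: fun_app)
          next
            case (Suc m)
            then have "m \<noteq> l" using j(2) \<open>k = Suc l\<close> by simp
            then show ?thesis
              using inv_forms_deg_homog[OF deg(2)[OF j(1) Suc], of c x] True by (simp add: homog_def)
          qed
          have "(\<Sum>j\<le>2 * n. (-1) ^ j * ?y j c x vs) = (\<Sum>j\<le>2 * n. if j = k then (-1) ^ k * ?y k c x vs else 0)"
            using other by (intro sum.cong refl) auto
          moreover have "codiff A \<Gamma> \<omega> n \<xi> c x vs = (\<Sum>j\<le>2 * n. (-1) ^ j * ?y j c x vs)"
            by (simp add: codiff_def)
          ultimately show ?thesis using 0 k by (simp add: fun_app)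
        qed
      qed
    qed
  qed
qed

lemma harmonic_iff:
  "harmonic A \<Gamma> \<omega> n \<xi> \<longleftrightarrow> \<xi> \<in> inv_forms A \<Gamma> \<and> ext_d A \<xi> = 0 \<and> (\<forall>k\<le>2 * n. sds (form_component k \<xi>) = 0)"
  using codiff_zero_iff unfolding harmonic_def zero_fun_def by blast

lemma inv_closed_iff: "\<xi> \<in> inv_closed A \<Gamma> \<longleftrightarrow> \<xi> \<in> inv_forms A \<Gamma> \<and> ext_d A \<xi> = 0"
  by (simp add: inv_closed_def zero_fun_def)

lemma cohomologous_iff: "(\<xi>, \<zeta>) \<in> cohomologous A \<Gamma> \<longleftrightarrow> \<xi> \<in> inv_closed A \<Gamma> \<and> \<zeta> \<in> inv_closed A \<Gamma> \<and>
    (\<exists>\<eta>\<in>inv_forms A \<Gamma>. \<zeta> = \<xi> + ext_d A \<eta>)"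
  by (simp add: cohomologous_def plus_fun_def)

lemma ext_d_minus: "\<eta> \<in> inv_forms A \<Gamma> \<Longrightarrow> ext_d A (- \<eta>) = - ext_d A \<eta>"
  and inv_forms_minus: "\<eta> \<in> inv_forms A \<Gamma> \<Longrightarrow> - \<eta> \<in> inv_forms A \<Gamma>"
  using ext_d_scale[of \<eta> "-1"] inv_forms_scale[of \<eta> "-1"] by simp_all

lemma equiv_cohomologous: "equiv (inv_closed A \<Gamma>) (cohomologous A \<Gamma>)"
proof (rule equivI)
  show "cohomologous A \<Gamma> \<subseteq> inv_closed A \<Gamma> \<times> inv_closed A \<Gamma>" by (auto simp: cohomologous_iff)
  show "refl_on (inv_closed A \<Gamma>) (cohomologous A \<Gamma>)"
    using inv_forms_zero ext_d_zero by (auto simp: refl_on_def cohomologous_iff intro!: bexI[of _ 0])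
  show "sym (cohomologous A \<Gamma>)"
  proof (rule symI)
    fix \<xi> \<zeta> assume "(\<xi>, \<zeta>) \<in> cohomologous A \<Gamma>"
    then obtain \<eta> where "\<xi> \<in> inv_closed A \<Gamma>" "\<zeta> \<in> inv_closed A \<Gamma>" "\<eta> \<in> inv_forms A \<Gamma>" "\<zeta> = \<xi> + ext_d A \<eta>"
      by (auto simp: cohomologous_iff)
    then show "(\<zeta>, \<xi>) \<in> cohomologous A \<Gamma>"
      unfolding cohomologous_iff by (intro conjI bexI[of _ "- \<eta>"]) (simp_all add: ext_d_minus inv_forms_minus)
  qed
  show "trans (cohomologous A \<Gamma>)"
  proof (rule transI)
    fix \<xi> \<zeta> \<theta> assume "(\<xi>, \<zeta>) \<in> cohomologous A \<Gamma>" "(\<zeta>, \<theta>) \<in> cohomologous A \<Gamma>"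
    then obtain \<eta> \<eta>' where "\<xi> \<in> inv_closed A \<Gamma>" "\<theta> \<in> inv_closed A \<Gamma>" "\<eta> \<in> inv_forms A \<Gamma>" "\<zeta> = \<xi> + ext_d A \<eta>"
      "\<eta>' \<in> inv_forms A \<Gamma>" "\<theta> = \<zeta> + ext_d A \<eta>'"
      by (auto simp: cohomologous_iff)
    then show "(\<xi>, \<theta>) \<in> cohomologous A \<Gamma>"
      unfolding cohomologous_iff by (intro conjI bexI[of _ "\<eta> + \<eta>'"]) (simp_all add: ext_d_add inv_forms_add add.assoc)
  qed
qed

abbreviation cls :: "('a, 'e) form \<Rightarrow> ('a, 'e) form set" where "cls \<xi> \<equiv> cohomologous A \<Gamma> `` {\<xi>}"

lemma cls_eq_iff: "\<xi> \<in> inv_closed A \<Gamma> \<Longrightarrow> \<zeta> \<in> inv_closed A \<Gamma> \<Longrightarrow> cls \<xi> = cls \<zeta> \<longleftrightarrow> (\<xi>, \<zeta>) \<in> cohomologous A \<Gamma>"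
  using eq_equiv_class_iff[OF equiv_cohomologous] by blast

lemma wedge_closed: "\<xi> \<in> inv_closed A \<Gamma> \<Longrightarrow> form_wedge \<omega> \<xi> \<in> inv_closed A \<Gamma>"
  using linear_0[OF linear_form_wedge] by (simp add: inv_closed_iff inv_forms_wedge \<omega>_inv ext_d_wedge)

lemma lefschetz_cls:
  assumes w: "w \<in> inv_closed A \<Gamma>" shows "lefschetz A \<Gamma> \<omega> (cls w) = cls (form_wedge \<omega> w)"
proof -
  have "cls (form_wedge \<omega> \<xi>) = cls (form_wedge \<omega> w)" if member: "\<xi> \<in> cls w" for \<xi>
  proof -
    obtain \<eta> where \<xi>: "\<xi> \<in> inv_closed A \<Gamma>" "\<eta> \<in> inv_forms A \<Gamma>" "\<xi> = w + ext_d A \<eta>"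
      using member unfolding Image_singleton_iff cohomologous_iff by blast
    have "form_wedge \<omega> \<xi> = form_wedge \<omega> w + ext_d A (form_wedge \<omega> \<eta>)"
      unfolding ext_d_wedge[OF \<xi>(2)] \<xi>(3) linear_add[OF linear_form_wedge] ..
    then have "(form_wedge \<omega> w, form_wedge \<omega> \<xi>) \<in> cohomologous A \<Gamma>"
      using wedge_closed[OF w] wedge_closed[OF \<xi>(1)] inv_forms_wedge[OF \<omega>_inv \<xi>(2)]
      unfolding cohomologous_iff by blast
    then show ?thesis using cls_eq_iff wedge_closed w \<xi>(1) by blast
  qed
  moreover have "w \<in> cls w" using equiv_class_self[OF equiv_cohomologous w] .
  ultimately show ?thesis unfolding lefschetz_def by blast
qed

lemma lefschetz_power_cls:
  "w \<in> inv_closed A \<Gamma> \<Longrightarrow> ((form_wedge \<omega>) ^^ k) w \<in> inv_closed A \<Gamma> \<and>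
     (lefschetz A \<Gamma> \<omega> ^^ k) (cls w) = cls (((form_wedge \<omega>) ^^ k) w)"
  by (induction k) (simp_all add: wedge_closed lefschetz_cls)

lemma Z_iff: "\<xi> \<in> LC.Z p \<longleftrightarrow> \<xi> \<in> inv_closed A \<Gamma> \<inter> inv_forms_deg A \<Gamma> p"
  by (auto simp: LC.Z_def inv_closed_iff inv_forms_degD)

lemma component_self: "\<xi> \<in> inv_forms_deg A \<Gamma> p \<Longrightarrow> form_component q \<xi> = (if q = p then \<xi> else 0)"
  using component_homog[OF inv_forms_deg_homog] by (auto simp: fun_eq_iff form_component_apply zero_fun_apply)

lemma form_component_add: "form_component p (\<xi> + \<zeta>) = form_component p \<xi> + form_component p \<zeta>"
  by (simp add: fun_eq_iff form_component_def plus_fun_apply)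

lemma component_exact:
  assumes "\<eta> \<in> inv_forms A \<Gamma>" shows "form_component p (ext_d A \<eta>) \<in> LC.Bd p"
proof (cases p)
  case 0 then show ?thesis by (simp add: LC.Bd_def ext_d_component(2))
next
  case (Suc q) then show ?thesis using component_deg[OF assms, of q] by (auto simp: LC.Bd_def ext_d_component(1))
qed

lemma Bd_exact: "\<xi> \<in> LC.Bd p \<Longrightarrow> \<exists>\<eta>\<in>inv_forms A \<Gamma>. \<xi> = ext_d A \<eta>"
  using inv_forms_zero ext_d_zero by (cases p) (auto simp: LC.Bd_def inv_forms_degD)

text \<open>An antiderivative of an exact form of degree \<open>p\<close> can be replaced by its
  component of degree \<open>p - 1\<close>.\<close>

lemma cohomologous_deg:
  assumes "\<xi> \<in> LC.Z p" "\<zeta> \<in> LC.Z p"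
  shows "(\<xi>, \<zeta>) \<in> cohomologous A \<Gamma> \<longleftrightarrow> \<zeta> - \<xi> \<in> LC.Bd p"
proof
  assume "(\<xi>, \<zeta>) \<in> cohomologous A \<Gamma>"
  then obtain \<eta> where \<eta>: "\<eta> \<in> inv_forms A \<Gamma>" "\<zeta> = \<xi> + ext_d A \<eta>" by (auto simp: cohomologous_iff)
  then have d: "\<zeta> - \<xi> = ext_d A \<eta>" by simp
  have "\<zeta> - \<xi> \<in> inv_forms_deg A \<Gamma> p" using assms by (intro LC.diff_\<Omega>) (auto simp: Z_iff)
  then have "\<zeta> - \<xi> = form_component p (ext_d A \<eta>)" using component_self[of "\<zeta> - \<xi>" p p] d by simp
  then show "\<zeta> - \<xi> \<in> LC.Bd p" using component_exact[OF \<eta>(1)] by simp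
next
  assume "\<zeta> - \<xi> \<in> LC.Bd p"
  then obtain \<eta> where "\<eta> \<in> inv_forms A \<Gamma>" "\<zeta> - \<xi> = ext_d A \<eta>" using Bd_exact by blast
  then have "\<eta> \<in> inv_forms A \<Gamma>" "\<zeta> = \<xi> + ext_d A \<eta>" by (auto simp: algebra_simps)
  then show "(\<xi>, \<zeta>) \<in> cohomologous A \<Gamma>" using assms by (auto simp: cohomologous_iff Z_iff)
qed

text \<open>Classes and harmonic forms may be inhomogeneous; both directions pass to the
  components of each degree.\<close>

lemma harmonic_representatives_iff:
  "(\<forall>C \<in> inv_cohomology A \<Gamma>. \<exists>\<xi>\<in>C. harmonic A \<Gamma> \<omega> n \<xi>) \<longleftrightarrow>
   (\<forall>p. \<forall>z\<in>LC.Z p. \<exists>x\<in>LC.Z p. sds x = 0 \<and> z - x \<in> LC.Bd p)"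
proof
  assume H: "\<forall>C \<in> inv_cohomology A \<Gamma>. \<exists>\<xi>\<in>C. harmonic A \<Gamma> \<omega> n \<xi>"
  show "\<forall>p. \<forall>z\<in>LC.Z p. \<exists>x\<in>LC.Z p. sds x = 0 \<and> z - x \<in> LC.Bd p"
  proof (intro allI ballI)
    fix p z assume z: "z \<in> LC.Z p"
    show "\<exists>x\<in>LC.Z p. sds x = 0 \<and> z - x \<in> LC.Bd p"
    proof (cases "p \<le> 2 * n")
      case False
      then have "z = 0" using z LC.\<Omega>_gt by (auto simp: Z_iff)
      then show ?thesis
        using z LC.s_0 LC.d_0 LC.Bd_zero by (intro bexI[of _ 0]) auto
    next
      case True
      have zc: "z \<in> inv_closed A \<Gamma>" "z \<in> inv_forms_deg A \<Gamma> p" using z by (auto simp: Z_iff)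
      have "cls z \<in> inv_cohomology A \<Gamma>" unfolding inv_cohomology_def using zc(1) by (rule quotientI)
      then obtain \<xi> where \<xi>: "\<xi> \<in> cls z" "harmonic A \<Gamma> \<omega> n \<xi>" using H by blast
      then obtain \<eta> where \<eta>: "\<eta> \<in> inv_forms A \<Gamma>" "\<xi> = z + ext_d A \<eta>" by (auto simp: cohomologous_iff)
      let ?x = "form_component p \<xi>"
      have h: "\<xi> \<in> inv_forms A \<Gamma>" "ext_d A \<xi> = 0" "sds ?x = 0" using \<xi>(2) True by (auto simp: harmonic_iff)
      have "ext_d A ?x = form_component (Suc p) 0" unfolding ext_d_component(1)[symmetric] h(2) ..
      also have "\<dots> = 0" by (simp add: fun_eq_iff form_component_def fun_app)
      finally have x: "?x \<in> LC.Z p"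
        using component_deg[OF h(1), of p] by (auto simp: Z_iff inv_closed_iff inv_forms_degD)
      have "?x = z + form_component p (ext_d A \<eta>)"
        unfolding \<eta>(2) form_component_add using component_self[OF zc(2), of p] by simp
      then have "?x - z \<in> LC.Bd p" using component_exact[OF \<eta>(1)] by simp
      then have "(?x, z) \<in> cohomologous A \<Gamma>"
        using cohomologous_deg[OF z x] equiv_cohomologous by (meson equivE symD)
      then have "z - ?x \<in> LC.Bd p" using cohomologous_deg[OF x z] by simp
      then show ?thesis using x h(3) by blast
    qed
  qed
next
  assume H: "\<forall>p. \<forall>z\<in>LC.Z p. \<exists>x\<in>LC.Z p. sds x = 0 \<and> z - x \<in> LC.Bd p"
  show "\<forall>C \<in> inv_cohomology A \<Gamma>. \<exists>\<xi>\<in>C. harmonic A \<Gamma> \<omega> n \<xi>"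
  proof
    fix C assume "C \<in> inv_cohomology A \<Gamma>"
    then obtain z where z: "z \<in> inv_closed A \<Gamma>" "C = cls z"
      unfolding inv_cohomology_def by (auto elim: quotientE)
    then have zi: "z \<in> inv_forms A \<Gamma>" and dz: "ext_d A z = 0" by (auto simp: inv_closed_iff)
    have "form_component p z \<in> LC.Z p" for p
    proof -
      have "ext_d A (form_component p z) = form_component (Suc p) 0" unfolding ext_d_component(1)[symmetric] dz ..
      also have "\<dots> = 0" by (simp add: fun_eq_iff form_component_def fun_app)
      finally show ?thesis using component_deg[OF zi, of p] by (auto simp: Z_iff inv_closed_iff inv_forms_degD)
    qed
    then have "\<exists>x. x \<in> LC.Z p \<and> sds x = 0 \<and> form_component p z - x \<in> LC.Bd p" for p using H by blast
    then obtain x where x: "\<And>p. x p \<in> LC.Z p" "\<And>p. sds (x p) = 0" "\<And>p. form_component p z - x p \<in> LC.Bd p"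
      by metis
    then have "\<exists>\<eta>. \<eta> \<in> inv_forms A \<Gamma> \<and> form_component p z - x p = ext_d A \<eta>" for p using Bd_exact by blast
    then obtain \<eta> where \<eta>: "\<And>p. \<eta> p \<in> inv_forms A \<Gamma>" "\<And>p. form_component p z - x p = ext_d A (\<eta> p)"
      by metis
    define \<xi> where "\<xi> = (\<Sum>p\<le>2 * n. x p)"
    have xi: "x p \<in> inv_forms_deg A \<Gamma> p" "x p \<in> inv_forms A \<Gamma>" "ext_d A (x p) = 0" for p
      using x(1)[of p] by (auto simp: Z_iff inv_closed_iff)
    have \<xi>i: "\<xi> \<in> inv_forms A \<Gamma>" unfolding \<xi>_def by (intro inv_forms_sum xi)
    have d\<xi>: "ext_d A \<xi> = 0" unfolding \<xi>_def by (simp add: ext_d_sum xi)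
    have comp: "form_component k \<xi> = x k" if "k \<le> 2 * n" for k
    proof -
      have "form_component k \<xi> = (\<Sum>p\<le>2 * n. form_component k (x p))"
        by (simp add: \<xi>_def fun_eq_iff form_component_def sum_fun_apply)
      also have "\<dots> = (\<Sum>p\<le>2 * n. if p = k then x k else 0)"
        using component_self[OF xi(1)] by (intro sum.cong refl) auto
      finally show ?thesis using that by simp
    qed
    have "harmonic A \<Gamma> \<omega> n \<xi>" using \<xi>i d\<xi> comp x(2) by (simp add: harmonic_iff)
    moreover have "\<xi> \<in> C"
    proof -
      have "z - \<xi> = (\<Sum>p\<le>2 * n. form_component p z - x p)"
        unfolding sum_subtractf sum_form_components[OF zi] \<xi>_def ..
      also have "\<dots> = ext_d A (\<Sum>p\<le>2 * n. \<eta> p)" using \<eta> by (simp add: ext_d_sum)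
      finally have "\<xi> = z + ext_d A (- (\<Sum>p\<le>2 * n. \<eta> p))"
        using ext_d_minus[OF inv_forms_sum, of "{..2 * n}" \<eta>] \<eta>(1) by (simp add: algebra_simps)
      moreover have "- (\<Sum>p\<le>2 * n. \<eta> p) \<in> inv_forms A \<Gamma>" using \<eta>(1) by (intro inv_forms_minus inv_forms_sum)
      ultimately show ?thesis
        using z \<xi>i d\<xi> unfolding z(2) by (auto simp: cohomologous_iff inv_closed_iff simp del: ext_d_minus)
    qed
    ultimately show "\<exists>\<xi>\<in>C. harmonic A \<Gamma> \<omega> n \<xi>" by blast
  qed
qed

text \<open>The image always lies in degree \<open>n + k\<close>, so equality of the two sets
  means surjectivity.\<close>

lemma lefschetz_surjective_iff:
  assumes k: "k \<le> n"
  shows "(lefschetz A \<Gamma> \<omega> ^^ k) ` inv_cohomology_deg A \<Gamma> (n - k) = inv_cohomology_deg A \<Gamma> (n + k) \<longleftrightarrow>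
    (\<forall>z\<in>LC.Z (n + k). \<exists>w\<in>LC.Z (n - k). z - ((form_wedge \<omega>) ^^ k) w \<in> LC.Bd (n + k))"
proof -
  have deg: "inv_cohomology_deg A \<Gamma> p = cls ` LC.Z p" for p
    unfolding inv_cohomology_deg_def by (auto simp: Z_iff)
  have Lk: "(lefschetz A \<Gamma> \<omega> ^^ k) (cls w) = cls (((form_wedge \<omega>) ^^ k) w)"
    and LZ: "((form_wedge \<omega>) ^^ k) w \<in> LC.Z (n + k)" if "w \<in> LC.Z (n - k)" for w
    using lefschetz_power_cls[of w k] LC.Lk_\<Omega>[of w "n - k" k] that k by (auto simp: Z_iff add.commute)
  have img: "(lefschetz A \<Gamma> \<omega> ^^ k) ` inv_cohomology_deg A \<Gamma> (n - k) = (\<lambda>w. cls (((form_wedge \<omega>) ^^ k) w)) ` LC.Z (n - k)"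
    unfolding deg image_image using Lk by (intro image_cong) auto
  have eq: "cls z = cls (((form_wedge \<omega>) ^^ k) w) \<longleftrightarrow> z - ((form_wedge \<omega>) ^^ k) w \<in> LC.Bd (n + k)"
    if "z \<in> LC.Z (n + k)" "w \<in> LC.Z (n - k)" for z w
    using cls_eq_iff[of "((form_wedge \<omega>) ^^ k) w" z] cohomologous_deg[OF LZ[OF that(2)] that(1)] that LZ[OF that(2)]
    by (auto simp: Z_iff)
  have "(lefschetz A \<Gamma> \<omega> ^^ k) ` inv_cohomology_deg A \<Gamma> (n - k) = inv_cohomology_deg A \<Gamma> (n + k) \<longleftrightarrow>
     (\<forall>z\<in>LC.Z (n + k). \<exists>w\<in>LC.Z (n - k). cls z = cls (((form_wedge \<omega>) ^^ k) w))"
    unfolding img deg[of "n + k"] using LZ by blast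
  then show ?thesis using eq by auto
qed

lemma harmonic_iff_hard_lefschetz:
  "(\<forall>C \<in> inv_cohomology A \<Gamma>. \<exists>\<xi>\<in>C. harmonic A \<Gamma> \<omega> n \<xi>) \<longleftrightarrow>
   (\<forall>k \<in> {0..n}. (lefschetz A \<Gamma> \<omega> ^^ k) ` inv_cohomology_deg A \<Gamma> (n - k) = inv_cohomology_deg A \<Gamma> (n + k))"
  unfolding harmonic_representatives_iff LC.harmonic_iff_lefschetz using lefschetz_surjective_iff by auto

end

theorem theorem3:
  fixes X :: "'a topology"
    and A :: "('a, 'e::real_inner) chart set"
    and \<Gamma> :: "'a local_map set"
    and \<omega> :: "('a, 'e) form"
    and n :: nat
  assumes "smooth_manifold (2 * n) X A"
    and "pseudogroup X A \<Gamma>"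
    and "inv_symplectic A \<Gamma> \<omega>"
  shows "(\<forall>C \<in> inv_cohomology A \<Gamma>. \<exists>\<xi>\<in>C. harmonic A \<Gamma> \<omega> n \<xi>) \<longleftrightarrow>
         (\<forall>k \<in> {0..n}. (lefschetz A \<Gamma> \<omega> ^^ k) ` inv_cohomology_deg A \<Gamma> (n - k)
                        = inv_cohomology_deg A \<Gamma> (n + k))"
proof -
  have "has_dimension TYPE('e) (2 * n)" using assms(1) by (simp add: smooth_manifold_def)
  then obtain B :: "'e set" where "orthonormal_basis B" "card B = 2 * n" by (rule orthonormal_basis_exists)
  with assms interpret lefschetz_manifold X A \<Gamma> \<omega> n B by (intro lefschetz_manifold.intro)
  show ?thesis by (rule harmonic_iff_hard_lefschetz)
qed

end
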